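(* Let $d\ge1$, let $D\in\{2d,2d+1\}$, and let $\Sigma\subset\mathbb R^{D+1}$ be the cone of coefficient vectors, in the basis $\mathbf q=(q_0,\dots,q_D)$ of Chebyshev polynomials of the first kind, of univariate polynomials of degree at most $D$ that are nonnegative on $[-1,1]$ (represented as weighted sums of squares as in the context). Let $\mathbf 1$ be the coefficient vector of the constant one polynomial. Then: 1. $k_1^{\mathbf 1}:=\min\{\mathbf 1^{\mathrm T}\mathbf v\mid\mathbf v\in\Sigma^*,\ \|\mathbf v\|_\infty=1\}\ge1$. 2. There exist finitely many points $z_1,\dots,z_s\in[-1,1]$, unisolvent for the polynomials of degree at most $D$, and $\alpha_1,\dots,\alpha_s>0$ such that $\mathbf M=\sum_{i=1}^s\alpha_i\,\mathbf q(z_i)\mathbf q(z_i)^{\mathrm T}$ satisfies $\operatorname{cond}(\mathbf M)\le4$. 3. For every $\mathbf t\in\Sigma^\circ$ and $\varepsilon>0$ with $\mathbf t-\varepsilon\mathbf 1$ on the boundary of $\Sigma$, there exists an integer dual certificate $\overline{\mathbf y}\in(\Sigma^* )^\circ$ of $\mathbf t$ with $$\|\overline{\mathbf y}\|_\infty\le\frac12+\frac{2d+2}{\varepsilon}\left\lceil3\sqrt{2d+2}\,\|\mathbf t\|_2\right\rceil$$ and $$\log\|\overline{\mathbf y}\|_\infty\le C\bigl(1+\log d+\log\|\mathbf t\|_2+\log(1/\varepsilon)\bigr)$$ with an absolute constant $C$ (independent of $d,\mathbf t,\varepsilon$).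
   Context: $\mathcal V_k$ denotes univariate real polynomials of degree at most $k$; $\Sigma_{2k}$ the sums of squares of elements of $\mathcal V_k$. If $D=2d$: weights $w_1=1$, $w_2=1-z^2$, degrees $(d_1,d_2)=(d,d-1)$; if $D=2d+1$: weights $w_1=1-z$, $w_2=1+z$, degrees $(d_1,d_2)=(d,d)$. In both cases $\Sigma=\{w_1\sigma_1+w_2\sigma_2:\sigma_i\in\Sigma_{2d_i}\}$, which is exactly the cone of polynomials in $\mathcal V_D$ nonnegative on $[-1,1]$. Polynomials in $\mathcal V_D$ are identified with coefficient vectors in the basis $\mathbf q$; put $U=D+1$. $\Sigma^*=\{\mathbf y\in\mathbb R^U:\mathbf x^{\mathrm T}\mathbf y\ge0\ \forall\mathbf x\in\Sigma\}$. Fix any ordered bases $\mathbf p_i$ of $\mathcal V_{d_i}$; $\Lambda_i$ is the unique linear map from $\mathbb R^U$ to symmetric matrices with $\Lambda_i(\mathbf q(z))=w_i(z)\mathbf p_i(z)\mathbf p_i(z)^{\mathrm T}$ for all $z$, and $\Lambda=\Lambda_1\oplus\Lambda_2$. Then $\Sigma^*=\{\mathbf x:\Lambda(\mathbf x)\succcurlyeq0\}$ and $(\Sigma^* )^\circ=\{\mathbf x:\Lambda(\mathbf x)\succ0\}$; $^\circ$ denotes interior. Let $f(\mathbf x)=-\ln\det\Lambda(\mathbf x)$ on $(\Sigma^* )^\circ$, with (positive definite) Hessian $H$. A vector $\mathbf x\in(\Sigma^* )^\circ$ is a dual certificate of $\mathbf s\in\Sigma$ if $H(\mathbf x)^{-1}\mathbf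 s\in\Sigma^*$. $\operatorname{cond}(\mathbf M)=\lambda_{\max}(\mathbf M)/\lambda_{\min}(\mathbf M)$. A point set is unisolvent for a space of polynomials if every polynomial in it is uniquely determined by its values on the set. *)

theory Defs
  imports
    "HOL-Analysis.Analysis"
    "HOL-Computational_Algebra.Polynomial"
    "Jordan_Normal_Form.Gauss_Jordan_Elimination"
    "Jordan_Normal_Form.Determinant"
    "Jordan_Normal_Form.Spectral_Radius"
begin

(* Vectors and matrices are those of Jordan_Normal_Form: their dimension is a value, so the
   degree can be quantified after an absolute constant has been chosen. *)

unbundle no vec_syntax
unbundle no inner_syntax
hide_const (open) Module.smult

section \<open>Norms, topology, second derivatives and condition numbers\<close>

definition l2_norm :: "real vec \<Rightarrow> real" where
  "l2_norm v = L2_set (\<lambda>i. v $ i) {..<dim_vec v}"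

(* Meaningful in positive dimension only. *)
definition linf_norm :: "real vec \<Rightarrow> real" where
  "linf_norm v = Max ((\<lambda>i. \<bar>v $ i\<bar>) ` {..<dim_vec v})"

(* Not l2_norm (x - y): Metric_space wants symmetry also outside of the carrier, where the
   dimensions of x and y may differ. *)
definition euclid_dist :: "nat \<Rightarrow> real vec \<Rightarrow> real vec \<Rightarrow> real" where
  "euclid_dist n x y = L2_set (\<lambda>i. x $ i - y $ i) {..<n}"

definition euclid_top :: "nat \<Rightarrow> real vec topology" where
  "euclid_top n = Metric_space.mtopology (carrier_vec n) (euclid_dist n)"

lemma euclid_dist_eq_l2_norm:
  assumes "x \<in> carrier_vec n" "y \<in> carrier_vec n"
  shows "euclid_dist n x y = l2_norm (x - y)"
  using assms unfolding euclid_dist_def l2_norm_def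
  by (auto intro!: L2_set_cong)

lemma Metric_space_euclid: "Metric_space (carrier_vec n) (euclid_dist n)"
proof
  show "0 \<le> euclid_dist n x y" for x y
    by (simp add: euclid_dist_def L2_set_nonneg)
  show "euclid_dist n x y = euclid_dist n y x" for x y
    unfolding euclid_dist_def L2_set_def by (simp add: power2_commute)
  show "(euclid_dist n x y = 0) = (x = y)"
    if "x \<in> carrier_vec n" "y \<in> carrier_vec n" for x y
    using that by (auto simp: euclid_dist_def L2_set_eq_0_iff)
  show "euclid_dist n x z \<le> euclid_dist n x y + euclid_dist n y z"
    if "x \<in> carrier_vec n" "y \<in> carrier_vec n" "z \<in> carrier_vec n" for x y z
    using L2_set_triangle_ineq[of "\<lambda>i. x $ i - y $ i" "\<lambda>i. y $ i - z $ i" "{..<n}"]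
    by (simp add: euclid_dist_def)
qed

definition hessian :: "nat \<Rightarrow> (real vec \<Rightarrow> real) \<Rightarrow> real vec \<Rightarrow> real mat" where
  "hessian n f x = mat n n (\<lambda>(i, j).
     deriv (\<lambda>r. deriv (\<lambda>s. f (x + r \<cdot>\<^sub>v unit_vec n i + s \<cdot>\<^sub>v unit_vec n j)) 0) 0)"

(* For symmetric matrices, whose eigenvalues are all real. *)
definition cond_number :: "real mat \<Rightarrow> real" where
  "cond_number M = Max (spectrum M) / Min (spectrum M)"

section \<open>Chebyshev polynomials and polynomials as coefficient vectors\<close>

fun cheb :: "nat \<Rightarrow> real poly" where
  "cheb 0 = 1"
| "cheb (Suc 0) = [:0, 1:]"
| "cheb (Suc (Suc n)) = [:0, 2:] * cheb (Suc n) - cheb n"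

lemma poly_cheb_cos: "poly (cheb n) (cos t) = cos (real n * t)"
proof (induction n rule: cheb.induct)
  case (3 n)
  define a where "a = (real n + 1) * t"
  have "cos (a + t) + cos (a - t) = 2 * cos t * cos a"
    by (simp add: cos_add cos_diff)
  moreover have "a + t = real (Suc (Suc n)) * t" "a - t = real n * t" "a = real (Suc n) * t"
    by (simp_all add: a_def algebra_simps)
  ultimately show ?case
    using 3 by (simp del: of_nat_Suc)
qed auto

definition cheb_vec :: "nat \<Rightarrow> real \<Rightarrow> real vec" where
  "cheb_vec D z = vec (D + 1) (\<lambda>i. poly (cheb i) z)"

definition poly_of_vec :: "real vec \<Rightarrow> real poly" where
  "poly_of_vec x = (\<Sum>i<dim_vec x. smult (x $ i) (cheb i))"

(* Coefficient vector of the constant polynomial 1, which is the zeroth Chebyshev polynomial. *)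
definition one_coeffs :: "nat \<Rightarrow> real vec" where
  "one_coeffs D = unit_vec (D + 1) 0"

lemma poly_of_vec_one: "poly_of_vec (one_coeffs D) = 1"
proof -
  have "poly_of_vec (one_coeffs D) = (\<Sum>i<Suc D. if i = 0 then 1 else 0)"
    unfolding poly_of_vec_def one_coeffs_def by (intro sum.cong) (auto simp: unit_vec_def)
  then show ?thesis by simp
qed

definition polys_upto :: "nat \<Rightarrow> real poly set" where
  "polys_upto k = {p. degree p \<le> k}"

interpretation poly_vs: vector_space "smult :: real \<Rightarrow> real poly \<Rightarrow> real poly"
  by unfold_locales (simp_all add: smult_add_right smult_add_left)

definition ordered_basis :: "nat \<Rightarrow> real poly list \<Rightarrow> bool" where
  "ordered_basis k ps \<longleftrightarrow>
     distinct ps \<and> poly_vs.independent (set ps) \<and> poly_vs.span (set ps) = polys_upto k"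

definition unisolvent :: "nat \<Rightarrow> real set \<Rightarrow> bool" where
  "unisolvent k Z \<longleftrightarrow>
     (\<forall>p \<in> polys_upto k. \<forall>r \<in> polys_upto k. (\<forall>z \<in> Z. poly p z = poly r z) \<longrightarrow> p = r)"

section \<open>The weighted sums-of-squares cone and its dual\<close>

definition weight1 :: "nat \<Rightarrow> real poly" where
  "weight1 D = (if even D then 1 else [:1, -1:])"

definition weight2 :: "nat \<Rightarrow> real poly" where
  "weight2 D = (if even D then [:1, 0, -1:] else [:1, 1:])"

definition deg1 :: "nat \<Rightarrow> nat" where
  "deg1 D = D div 2"

definition deg2 :: "nat \<Rightarrow> nat" where
  "deg2 D = (if even D then D div 2 - 1 else D div 2)"

definition sos :: "nat \<Rightarrow> real poly set" where
  "sos k = {\<Sum>p\<leftarrow>ps. p\<^sup>2 | ps. set ps \<subseteq> polys_upto k}"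

definition Sigma_cone :: "nat \<Rightarrow> real vec set" where
  "Sigma_cone D = {x \<in> carrier_vec (D + 1). \<exists>s1 \<in> sos (deg1 D). \<exists>s2 \<in> sos (deg2 D).
     poly_of_vec x = weight1 D * s1 + weight2 D * s2}"

definition Sigma_dual :: "nat \<Rightarrow> real vec set" where
  "Sigma_dual D = {y \<in> carrier_vec (D + 1). \<forall>x \<in> Sigma_cone D. 0 \<le> x \<bullet> y}"

section \<open>The barrier function and dual certificates\<close>

(* L is the linear map into the symmetric matrices belonging to the weight w and the ordered
   basis ps. These conditions determine L on carrier_vec (D + 1), the only vectors on which it
   is used; for existence see Lambda_map_exists below. *)
definition Lambda_map :: "nat \<Rightarrow> real poly \<Rightarrow> real poly list \<Rightarrow> (real vec \<Rightarrow> real mat) \<Rightarrow> bool" where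
  "Lambda_map D w ps L \<longleftrightarrow>
     (\<forall>x \<in> carrier_vec (D + 1). L x \<in> carrier_mat (length ps) (length ps) \<and> (L x)\<^sup>T = L x) \<and>
     (\<forall>x \<in> carrier_vec (D + 1). \<forall>y \<in> carrier_vec (D + 1). L (x + y) = L x + L y) \<and>
     (\<forall>x \<in> carrier_vec (D + 1). \<forall>c. L (c \<cdot>\<^sub>v x) = c \<cdot>\<^sub>m L x) \<and>
     (\<forall>z. L (cheb_vec D z) =
        mat (length ps) (length ps) (\<lambda>(a, b). poly w z * (poly (ps ! a) z * poly (ps ! b) z)))"

definition Lambda_sum :: "(real vec \<Rightarrow> real mat) \<Rightarrow> (real vec \<Rightarrow> real mat) \<Rightarrow> real vec \<Rightarrow> real mat" where
  "Lambda_sum L1 L2 x = diag_block_mat [L1 x, L2 x]"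

definition barrier :: "(real vec \<Rightarrow> real mat) \<Rightarrow> (real vec \<Rightarrow> real mat) \<Rightarrow> real vec \<Rightarrow> real" where
  "barrier L1 L2 x = - ln (det (Lambda_sum L1 L2 x))"

definition dual_certificate ::
  "nat \<Rightarrow> (real vec \<Rightarrow> real mat) \<Rightarrow> (real vec \<Rightarrow> real mat) \<Rightarrow> real vec \<Rightarrow> real vec \<Rightarrow> bool" where
  "dual_certificate D L1 L2 s x \<longleftrightarrow>
     s \<in> Sigma_cone D \<and> x \<in> euclid_top (D + 1) interior_of Sigma_dual D \<and>
     the (mat_inverse (hessian (D + 1) (barrier L1 L2) x)) *\<^sub>v s \<in> Sigma_dual D"

lemma degree_cheb: "degree (cheb n) = n \<and> cheb n \<noteq> 0"
proof (induction n rule: cheb.induct)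
  case (3 n)
  have "degree ([:0, 2:] * cheb (Suc n)) = Suc (Suc n)"
    using 3 by (subst degree_mult_eq) auto
  moreover have "degree (cheb n) < Suc (Suc n)"
    using 3 by simp
  ultimately have "degree (cheb (Suc (Suc n))) = Suc (Suc n)"
    using degree_add_eq_left[of "- cheb n" "[:0, 2:] * cheb (Suc n)"]
    by (simp only: cheb.simps degree_minus add_uminus_conv_diff)
  then show ?case by force
qed auto

lemma cheb_expansion:
  assumes "degree p \<le> D"
  shows "\<exists>c. p = (\<Sum>i<Suc D. smult (c i) (cheb i))"
  using assms
proof (induction D arbitrary: p)
  case 0
  then obtain a where "p = [:a:]" by (metis degree_eq_zeroE le_zero_eq)
  then have "p = (\<Sum>i<Suc 0. smult a (cheb i))" by simp
  then show ?case by (intro exI[of _ "\<lambda>_. a"])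
next
  case (Suc D)
  let ?T = "cheb (Suc D)"
  have dc: "degree ?T = Suc D"
    using degree_cheb by blast
  have lc: "coeff ?T (Suc D) \<noteq> 0"
    using degree_cheb[of "Suc D"] leading_coeff_0_iff[of ?T] by (simp only: dc not_False_eq_True)
  define a where "a = coeff p (Suc D) / coeff ?T (Suc D)"
  let ?r = "p - smult a ?T"
  have "coeff ?r (Suc D) = 0"
    using lc by (simp only: a_def coeff_diff coeff_smult) simp
  moreover have "coeff ?r i = 0" if "i > Suc D" for i
    using coeff_eq_0[of p i] coeff_eq_0[of ?T i] Suc.prems dc that by simp
  ultimately have "coeff ?r i = 0" if "i > D" for i
    using that by (cases "i = Suc D") auto
  then have "degree ?r \<le> D"
    by (intro degree_le) blast
  from Suc.IH[OF this] obtain c where c: "?r = (\<Sum>i<Suc D. smult (c i) (cheb i))" by blast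
  define c' where "c' = c(Suc D := a)"
  have "(\<Sum>i<Suc D. smult (c' i) (cheb i)) = ?r"
    unfolding c c'_def by (intro sum.cong) (auto simp del: cheb.simps)
  then have "p = (\<Sum>i<Suc (Suc D). smult (c' i) (cheb i))"
    by (subst sum.lessThan_Suc) (simp add: c'_def del: cheb.simps sum.lessThan_Suc)
  then show ?case by blast
qed

lemma Lambda_map_exists:
  assumes "ordered_basis k ps" and "degree w + 2 * k \<le> D"
  shows "\<exists>L. Lambda_map D w ps L"
proof -
  let ?n = "length ps"
  have "\<exists>c. p = (\<Sum>i<Suc D. smult (c i) (cheb i))" if "degree p \<le> D" for p
    using cheb_expansion that by blast
  then obtain c where c: "degree p \<le> D \<Longrightarrow> p = (\<Sum>i<Suc D. smult (c p i) (cheb i))" for p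
    by metis
  define L where "L x = mat ?n ?n (\<lambda>(a, b). \<Sum>i<Suc D. x $ i * c (w * (ps ! a * ps ! b)) i)"
    for x :: "real vec"
  have deg: "degree (ps ! a) \<le> k" if "a < ?n" for a
    using assms(1) that poly_vs.span_superset[of "set ps"] nth_mem[OF that]
    unfolding ordered_basis_def polys_upto_def by blast
  have "degree (w * (ps ! a * ps ! b)) \<le> D" if "a < ?n" "b < ?n" for a b
    using deg[OF that(1)] deg[OF that(2)] assms(2)
      degree_mult_le[of w "ps ! a * ps ! b"] degree_mult_le[of "ps ! a" "ps ! b"]
    by linarith
  then have "poly (w * (ps ! a * ps ! b)) z =
      (\<Sum>i<Suc D. poly (cheb i) z * c (w * (ps ! a * ps ! b)) i)" if "a < ?n" "b < ?n" for a b z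
    using that by (subst c) (auto simp: poly_sum mult.commute)
  then have cheb: "L (cheb_vec D z) =
      mat ?n ?n (\<lambda>(a, b). poly w z * (poly (ps ! a) z * poly (ps ! b) z))" for z
    unfolding L_def cheb_vec_def by (intro eq_matI) auto
  have "L x \<in> carrier_mat ?n ?n" "(L x)\<^sup>T = L x" for x
    unfolding L_def by (auto intro!: eq_matI simp: mult.commute)
  moreover have "L (x + y) = L x + L y"
    if "x \<in> carrier_vec (D + 1)" "y \<in> carrier_vec (D + 1)" for x y
    unfolding L_def
    by (rule eq_matI) (use that in \<open>auto simp: sum.distrib algebra_simps\<close>)
  moreover have "L (e \<cdot>\<^sub>v x) = e \<cdot>\<^sub>m L x" if "x \<in> carrier_vec (D + 1)" for x e
    unfolding L_def
    by (rule eq_matI) (use that in \<open>auto simp: sum_distrib_left algebra_simps\<close>)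
  ultimately have "Lambda_map D w ps L"
    unfolding Lambda_map_def using cheb by blast
  then show ?thesis by blast
qed

lemma degree_weights:
  assumes "D \<ge> 2"
  shows "degree (weight1 D) + 2 * deg1 D \<le> D" "degree (weight2 D) + 2 * deg2 D \<le> D"
  using assms by (auto simp: weight1_def weight2_def deg1_def deg2_def elim!: evenE oddE)

end

(* The negative gradient of the barrier takes the value t at a multiple y of the maximiser of
   det Lambda on a slice t.y = const of the dual cone. Pairing with t - eps 1 bounds y_0, and
   1 + T_i, 1 - T_i in Sigma give |y_i| <= y_0 on the dual cone, so y is small. The local norm of the
   barrier at y is controlled by the trace of the Hessian, which is estimated through the Chebyshev
   nodes: there the Hessian form is at most t(z)^2, and discrete orthogonality makes the sum over the
   nodes diagonal. Hence, after scaling y by a multiple of |t|, rounding moves it by less than 1 in its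
   local norm, and every point at local distance less than 1 from y is a dual certificate of t. *)
theory Submission
  imports Defs
begin

section \<open>Traces, Frobenius products and definite matrices\<close>

text \<open>The obstacle is to invert the gradient map of the barrier at \<open>t\<close>.
  Describing the preimage as a constrained maximiser reduces this to compactness, and the bound of
  all coordinates by the zeroth one is what makes the slices compact. Local norms are handled by
  whitening: a congruence \<open>A\<close> turns \<open>L y\<close> into the identity, so that the
  local norm at \<open>y\<close> is a plain Frobenius norm, and its unit ball lies in the cone
  because a matrix at Frobenius distance less than 1 from the identity is positive definite. That
  the whole unit ball consists of certificates rests on an exact symmetry:
  \<open>G * G\<^sup>T\<close> and \<open>G\<^sup>T * G\<close> have the same distance from the
  identity, so passing from the local norm at \<open>y\<close> to the one at the rounded point loses
  nothing. With the scale \<open>3 * sqrt (2 * d + 2) * l2_norm t\<close>, the Hessian trace is at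
  most \<open>2 / (9 * (2 * d + 2))\<close>, while rounding moves \<open>y\<close> by a vector of
  squared length at most \<open>(2 * d + 2) / 4\<close>. The squared local distance is thus at most
  1/18, which also leaves room for a neighbourhood inside the dual cone.\<close>

definition tr :: "real mat \<Rightarrow> real" where
  "tr A = (\<Sum>i<dim_row A. A $$ (i, i))"

definition frob :: "real mat \<Rightarrow> real mat \<Rightarrow> real" where
  "frob A B = (\<Sum>i<dim_row A. \<Sum>j<dim_col A. A $$ (i, j) * B $$ (i, j))"

definition pos_semidef :: "real mat \<Rightarrow> bool" where
  "pos_semidef M \<longleftrightarrow> (\<forall>u \<in> carrier_vec (dim_row M). 0 \<le> u \<bullet> (M *\<^sub>v u))"

definition pos_def :: "real mat \<Rightarrow> bool" where
  "pos_def M \<longleftrightarrow> (\<forall>u \<in> carrier_vec (dim_row M). u \<noteq> 0\<^sub>v (dim_row M) \<longrightarrow> 0 < u \<bullet> (M *\<^sub>v u))"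

lemma index_mult_mat_sum:
  assumes "A \<in> carrier_mat n m" "B \<in> carrier_mat m k" "i < n" "j < k"
  shows "(A * B) $$ (i, j) = (\<Sum>l<m. A $$ (i, l) * B $$ (l, j))"
  using assms by (auto simp: scalar_prod_def atLeast0LessThan)

lemma quad_form_sum:
  assumes "M \<in> carrier_mat n m" "u \<in> carrier_vec n" "v \<in> carrier_vec m"
  shows "u \<bullet> (M *\<^sub>v v) = (\<Sum>i<n. \<Sum>j<m. u $ i * M $$ (i, j) * v $ j)"
  using assms
  by (auto simp: scalar_prod_def atLeast0LessThan sum_distrib_left mult.assoc intro!: sum.cong)

lemma tr_mult_comm:
  assumes "A \<in> carrier_mat n m" "B \<in> carrier_mat m n"
  shows "tr (A * B) = tr (B * A)"
proof -
  have "tr (A * B) = (\<Sum>i<n. \<Sum>l<m. A $$ (i, l) * B $$ (l, i))"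
    unfolding tr_def using assms
    by (intro sum.cong) (auto simp: index_mult_mat_sum[OF assms] simp del: index_mult_mat(1))
  also have "\<dots> = (\<Sum>l<m. \<Sum>i<n. B $$ (l, i) * A $$ (i, l))"
    by (subst sum.swap) (simp add: mult.commute)
  also have "\<dots> = tr (B * A)"
    unfolding tr_def using assms
    by (intro sum.cong) (auto simp: index_mult_mat_sum[OF assms(2,1)] simp del: index_mult_mat(1))
  finally show ?thesis .
qed

lemma tr_add: "A \<in> carrier_mat n n \<Longrightarrow> B \<in> carrier_mat n n \<Longrightarrow> tr (A + B) = tr A + tr B"
  by (auto simp: tr_def sum.distrib)

lemma tr_smult: "A \<in> carrier_mat n n \<Longrightarrow> tr (c \<cdot>\<^sub>m A) = c * tr A"
  by (auto simp: tr_def sum_distrib_left)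

lemma tr_one: "tr (1\<^sub>m n) = real n"
  by (simp add: tr_def)

lemma frob_eq_tr:
  assumes "A \<in> carrier_mat n m" "B \<in> carrier_mat n m"
  shows "frob A B = tr (A\<^sup>T * B)"
proof -
  have "tr (A\<^sup>T * B) = (\<Sum>j<m. \<Sum>i<n. A $$ (i, j) * B $$ (i, j))"
    unfolding tr_def using assms by (intro sum.cong) (auto simp: scalar_prod_def atLeast0LessThan)
  also have "\<dots> = frob A B"
    unfolding frob_def using assms by (subst sum.swap) simp
  finally show ?thesis by simp
qed

lemma frob_pairs:
  assumes "A \<in> carrier_mat n m"
  shows "frob A B = (\<Sum>p\<in>{..<n} \<times> {..<m}. A $$ p * B $$ p)"
  using assms by (auto simp: frob_def sum.cartesian_product intro!: sum.cong)

lemma frob_add_left: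
  "A \<in> carrier_mat n m \<Longrightarrow> B \<in> carrier_mat n m \<Longrightarrow> frob (A + B) C = frob A C + frob B C"
  by (auto simp: frob_def sum.distrib algebra_simps)

lemma frob_smult_left: "A \<in> carrier_mat n m \<Longrightarrow> frob (c \<cdot>\<^sub>m A) C = c * frob A C"
  by (auto simp: frob_def sum_distrib_left mult.assoc)

lemma frob_commute:
  "A \<in> carrier_mat n m \<Longrightarrow> B \<in> carrier_mat n m \<Longrightarrow> frob A B = frob B A"
  by (auto simp: frob_def mult.commute)

lemma frob_self_nonneg: "0 \<le> frob A A"
  by (auto simp: frob_def intro!: sum_nonneg)

lemma frob_self_eq_0:
  assumes "A \<in> carrier_mat n m" "frob A A = 0"
  shows "A = 0\<^sub>m n m"
proof -
  have "(\<Sum>p\<in>{..<n} \<times> {..<m}. A $$ p * A $$ p) = 0"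
    using assms by (simp add: frob_pairs)
  then have "\<forall>p\<in>{..<n} \<times> {..<m}. A $$ p * A $$ p = 0"
    by (subst (asm) sum_nonneg_eq_0_iff) auto
  then show ?thesis
    using assms by (intro eq_matI) auto
qed

lemma frob_Cauchy_Schwarz:
  assumes "A \<in> carrier_mat n m" "B \<in> carrier_mat n m"
  shows "(frob A B)\<^sup>2 \<le> frob A A * frob B B"
  using Cauchy_Schwarz_ineq_sum[of "\<lambda>p. A $$ p" "\<lambda>p. B $$ p" "{..<n} \<times> {..<m}"] assms
  by (simp add: frob_pairs power2_eq_square)

lemma frob_one_left:
  assumes "A \<in> carrier_mat n n"
  shows "frob (1\<^sub>m n) A = tr A"
  using assms frob_eq_tr[of "1\<^sub>m n" n n A] by simp

text \<open>The form is the Frobenius product of \<open>V\<close> with the rank one matrix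
  \<open>W\<close> of products \<open>u $ i * u $ j\<close>, whose Frobenius norm is
  \<open>u \<bullet> u\<close>; Cauchy-Schwarz does the rest.\<close>

lemma quad_form_le_frob:
  assumes V: "V \<in> carrier_mat n n" and u: "u \<in> carrier_vec n"
  shows "\<bar>u \<bullet> (V *\<^sub>v u)\<bar> \<le> sqrt (frob V V) * (u \<bullet> u)"
proof -
  define W where "W = mat n n (\<lambda>(i, j). u $ i * u $ j)"
  have W: "W \<in> carrier_mat n n"
    by (simp add: W_def)
  have 1: "u \<bullet> (V *\<^sub>v u) = frob V W"
    using assms unfolding W_def frob_def
    by (subst quad_form_sum[OF V u u]) (auto simp: algebra_simps intro!: sum.cong)
  have 2: "frob W W = (u \<bullet> u)\<^sup>2"
    using u unfolding W_def frob_def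
    by (auto simp: scalar_prod_def atLeast0LessThan power2_eq_square sum_product algebra_simps
        intro!: sum.cong)
  have 3: "0 \<le> u \<bullet> u"
    by (auto simp: scalar_prod_def intro!: sum_nonneg)
  have "\<bar>frob V W\<bar> \<le> sqrt (frob V V * frob W W)"
    by (intro real_le_rsqrt) (simp add: frob_Cauchy_Schwarz[OF V W])
  then show ?thesis
    using 3 by (simp add: 1 2 real_sqrt_mult)
qed

lemma self_scalar_prod_pos:
  fixes u :: "real vec"
  assumes "u \<in> carrier_vec n" "u \<noteq> 0\<^sub>v n"
  shows "0 < u \<bullet> u"
proof -
  obtain i where i: "i < n" "u $ i \<noteq> 0"
    using assms by (metis carrier_vecD eq_vecI index_zero_vec)
  have "0 < (u $ i)\<^sup>2" using i by simp
  also have "\<dots> \<le> (\<Sum>i\<in>{0..<n}. (u $ i)\<^sup>2)"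
    using i by (intro member_le_sum) auto
  finally show ?thesis
    using assms by (simp add: scalar_prod_def power2_eq_square)
qed

text \<open>The previous estimate shows that \<open>V\<close> cannot outweigh the identity in any
  direction. After whitening, this becomes the inclusion of a local unit ball in the cone.\<close>

lemma pos_def_one_add:
  assumes V: "V \<in> carrier_mat n n" and "frob V V < 1"
  shows "pos_def (1\<^sub>m n + V)"
  unfolding pos_def_def
proof (intro ballI impI)
  fix u :: "real vec" assume "u \<in> carrier_vec (dim_row (1\<^sub>m n + V))" and nz: "u \<noteq> 0\<^sub>v (dim_row (1\<^sub>m n + V))"
  then have u: "u \<in> carrier_vec n" and nz: "u \<noteq> 0\<^sub>v n"
    using V by auto
  have "u \<bullet> ((1\<^sub>m n + V) *\<^sub>v u) = u \<bullet> u + u \<bullet> (V *\<^sub>v u)"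
    using u V by (simp add: add_mult_distrib_mat_vec[of _ n n] scalar_prod_add_distrib[of _ n])
  moreover have "sqrt (frob V V) * (u \<bullet> u) < 1 * (u \<bullet> u)"
    using self_scalar_prod_pos[OF u nz] assms by (intro mult_strict_right_mono) auto
  ultimately show "0 < u \<bullet> ((1\<^sub>m n + V) *\<^sub>v u)"
    using quad_form_le_frob[OF V u] by linarith
qed

lemma pos_def_imp_pos_semidef:
  assumes "M \<in> carrier_mat n n" "pos_def M"
  shows "pos_semidef M"
  unfolding pos_semidef_def
proof
  fix u :: "real vec" assume u: "u \<in> carrier_vec (dim_row M)"
  show "0 \<le> u \<bullet> (M *\<^sub>v u)"
    using assms u by (cases "u = 0\<^sub>v n") (auto simp: pos_def_def less_imp_le)
qed

section \<open>Congruence transformations and definiteness\<close>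

lemma congruence_quad_form:
  fixes u :: "real vec"
  assumes "M \<in> carrier_mat n n" "A \<in> carrier_mat n m" "u \<in> carrier_vec m"
  shows "u \<bullet> ((A\<^sup>T * M * A) *\<^sub>v u) = (A *\<^sub>v u) \<bullet> (M *\<^sub>v (A *\<^sub>v u))"
proof -
  have "(A\<^sup>T * M * A) *\<^sub>v u = A\<^sup>T *\<^sub>v (M *\<^sub>v (A *\<^sub>v u))"
    using assms by (simp add: assoc_mult_mat[of _ m n _ n _ m] assoc_mult_mat_vec[of _ m n _ m]
        assoc_mult_mat_vec[of _ n n _ m])
  then have "u \<bullet> ((A\<^sup>T * M * A) *\<^sub>v u) = (A\<^sup>T *\<^sub>v (M *\<^sub>v (A *\<^sub>v u))) \<bullet> u"
    using assms comm_scalar_prod[of u m "A\<^sup>T *\<^sub>v (M *\<^sub>v (A *\<^sub>v u))"] by simp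
  also have "\<dots> = (M *\<^sub>v (A *\<^sub>v u)) \<bullet> (A *\<^sub>v u)"
    using assms by (intro transpose_vec_mult_scalar[of _ n m]) auto
  also have "\<dots> = (A *\<^sub>v u) \<bullet> (M *\<^sub>v (A *\<^sub>v u))"
    using assms by (intro comm_scalar_prod[of _ n]) auto
  finally show ?thesis .
qed

lemma pos_semidef_congruence:
  assumes "M \<in> carrier_mat n n" "A \<in> carrier_mat n m" "pos_semidef M"
  shows "pos_semidef (A\<^sup>T * M * A)"
  using assms congruence_quad_form[OF assms(1,2)] unfolding pos_semidef_def by auto

text \<open>The right inverse \<open>B\<close> makes \<open>A\<close> onto, so the pulled back form
  sees every vector.\<close>

lemma pos_def_congruence_inv:
  assumes M: "M \<in> carrier_mat n n" and A: "A \<in> carrier_mat n n" and B: "B \<in> carrier_mat n n"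
    and AB: "A * B = 1\<^sub>m n" and pd: "pos_def (A\<^sup>T * M * A)"
  shows "pos_def M"
  unfolding pos_def_def
proof (intro ballI impI)
  fix u :: "real vec" assume "u \<in> carrier_vec (dim_row M)" "u \<noteq> 0\<^sub>v (dim_row M)"
  then have u: "u \<in> carrier_vec n" "u \<noteq> 0\<^sub>v n"
    using M by auto
  define v where "v = B *\<^sub>v u"
  have v: "v \<in> carrier_vec n" and Av: "A *\<^sub>v v = u"
    using u A B AB by (simp_all add: v_def flip: assoc_mult_mat_vec[of _ n n _ n])
  have "v \<noteq> 0\<^sub>v n"
    using Av u A by auto
  then have "0 < v \<bullet> ((A\<^sup>T * M * A) *\<^sub>v v)"
    using pd A v unfolding pos_def_def by simp
  then show "0 < u \<bullet> (M *\<^sub>v u)"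
    unfolding congruence_quad_form[OF M A v] Av .
qed

lemma pos_def_congruence:
  assumes M: "M \<in> carrier_mat n n" and A: "A \<in> carrier_mat n n" and B: "B \<in> carrier_mat n n"
    and BA: "B * A = 1\<^sub>m n" and pd: "pos_def M"
  shows "pos_def (A\<^sup>T * M * A)"
  unfolding pos_def_def
proof (intro ballI impI)
  fix u :: "real vec"
  assume "u \<in> carrier_vec (dim_row (A\<^sup>T * M * A))" "u \<noteq> 0\<^sub>v (dim_row (A\<^sup>T * M * A))"
  then have u: "u \<in> carrier_vec n" "u \<noteq> 0\<^sub>v n"
    using A by auto
  have "B *\<^sub>v (A *\<^sub>v u) = u"
    using u A B BA by (simp flip: assoc_mult_mat_vec[of _ n n _ n])
  moreover have "B *\<^sub>v 0\<^sub>v n = 0\<^sub>v n"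
    using B by (intro eq_vecI) auto
  ultimately have "A *\<^sub>v u \<noteq> 0\<^sub>v n"
    using u by auto
  then show "0 < u \<bullet> ((A\<^sup>T * M * A) *\<^sub>v u)"
    using pd M A u congruence_quad_form[OF M A u(1)] by (simp add: pos_def_def)
qed

section \<open>Block matrices, symmetric elimination and whitening\<close>

lemma quad_form_diag_block:
  fixes u1 u2 :: "real vec"
  assumes "M1 \<in> carrier_mat n1 n1" "M2 \<in> carrier_mat n2 n2"
    "u1 \<in> carrier_vec n1" "u2 \<in> carrier_vec n2"
  shows "(u1 @\<^sub>v u2) \<bullet> (four_block_mat M1 (0\<^sub>m n1 n2) (0\<^sub>m n2 n1) M2 *\<^sub>v (u1 @\<^sub>v u2)) =
    u1 \<bullet> (M1 *\<^sub>v u1) + u2 \<bullet> (M2 *\<^sub>v u2)"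
proof -
  have "four_block_mat M1 (0\<^sub>m n1 n2) (0\<^sub>m n2 n1) M2 *\<^sub>v (u1 @\<^sub>v u2) = (M1 *\<^sub>v u1) @\<^sub>v (M2 *\<^sub>v u2)"
    using assms by (subst four_block_mat_mult_vec[of _ n1 n1 _ n2 _ n2]) auto
  then show ?thesis
    using assms by (simp add: scalar_prod_append[of _ n1 _ n2])
qed

lemma pos_def_diag_block:
  assumes "M1 \<in> carrier_mat n1 n1" "M2 \<in> carrier_mat n2 n2"
    "pos_def (four_block_mat M1 (0\<^sub>m n1 n2) (0\<^sub>m n2 n1) M2)"
  shows "pos_def M2"
  unfolding pos_def_def
proof (intro ballI impI)
  fix u :: "real vec" assume u: "u \<in> carrier_vec (dim_row M2)" "u \<noteq> 0\<^sub>v (dim_row M2)"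
  have "0\<^sub>v n1 @\<^sub>v u \<noteq> 0\<^sub>v (n1 + n2)"
  proof
    assume eq: "0\<^sub>v n1 @\<^sub>v u = 0\<^sub>v (n1 + n2)"
    have "u $ i = 0" if "i < n2" for i
      using arg_cong[OF eq, of "\<lambda>v. v $ (n1 + i)"] that u assms by simp
    with u assms show False by (auto intro!: eq_vecI)
  qed
  then have "0 < (0\<^sub>v n1 @\<^sub>v u) \<bullet> (four_block_mat M1 (0\<^sub>m n1 n2) (0\<^sub>m n2 n1) M2 *\<^sub>v (0\<^sub>v n1 @\<^sub>v u))"
    using assms u unfolding pos_def_def by simp
  then show "0 < u \<bullet> (M2 *\<^sub>v u)"
    using assms u by (subst (asm) quad_form_diag_block) auto
qed

text \<open>One step of symmetric Gaussian elimination: the last two assumptions say that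
  \<open>B\<close> clears the off-diagonal blocks, and what remains in the corner is the Schur
  complement.\<close>

lemma four_block_congruence_one:
  fixes P Q R S B :: "real mat"
  assumes P: "P \<in> carrier_mat n1 n1" and Q: "Q \<in> carrier_mat n1 n2"
    and R: "R \<in> carrier_mat n2 n1" and S: "S \<in> carrier_mat n2 n2"
    and B: "B \<in> carrier_mat n1 n2"
    and "B\<^sup>T * P + R = 0\<^sub>m n2 n1" "P * B + Q = 0\<^sub>m n1 n2"
  shows "(four_block_mat (1\<^sub>m n1) B (0\<^sub>m n2 n1) (1\<^sub>m n2))\<^sup>T * four_block_mat P Q R S *
     four_block_mat (1\<^sub>m n1) B (0\<^sub>m n2 n1) (1\<^sub>m n2) =
     four_block_mat P (0\<^sub>m n1 n2) (0\<^sub>m n2 n1) (B\<^sup>T * Q + S)"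
proof -
  have T: "(four_block_mat (1\<^sub>m n1) B (0\<^sub>m n2 n1) (1\<^sub>m n2))\<^sup>T =
     four_block_mat (1\<^sub>m n1) (0\<^sub>m n1 n2) (B\<^sup>T) (1\<^sub>m n2)"
    using B by (subst transpose_four_block_mat[of _ n1 n1 _ n2 _ n2]) auto
  have "four_block_mat (1\<^sub>m n1) (0\<^sub>m n1 n2) (B\<^sup>T) (1\<^sub>m n2) * four_block_mat P Q R S =
     four_block_mat P Q (0\<^sub>m n2 n1) (B\<^sup>T * Q + S)"
    using assms
    by (subst mult_four_block_mat[of _ n1 n1 _ n2 _ n2 _ _ n1 _ n2]) auto
  moreover have "four_block_mat P Q (0\<^sub>m n2 n1) (B\<^sup>T * Q + S) *
      four_block_mat (1\<^sub>m n1) B (0\<^sub>m n2 n1) (1\<^sub>m n2) =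
     four_block_mat P (0\<^sub>m n1 n2) (0\<^sub>m n2 n1) (B\<^sup>T * Q + S)"
    using assms by (subst mult_four_block_mat[of _ n1 n1 _ n2 _ n2 _ _ n1 _ n2]) auto
  ultimately show ?thesis
    by (simp add: T)
qed

lemma four_block_congruence_diag:
  fixes P S A B :: "real mat"
  assumes P: "P \<in> carrier_mat n1 n1" and S: "S \<in> carrier_mat n2 n2"
    and A: "A \<in> carrier_mat n1 n1" and B: "B \<in> carrier_mat n2 n2"
  shows "(four_block_mat A (0\<^sub>m n1 n2) (0\<^sub>m n2 n1) B)\<^sup>T * four_block_mat P (0\<^sub>m n1 n2) (0\<^sub>m n2 n1) S *
     four_block_mat A (0\<^sub>m n1 n2) (0\<^sub>m n2 n1) B =
     four_block_mat (A\<^sup>T * P * A) (0\<^sub>m n1 n2) (0\<^sub>m n2 n1) (B\<^sup>T * S * B)"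
proof -
  have T: "(four_block_mat A (0\<^sub>m n1 n2) (0\<^sub>m n2 n1) B)\<^sup>T =
     four_block_mat (A\<^sup>T) (0\<^sub>m n1 n2) (0\<^sub>m n2 n1) (B\<^sup>T)"
    using A B by (subst transpose_four_block_mat[of _ n1 n1 _ n2 _ n2]) auto
  have "four_block_mat (A\<^sup>T) (0\<^sub>m n1 n2) (0\<^sub>m n2 n1) (B\<^sup>T) *
      four_block_mat P (0\<^sub>m n1 n2) (0\<^sub>m n2 n1) S =
     four_block_mat (A\<^sup>T * P) (0\<^sub>m n1 n2) (0\<^sub>m n2 n1) (B\<^sup>T * S)"
    using assms by (subst mult_four_block_mat[of _ n1 n1 _ n2 _ n2 _ _ n1 _ n2]) auto
  moreover have "four_block_mat (A\<^sup>T * P) (0\<^sub>m n1 n2) (0\<^sub>m n2 n1) (B\<^sup>T * S) *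
      four_block_mat A (0\<^sub>m n1 n2) (0\<^sub>m n2 n1) B =
     four_block_mat (A\<^sup>T * P * A) (0\<^sub>m n1 n2) (0\<^sub>m n2 n1) (B\<^sup>T * S * B)"
    using assms by (subst mult_four_block_mat[of _ n1 n1 _ n2 _ n2 _ _ n1 _ n2]) auto
  ultimately show ?thesis
    by (simp add: T)
qed

lemma congruence_mult:
  assumes "M \<in> carrier_mat n n" "A \<in> carrier_mat n n" "B \<in> carrier_mat n n"
  shows "(A * B)\<^sup>T * M * (A * B) = B\<^sup>T * (A\<^sup>T * M * A) * (B :: real mat)"
  using assms by (simp add: transpose_mult[of _ n n _ n] assoc_mult_mat[of _ n n _ n _ n])

text \<open>A Cholesky factorisation by induction on the size. The first diagonal entry is a
  positive pivot, and the Schur complement left after eliminating its row and column inherits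
  symmetry and definiteness. The matrix \<open>A\<close> later takes the place of an inverse square
  root.\<close>

lemma pos_def_congruent_one:
  assumes "M \<in> carrier_mat n n" "M\<^sup>T = M" "pos_def M"
  shows "\<exists>A \<in> carrier_mat n n. A\<^sup>T * M * A = 1\<^sub>m n"
  using assms
proof (induction n arbitrary: M)
  case 0
  then have "1\<^sub>m 0 \<in> carrier_mat 0 0" "(1\<^sub>m 0)\<^sup>T * M * 1\<^sub>m 0 = 1\<^sub>m 0"
    by (auto intro!: eq_matI)
  then show ?case by blast
next
  case (Suc n)
  define a where "a = M $$ (0, 0)"
  define P where "P = mat 1 1 (\<lambda>_. a)"
  define Q where "Q = mat 1 n (\<lambda>(i, j). M $$ (0, Suc j))"
  define C where "C = mat n n (\<lambda>(i, j). M $$ (Suc i, Suc j))"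
  \<comment> \<open>Solves \<open>P * B = - Q\<close>, so that the off-diagonal blocks
    vanish.\<close>
  define B where "B = (- 1 / a) \<cdot>\<^sub>m Q"
  have sym: "M $$ (i, j) = M $$ (j, i)" if "i < Suc n" "j < Suc n" for i j
    using that Suc.prems(1,2) by (metis carrier_matD index_transpose_mat(1))
  have carr: "P \<in> carrier_mat 1 1" "Q \<in> carrier_mat 1 n" "Q\<^sup>T \<in> carrier_mat n 1"
      "C \<in> carrier_mat n n" "B \<in> carrier_mat 1 n"
    by (simp_all add: P_def Q_def C_def B_def)
  have M: "M = four_block_mat P Q (Q\<^sup>T) C"
    using Suc.prems(1) sym
    by (intro eq_matI) (auto simp: P_def Q_def C_def a_def)
  have "unit_vec (Suc n) 0 \<bullet> (M *\<^sub>v unit_vec (Suc n) 0) = a"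
    using Suc.prems(1) by (simp add: a_def)
  then have a: "a > 0"
    using Suc.prems(1,3) unfolding pos_def_def
    by (metis carrier_matD(1) unit_vec_carrier unit_vec_nonzero zero_less_Suc)
  define A where "A = four_block_mat (1\<^sub>m 1) B (0\<^sub>m n 1) (1\<^sub>m n)"
  \<comment> \<open>The inverse of \<open>A\<close>, through which definiteness passes to the
    eliminated matrix.\<close>
  define A' where "A' = four_block_mat (1\<^sub>m 1) (- B) (0\<^sub>m n 1) (1\<^sub>m n)"
  have A: "A \<in> carrier_mat (Suc n) (Suc n)" "A' \<in> carrier_mat (Suc n) (Suc n)"
    using carr unfolding A_def A'_def
    by (metis four_block_carrier_mat one_carrier_mat plus_1_eq_Suc)+
  define S where "S = B\<^sup>T * Q + C"
  have S: "S \<in> carrier_mat n n"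
    using carr by (simp add: S_def)
  have AMA: "A\<^sup>T * M * A = four_block_mat P (0\<^sub>m 1 n) (0\<^sub>m n 1) S"
    unfolding M A_def S_def using carr
  proof (intro four_block_congruence_one)
    show "B\<^sup>T * P + Q\<^sup>T = 0\<^sub>m n 1" "P * B + Q = 0\<^sub>m 1 n"
      using a by (auto intro!: eq_matI simp: B_def P_def Q_def scalar_prod_def)
  qed auto
  have BB: "B + - B = 0\<^sub>m 1 n"
    using carr(5) by (intro eq_matI) auto
  have "A' * A = 1\<^sub>m (Suc n)"
  proof -
    have "A' * A = four_block_mat (1\<^sub>m 1) (0\<^sub>m 1 n) (0\<^sub>m n 1) (1\<^sub>m n)"
      unfolding A_def A'_def using carr BB
      by (subst mult_four_block_mat[of _ 1 1 _ n _ n _ _ 1 _ n]) auto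
    then show ?thesis
      using four_block_one_mat[of 1 n] by simp
  qed
  then have "pos_def (four_block_mat P (0\<^sub>m 1 n) (0\<^sub>m n 1) S)"
    using pos_def_congruence[OF Suc.prems(1) A _ Suc.prems(3)] AMA by simp
  then have "pos_def S"
    using pos_def_diag_block carr S by blast
  moreover have "S\<^sup>T = S"
    using sym by (intro eq_matI) (auto simp: S_def B_def C_def Q_def scalar_prod_def)
  ultimately obtain R where R: "R \<in> carrier_mat n n" "R\<^sup>T * S * R = 1\<^sub>m n"
    using Suc.IH[OF S] by blast
  define E where "E = mat 1 1 (\<lambda>_. 1 / sqrt a)"
  have E: "E \<in> carrier_mat 1 1" "E\<^sup>T * P * E = 1\<^sub>m 1"
    using a by (auto intro!: eq_matI simp: E_def P_def scalar_prod_def)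
  define F where "F = four_block_mat E (0\<^sub>m 1 n) (0\<^sub>m n 1) R"
  have F: "F \<in> carrier_mat (Suc n) (Suc n)"
    unfolding F_def using E R by (metis four_block_carrier_mat plus_1_eq_Suc)
  have "(A * F)\<^sup>T * M * (A * F) = F\<^sup>T * (A\<^sup>T * M * A) * F"
    using Suc.prems(1) A F by (intro congruence_mult) auto
  also have "\<dots> = four_block_mat (E\<^sup>T * P * E) (0\<^sub>m 1 n) (0\<^sub>m n 1) (R\<^sup>T * S * R)"
    unfolding AMA F_def using carr S E R by (intro four_block_congruence_diag) auto
  also have "\<dots> = 1\<^sub>m (Suc n)"
    using four_block_one_mat[of 1 n] E R by simp
  finally show ?case
    using A F by (intro bexI[of _ "A * F"]) auto
qed

text \<open>If \<open>w = M *\<^sub>v u\<close> were nonzero, the form along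
  \<open>u + s \<cdot>\<^sub>v w\<close> would start at 0 with slope
  \<open>2 * (w \<bullet> w)\<close>, and be negative for suitable negative
  \<open>s\<close>.\<close>

lemma pos_semidef_null_vector:
  assumes M: "M \<in> carrier_mat n n" and sym: "M\<^sup>T = M" and psd: "pos_semidef M"
    and u: "u \<in> carrier_vec n" and u0: "u \<bullet> (M *\<^sub>v u) = 0"
  shows "M *\<^sub>v u = 0\<^sub>v n"
proof (rule ccontr)
  define w where "w = M *\<^sub>v u"
  assume "M *\<^sub>v u \<noteq> 0\<^sub>v n"
  then have w: "w \<in> carrier_vec n" and ww: "0 < w \<bullet> w"
    using M u self_scalar_prod_pos[of w n] by (auto simp: w_def)
  define b where "b = w \<bullet> (M *\<^sub>v w)"
  have b: "0 \<le> b"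
    using psd w M by (simp add: b_def pos_semidef_def)
  have uMw: "u \<bullet> (M *\<^sub>v w) = w \<bullet> w"
    using transpose_vec_mult_scalar[OF M w u] M u w by (simp add: sym flip: w_def)
  have q: "0 \<le> 2 * s * (w \<bullet> w) + s\<^sup>2 * b" for s
  proof -
    have "0 \<le> (u + s \<cdot>\<^sub>v w) \<bullet> (M *\<^sub>v (u + s \<cdot>\<^sub>v w))"
      using psd u w M by (simp add: pos_semidef_def)
    also have "M *\<^sub>v (u + s \<cdot>\<^sub>v w) = w + s \<cdot>\<^sub>v (M *\<^sub>v w)"
      using M u w by (simp add: mult_add_distrib_mat_vec[of _ n n] mult_mat_vec[of _ n n] w_def)
    also have "(u + s \<cdot>\<^sub>v w) \<bullet> (w + s \<cdot>\<^sub>v (M *\<^sub>v w)) =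
        u \<bullet> w + s * (u \<bullet> (M *\<^sub>v w)) + (s * (w \<bullet> w) + s * (s * (w \<bullet> (M *\<^sub>v w))))"
      using M u w by (simp add: add_scalar_prod_distrib[of _ n] scalar_prod_add_distrib[of _ n]
          algebra_simps)
    finally show ?thesis
      using u0 uMw by (simp add: b_def w_def power2_eq_square algebra_simps)
  qed
  show False
  proof (cases "b = 0")
    case True
    then show False using q[of "-1"] ww by simp
  next
    case False
    \<comment> \<open>This \<open>s\<close> minimises the quadratic; its value there is minus the
      square of \<open>w \<bullet> w\<close> over \<open>b\<close>.\<close>
    then show False
      using q[of "- (w \<bullet> w) / b"] mult_pos_pos[OF ww ww] b by (simp add: field_simps power2_eq_square)
  qed
qed

lemma pos_semidef_nonsingular_imp_pos_def:
  assumes M: "M \<in> carrier_mat n n" and sym: "M\<^sup>T = M" and psd: "pos_semidef M" and "det M \<noteq> 0"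
  shows "pos_def M"
  unfolding pos_def_def
proof (intro ballI impI)
  fix u :: "real vec" assume "u \<in> carrier_vec (dim_row M)" "u \<noteq> 0\<^sub>v (dim_row M)"
  then have u: "u \<in> carrier_vec n" "u \<noteq> 0\<^sub>v n"
    using M by auto
  have "M *\<^sub>v u \<noteq> 0\<^sub>v n"
    using assms(4) det_0_iff_vec_prod_zero[OF M] u by auto
  then have "u \<bullet> (M *\<^sub>v u) \<noteq> 0"
    using pos_semidef_null_vector[OF M sym psd u(1)] by auto
  then show "0 < u \<bullet> (M *\<^sub>v u)"
    using psd u M unfolding pos_semidef_def by (simp add: less_le)
qed

text \<open>For nonnegative eigenvalues the sum of the squares is at most the square of the sum. The
  proof does without eigenvalues: the principal two by two minors bound each squared entry by a
  product of diagonal entries, and these products add up to the squared trace.\<close>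

lemma pos_semidef_frob_le_tr:
  assumes M: "M \<in> carrier_mat n n" and sym: "M\<^sup>T = M" and psd: "pos_semidef M"
  shows "frob M M \<le> (tr M)\<^sup>2"
proof -
  have s: "M $$ (i, j) = M $$ (j, i)" if "i < n" "j < n" for i j
    using that M sym by (metis carrier_matD index_transpose_mat(1))
  have col: "M *\<^sub>v unit_vec n i = col M i" if "i < n" for i
    using M that by (intro eq_vecI) auto
  have q: "0 \<le> a\<^sup>2 * M $$ (i, i) + 2 * a * b * M $$ (i, j) + b\<^sup>2 * M $$ (j, j)"
    if ij: "i < n" "j < n" for a b i j
  proof -
    define u where "u = a \<cdot>\<^sub>v unit_vec n i + b \<cdot>\<^sub>v unit_vec n j"
    have "0 \<le> u \<bullet> (M *\<^sub>v u)"
      using psd M by (simp add: pos_semidef_def u_def)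
    also have "M *\<^sub>v u = a \<cdot>\<^sub>v col M i + b \<cdot>\<^sub>v col M j"
      using M ij by (simp add: u_def mult_add_distrib_mat_vec[of _ n n] mult_mat_vec[of _ n n] col)
    also have "u \<bullet> \<dots> = a\<^sup>2 * M $$ (i, i) + 2 * a * b * M $$ (i, j) + b\<^sup>2 * M $$ (j, j)"
      using M ij s[OF ij] unfolding u_def
      by (simp add: add_scalar_prod_distrib[of _ n] scalar_prod_add_distrib[of _ n])
        (simp add: power2_eq_square algebra_simps)
    finally show ?thesis .
  qed
  have d: "0 \<le> M $$ (i, i)" if "i < n" for i
    using q[OF that that, of 1 0] by simp
  have "(M $$ (i, j))\<^sup>2 \<le> M $$ (i, i) * M $$ (j, j)" if ij: "i < n" "j < n" for i j
  proof (cases "M $$ (i, i) = 0")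
    case True
    have "M $$ (i, j) = 0"
    proof (rule ccontr)
      assume nz: "M $$ (i, j) \<noteq> 0"
      \<comment> \<open>With a zero diagonal entry the form is affine in \<open>a\<close>; the
        chosen \<open>a\<close> makes it equal to -1.\<close>
      show False
        using q[OF ij, of "- (M $$ (j, j) + 1) / (2 * M $$ (i, j))" 1] nz True by (simp add: field_simps)
    qed
    then show ?thesis using True by simp
  next
    case False
    then have p: "M $$ (i, i) > 0" using d[OF ij(1)] by simp
    have "0 \<le> M $$ (i, i) * (M $$ (i, i) * M $$ (j, j) - (M $$ (i, j))\<^sup>2)"
      using q[OF ij, of "- M $$ (i, j)" "M $$ (i, i)"] by (simp add: power2_eq_square algebra_simps)
    then show ?thesis
      using p by (simp add: zero_le_mult_iff)
  qed
  then have "frob M M \<le> (\<Sum>i<n. \<Sum>j<n. M $$ (i, i) * M $$ (j, j))"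
    unfolding frob_def using M by (auto intro!: sum_mono simp: power2_eq_square)
  also have "\<dots> = (tr M)\<^sup>2"
    using M by (auto simp: tr_def power2_eq_square sum_product)
  finally show ?thesis .
qed

section \<open>Derivatives of the logarithm of the determinant\<close>

lemma continuous_on_det:
  fixes M :: "'a::topological_space \<Rightarrow> real mat"
  assumes "\<And>x. x \<in> S \<Longrightarrow> M x \<in> carrier_mat n n"
    and "\<And>i j. i < n \<Longrightarrow> j < n \<Longrightarrow> continuous_on S (\<lambda>x. M x $$ (i, j))"
  shows "continuous_on S (\<lambda>x. det (M x))"
proof -
  have "continuous_on S (\<lambda>x. \<Sum>p \<in> {p. p permutes {0..<n}}.
      signof p * (\<Prod>i = 0..<n. M x $$ (i, p i)))"
    by (intro continuous_on_sum continuous_on_mult continuous_on_const continuous_on_prod assms(2))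
      (auto dest: permutes_in_image)
  then show ?thesis
    by (rule continuous_on_eq) (simp add: det_def'[OF assms(1)])
qed

text \<open>Division by the determinant turns this into continuity of the inverse, the only
  regularity that the second derivative below relies on.\<close>

lemma continuous_on_adj_mat:
  fixes M :: "'a::topological_space \<Rightarrow> real mat"
  assumes M: "\<And>x. x \<in> S \<Longrightarrow> M x \<in> carrier_mat n n"
    and cont: "\<And>i j. i < n \<Longrightarrow> j < n \<Longrightarrow> continuous_on S (\<lambda>x. M x $$ (i, j))"
    and ij: "i < n" "j < n"
  shows "continuous_on S (\<lambda>x. adj_mat (M x) $$ (i, j))"
proof -
  have "continuous_on S (\<lambda>x. det (mat_delete (M x) j i))"
  proof (rule continuous_on_det[where n = "n - 1"])
    show "mat_delete (M x) j i \<in> carrier_mat (n - 1) (n - 1)" if "x \<in> S" for x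
      by (rule mat_delete_carrier[OF M[OF that]])
    fix k l assume kl: "k < n - 1" "l < n - 1"
    have "continuous_on S (\<lambda>x. M x $$ (insert_index j k, insert_index i l))"
      using kl by (intro cont) (auto simp: insert_index_def)
    then show "continuous_on S (\<lambda>x. mat_delete (M x) j i $$ (k, l))"
      by (rule continuous_on_eq) (use kl in \<open>auto simp: mat_delete_def insert_index_def carrier_matD[OF M]\<close>)
  qed
  then have "continuous_on S (\<lambda>x. (-1) ^ (j + i) * det (mat_delete (M x) j i))"
    by (intro continuous_intros)
  then show ?thesis
    by (rule continuous_on_eq) (use ij in \<open>auto simp: adj_mat_def cofactor_def carrier_matD[OF M]\<close>)
qed

text \<open>If \<open>p\<close> moves \<open>k\<close>, it also moves \<open>p k\<close>, so no
  index is the only one moved.\<close>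

lemma permutes_moves_another:
  assumes "p permutes A" "p \<noteq> id"
  shows "\<exists>j \<in> A - {i}. p j \<noteq> j"
proof -
  obtain k where k: "p k \<noteq> k"
    using assms by (metis eq_id_iff)
  then have "p (p k) \<noteq> p k"
    using assms(1) by (meson inj_eq permutes_inj)
  moreover have "k \<in> A" "p k \<in> A"
    using k assms(1) by (meson permutes_not_in permutes_in_image)+
  ultimately show ?thesis
    using k by (cases "k = i") auto
qed

text \<open>The product rule deletes one factor from each Leibniz term. A permutation other than the
  identity keeps another off-diagonal factor, which is 0 at \<open>s = 0\<close>; the identity
  contributes the trace.\<close>

lemma DERIV_det_one_add:
  fixes N :: "real mat"
  assumes N: "N \<in> carrier_mat n n"
  shows "((\<lambda>s. det (1\<^sub>m n + s \<cdot>\<^sub>m N)) has_real_derivative tr N) (at 0)"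
proof -
  let ?P = "{p. p permutes {0..<n}}"
  define e where "e p i = (if i = p i then 1 else 0 :: real)" for p :: "nat \<Rightarrow> nat" and i
  have pi: "p i < n" if "p \<in> ?P" "i < n" for p i
    using that by (auto dest: permutes_in_image)
  have det: "det (1\<^sub>m n + s \<cdot>\<^sub>m N) =
      (\<Sum>p \<in> ?P. signof p * (\<Prod>i = 0..<n. e p i + s * N $$ (i, p i)))" for s
    using N pi by (subst det_def'[of _ n]) (auto simp: e_def intro!: sum.cong prod.cong)
  have "((\<lambda>s. \<Prod>i = 0..<n. e p i + s * N $$ (i, p i)) has_real_derivative
      (\<Sum>i = 0..<n. N $$ (i, p i) * (\<Prod>j \<in> {0..<n} - {i}. e p j + 0 * N $$ (j, p j)))) (at 0)" for p
    by (rule has_field_derivative_prod) (auto intro!: derivative_eq_intros)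
  then have D: "((\<lambda>s. det (1\<^sub>m n + s \<cdot>\<^sub>m N)) has_real_derivative (\<Sum>p \<in> ?P. signof p *
      (\<Sum>i = 0..<n. N $$ (i, p i) * (\<Prod>j \<in> {0..<n} - {i}. e p j + 0 * N $$ (j, p j))))) (at 0)"
    unfolding det by (intro DERIV_sum DERIV_cmult) auto
  have "signof p * (\<Sum>i = 0..<n. N $$ (i, p i) * (\<Prod>j \<in> {0..<n} - {i}. e p j + 0 * N $$ (j, p j))) =
      (if p = id then tr N else 0)" if p: "p \<in> ?P" for p
  proof (cases "p = id")
    case True
    then show ?thesis
      using N by (auto simp: e_def tr_def atLeast0LessThan)
  next
    case False
    have "(\<Prod>j \<in> {0..<n} - {i}. e p j + 0 * N $$ (j, p j)) = 0" for i
      using permutes_moves_another[of p "{0..<n}" i] p False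
      by (intro prod_zero) (auto simp: e_def)
    then show ?thesis using False by simp
  qed
  then have "(\<Sum>p \<in> ?P. signof p *
      (\<Sum>i = 0..<n. N $$ (i, p i) * (\<Prod>j \<in> {0..<n} - {i}. e p j + 0 * N $$ (j, p j)))) =
      (\<Sum>p \<in> ?P. if p = id then tr N else 0)"
    by (intro sum.cong) auto
  also have "\<dots> = tr N"
    using permutes_id by (subst sum.delta) (auto simp: finite_permutations)
  finally show ?thesis
    using D by simp
qed

text \<open>Jacobi's formula, reduced to the identity matrix by the factorisation
  \<open>M + s Q = M (1 + s S Q)\<close>.\<close>

lemma DERIV_det:
  fixes M Q S :: "real mat"
  assumes M: "M \<in> carrier_mat n n" and Q: "Q \<in> carrier_mat n n" and S: "S \<in> carrier_mat n n"
    and MS: "M * S = 1\<^sub>m n"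
  shows "((\<lambda>s. det (M + s \<cdot>\<^sub>m Q)) has_real_derivative det M * tr (S * Q)) (at 0)"
proof -
  have "M + s \<cdot>\<^sub>m Q = M * (1\<^sub>m n + s \<cdot>\<^sub>m (S * Q))" for s
  proof -
    have "M * (s \<cdot>\<^sub>m (S * Q)) = s \<cdot>\<^sub>m (M * S * Q)"
      using M Q S by (simp add: mult_smult_distrib[of _ n n _ n])
    also have "\<dots> = s \<cdot>\<^sub>m Q"
      using Q by (simp add: MS)
    finally show ?thesis
      using M Q S by (simp add: mult_add_distrib_mat[of _ n n _ n])
  qed
  then have "det (M + s \<cdot>\<^sub>m Q) = det M * det (1\<^sub>m n + s \<cdot>\<^sub>m (S * Q))" for s
    using M Q S by (simp add: det_mult[of _ n])
  then show ?thesis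
    using DERIV_cmult[OF DERIV_det_one_add[of "S * Q" n], of "det M"] S Q by simp
qed

lemma deriv_neg_ln_det:
  fixes M Q S :: "real mat"
  assumes "M \<in> carrier_mat n n" "Q \<in> carrier_mat n n" "S \<in> carrier_mat n n"
    and "M * S = 1\<^sub>m n" and "det M > 0"
  shows "deriv (\<lambda>s. - ln (det (M + s \<cdot>\<^sub>m Q))) 0 = - tr (S * Q)"
proof (rule DERIV_imp_deriv)
  have "M + 0 \<cdot>\<^sub>m Q = M"
    using assms by (intro eq_matI) auto
  then show "((\<lambda>s. - ln (det (M + s \<cdot>\<^sub>m Q))) has_real_derivative - tr (S * Q)) (at 0)"
    using assms by (auto intro!: derivative_eq_intros DERIV_det[OF assms(1-4)])
qed

text \<open>With \<open>T r\<close> the inverse of \<open>M r\<close>, the inner derivative is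
  \<open>- tr (T r * Q)\<close>. The resolvent identity rewrites it as
  \<open>r * g r - tr (S * Q)\<close>, so in Caratheodory's form of the derivative the answer is
  \<open>g 0\<close>, and continuity of the inverse takes the place of its
  differentiability.\<close>

lemma deriv2_neg_ln_det:
  fixes X P Q S :: "real mat"
  assumes X: "X \<in> carrier_mat n n" and P: "P \<in> carrier_mat n n" and Q: "Q \<in> carrier_mat n n"
    and S: "S \<in> carrier_mat n n" and XS: "X * S = 1\<^sub>m n" and pos: "det X > 0"
  shows "deriv (\<lambda>r. deriv (\<lambda>s. - ln (det (X + r \<cdot>\<^sub>m P + s \<cdot>\<^sub>m Q))) 0) 0 = tr (S * P * S * Q)"
proof -
  define M where "M r = X + r \<cdot>\<^sub>m P" for r
  \<comment> \<open>The adjugate formula defines \<open>T r\<close> for every \<open>r\<close>; it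
    is the inverse wherever the determinant is nonzero.\<close>
  define T where "T r = (1 / det (M r)) \<cdot>\<^sub>m adj_mat (M r)" for r
  define g where "g r = tr (Q * S * P * T r)" for r
  have M: "M r \<in> carrier_mat n n" for r
    using X P by (simp add: M_def)
  have adj: "adj_mat (M r) \<in> carrier_mat n n" for r
    using adj_mat(1)[OF M] .
  have T: "T r \<in> carrier_mat n n" for r
    using adj by (simp add: T_def)
  have SX: "S * X = 1\<^sub>m n"
    using mat_mult_left_right_inverse[OF X S XS] .
  have M0: "M 0 = X"
    using X P by (auto simp: M_def intro!: eq_matI)
  have MT: "M r * T r = 1\<^sub>m n" if "det (M r) \<noteq> 0" for r
  proof -
    have "M r * T r = (1 / det (M r)) \<cdot>\<^sub>m (M r * adj_mat (M r))"
      unfolding T_def using M adj by (simp add: mult_smult_distrib[of _ n n _ n])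
    also have "\<dots> = 1\<^sub>m n"
      unfolding adj_mat(2)[OF M] using that by (intro eq_matI) auto
    finally show ?thesis .
  qed
  \<comment> \<open>The resolvent identity, from inserting \<open>M r * T r = 1\<close> after
    \<open>S\<close>.\<close>
  have T_eq: "T r + r \<cdot>\<^sub>m (S * P * T r) = S" if "det (M r) \<noteq> 0" for r
  proof -
    have "S = S * (M r * T r)"
      using S by (simp add: MT[OF that])
    also have "\<dots> = (S * X + r \<cdot>\<^sub>m (S * P)) * T r"
      using S X P T M by (simp add: M_def flip: assoc_mult_mat[of _ n n _ n _ n])
        (simp add: mult_add_distrib_mat[of _ n n _ n] mult_smult_distrib[of _ n n _ n])
    also have "\<dots> = T r + r \<cdot>\<^sub>m (S * P * T r)"
      using S P T left_mult_one_mat[OF T[of r]] by (simp add: SX add_mult_distrib_mat[of _ n n _ _ n]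
          mult_smult_assoc_mat[of _ n n _ n])
    finally show ?thesis by simp
  qed
  have T0: "T 0 = S"
  proof -
    have "0 \<cdot>\<^sub>m (S * P * T 0) = 0\<^sub>m n n"
      using S P T[of 0] by (intro eq_matI) auto
    then show ?thesis
      using T_eq[of 0] pos M0 T[of 0] by simp
  qed
  have contM: "continuous_on UNIV (\<lambda>r. M r $$ (i, j))" if "i < n" "j < n" for i j
  proof -
    have "continuous_on UNIV (\<lambda>r. X $$ (i, j) + r * P $$ (i, j))"
      by (intro continuous_intros)
    then show ?thesis
      using that X P by (simp add: M_def)
  qed
  have contdet: "continuous_on UNIV (\<lambda>r. det (M r))"
    by (rule continuous_on_det[OF M contM])
  have contT: "isCont (\<lambda>r. T r $$ (i, j)) 0" if ij: "i < n" "j < n" for i j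
  proof -
    have "T r $$ (i, j) = adj_mat (M r) $$ (i, j) / det (M r)" for r
      using ij adj[of r] by (simp add: T_def)
    moreover have "isCont (\<lambda>r. adj_mat (M r) $$ (i, j)) 0"
      using continuous_on_adj_mat[OF M contM ij] by (simp add: continuous_on_eq_continuous_at)
    moreover have "isCont (\<lambda>r. det (M r)) 0"
      using contdet by (simp add: continuous_on_eq_continuous_at)
    ultimately show ?thesis
      using pos M0 by (auto intro!: continuous_intros)
  qed
  have "g r = (\<Sum>i<n. \<Sum>j<n. (Q * S * P) $$ (i, j) * T r $$ (j, i))" for r
    unfolding g_def tr_def using Q S P T[of r]
    by (auto simp: index_mult_mat_sum[of _ n n _ n] simp del: index_mult_mat(1) intro!: sum.cong)
  then have g: "g = (\<lambda>r. \<Sum>i<n. \<Sum>j<n. (Q * S * P) $$ (i, j) * T r $$ (j, i))"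
    by (rule ext)
  have contg: "isCont g 0"
    unfolding g using contT by (intro continuous_intros) auto
  have "eventually (\<lambda>r. det (M r) > 0) (nhds 0)"
    using contdet pos M0 open_Collect_less[OF continuous_on_const contdet, of 0]
    by (auto simp: eventually_nhds)
  then have "eventually (\<lambda>r. deriv (\<lambda>s. - ln (det (X + r \<cdot>\<^sub>m P + s \<cdot>\<^sub>m Q))) 0 =
      r * g r - tr (S * Q)) (nhds 0)"
  proof eventually_elim
    case (elim r)
    have "deriv (\<lambda>s. - ln (det (M r + s \<cdot>\<^sub>m Q))) 0 = - tr (T r * Q)"
      using elim by (intro deriv_neg_ln_det[OF M Q T] MT) auto
    moreover have "tr (S * Q) = tr (T r * Q) + r * g r"
    proof -
      have "S * Q = T r * Q + r \<cdot>\<^sub>m (S * P * T r * Q)"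
      proof -
        have "S * Q = (T r + r \<cdot>\<^sub>m (S * P * T r)) * Q"
          using T_eq[of r] elim by simp
        also have "\<dots> = T r * Q + (r \<cdot>\<^sub>m (S * P * T r)) * Q"
          using T[of r] S P Q by (intro add_mult_distrib_mat[of _ n n]) auto
        also have "(r \<cdot>\<^sub>m (S * P * T r)) * Q = r \<cdot>\<^sub>m (S * P * T r * Q)"
          using T[of r] S P Q by (intro mult_smult_assoc_mat[of _ n n]) auto
        finally show ?thesis .
      qed
      moreover have "tr (S * P * T r * Q) = g r"
        unfolding g_def using S P T[of r] Q tr_mult_comm[of Q n n "S * P * T r"]
        by (simp add: assoc_mult_mat[of _ n n _ n _ n])
      moreover have "S * P * T r * Q \<in> carrier_mat n n"
        using S P T[of r] Q by (meson mult_carrier_mat)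
      ultimately show ?thesis
        using S P T[of r] Q tr_add[of "T r * Q" n "r \<cdot>\<^sub>m (S * P * T r * Q)"]
          tr_smult[of "S * P * T r * Q" n r]
        by (simp del: assoc_mult_mat)
    qed
    ultimately show ?case
      by (simp add: M_def)
  qed
  then have "deriv (\<lambda>r. deriv (\<lambda>s. - ln (det (X + r \<cdot>\<^sub>m P + s \<cdot>\<^sub>m Q))) 0) 0 =
      deriv (\<lambda>r. r * g r - tr (S * Q)) 0"
    by (intro deriv_cong_ev) auto
  also have "\<dots> = g 0"
    by (intro DERIV_imp_deriv, unfold CARAT_DERIV, intro exI[of _ g])
      (use contg in \<open>auto intro!: continuous_intros\<close>)
  also have "g 0 = tr (S * P * S * Q)"
    unfolding g_def T0 using S P Q tr_mult_comm[of Q n n "S * P * S"]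
    by (simp add: assoc_mult_mat[of _ n n _ n _ n])
  finally show ?thesis .
qed

section \<open>Linear matrix inequalities and their barrier\<close>

abbreviation congr_mat :: "real mat \<Rightarrow> real mat \<Rightarrow> real mat" where
  "congr_mat A M \<equiv> A\<^sup>T * M * A"

lemma congr_mat_add:
  assumes "A \<in> carrier_mat n n" "M \<in> carrier_mat n n" "M' \<in> carrier_mat n n"
  shows "congr_mat A (M + M') = congr_mat A M + congr_mat A M'"
  using assms
  by (simp add: mult_add_distrib_mat[of _ n n _ n] add_mult_distrib_mat[of _ n n _ _ n])

lemma congr_mat_smult:
  assumes "A \<in> carrier_mat n n" "M \<in> carrier_mat n n"
  shows "congr_mat A (c \<cdot>\<^sub>m M) = c \<cdot>\<^sub>m congr_mat A M"
  using assms by (simp add: mult_smult_distrib[of _ n n _ n] mult_smult_assoc_mat[of _ n n _ n])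

lemma transpose_congr_mat:
  assumes "A \<in> carrier_mat n n" "M \<in> carrier_mat n n" "M\<^sup>T = M"
  shows "(congr_mat A M)\<^sup>T = congr_mat A M"
  using assms by (simp add: transpose_mult[of _ n n _ n] assoc_mult_mat[of _ n n _ n _ n])

lemma congr_mat_carrier:
  "A \<in> carrier_mat n n \<Longrightarrow> congr_mat A M \<in> carrier_mat n n"
  by auto

text \<open>Whitening provides the inverse of \<open>M\<close> as \<open>A * A\<^sup>T\<close>, and
  taking determinants gives that the square of \<open>det A\<close> times \<open>det M\<close> is
  1.\<close>

lemma congruent_one_inverse:
  assumes A: "A \<in> carrier_mat n n" and M: "M \<in> carrier_mat n n" and one: "congr_mat A M = 1\<^sub>m n"
  shows "A * (A\<^sup>T * M) = 1\<^sub>m n" "M * (A * A\<^sup>T) = 1\<^sub>m n" "det M > 0"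
proof -
  show *: "A * (A\<^sup>T * M) = 1\<^sub>m n"
    using A M one by (intro mat_mult_left_right_inverse[of "A\<^sup>T * M" n A]) auto
  have "(A * A\<^sup>T) * M = 1\<^sub>m n"
    using A M * by (simp add: assoc_mult_mat[of _ n n _ n _ n])
  then show "M * (A * A\<^sup>T) = 1\<^sub>m n"
    using A M by (intro mat_mult_left_right_inverse[of "A * A\<^sup>T" n M]) auto
  have "det (congr_mat A M) = det A * det A * det M"
    using A M by (simp add: det_mult[of _ n] det_transpose[of _ n])
  then have "(det A)\<^sup>2 * det M = 1"
    by (simp add: one power2_eq_square)
  then have "0 < (det A)\<^sup>2 * det M"
    by simp
  then show "det M > 0"
    by (auto simp: zero_less_mult_iff)
qed

lemma pos_def_det_pos:
  assumes "M \<in> carrier_mat n n" "M\<^sup>T = M" "pos_def M"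
  shows "det M > 0"
  using pos_def_congruent_one[OF assms] congruent_one_inverse(3)[OF _ assms(1)] by blast

lemma tr_congr_mat:
  assumes "A \<in> carrier_mat n n" "M \<in> carrier_mat n n"
  shows "tr (congr_mat A M) = tr (A * A\<^sup>T * M)"
  using assms tr_mult_comm[of "A\<^sup>T * M" n n A] by (simp add: assoc_mult_mat[of _ n n _ n _ n])

text \<open>Exchanges the two local norms: if \<open>A\<close> and \<open>B\<close> whiten \<open>Y\<close> and \<open>X\<close> and \<open>A = B G\<close>, then \<open>G\<^sup>T G\<close>
  is \<open>X\<close> seen from \<open>Y\<close>, and \<open>G G\<^sup>T\<close> is the inverse of \<open>Y\<close> seen from \<open>X\<close>.\<close>

lemma frob_gram_minus_one:
  assumes G: "G \<in> carrier_mat n n"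
  shows "frob (G * G\<^sup>T + (-1) \<cdot>\<^sub>m 1\<^sub>m n) (G * G\<^sup>T + (-1) \<cdot>\<^sub>m 1\<^sub>m n) =
    frob (G\<^sup>T * G + (-1) \<cdot>\<^sub>m 1\<^sub>m n) (G\<^sup>T * G + (-1) \<cdot>\<^sub>m 1\<^sub>m n)"
proof -
  have ex: "frob (E + (-1) \<cdot>\<^sub>m 1\<^sub>m n) (E + (-1) \<cdot>\<^sub>m 1\<^sub>m n) = tr (E * E) - 2 * tr E + n"
    if E: "E \<in> carrier_mat n n" "E\<^sup>T = E" for E
  proof -
    have I: "(-1) \<cdot>\<^sub>m 1\<^sub>m n \<in> carrier_mat n n" "E + (-1) \<cdot>\<^sub>m 1\<^sub>m n \<in> carrier_mat n n"
      using E by auto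
    have "frob (E + (-1) \<cdot>\<^sub>m 1\<^sub>m n) (E + (-1) \<cdot>\<^sub>m 1\<^sub>m n) =
        frob E (E + (-1) \<cdot>\<^sub>m 1\<^sub>m n) - tr (E + (-1) \<cdot>\<^sub>m 1\<^sub>m n)"
      using E I by (simp add: frob_add_left[of _ n n] frob_smult_left[of _ n n] frob_one_left)
    also have "frob E (E + (-1) \<cdot>\<^sub>m 1\<^sub>m n) = frob (E + (-1) \<cdot>\<^sub>m 1\<^sub>m n) E"
      using E I by (intro frob_commute) auto
    also have "\<dots> = frob E E - tr E"
      using E I by (simp add: frob_add_left[of _ n n] frob_smult_left[of _ n n] frob_one_left)
    finally show ?thesis
      using E I by (simp add: frob_eq_tr[of _ n n] tr_add[of _ n] tr_smult[of _ n] tr_one)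
  qed
  have "tr (G * G\<^sup>T * (G * G\<^sup>T)) = tr (G\<^sup>T * G * (G\<^sup>T * G))"
    using G tr_mult_comm[of G n n "G\<^sup>T * (G * G\<^sup>T)"]
    by (simp add: assoc_mult_mat[of _ n n _ n _ n])
  moreover have "tr (G * G\<^sup>T) = tr (G\<^sup>T * G)"
    using G by (intro tr_mult_comm) auto
  ultimately show ?thesis
    using G by (simp add: ex transpose_mult[of _ n n _ n])
qed

section \<open>Linear functionals in coordinates, and the abstract linear matrix inequality\<close>

definition linear_functional :: "nat \<Rightarrow> (real vec \<Rightarrow> real) \<Rightarrow> bool" where
  "linear_functional n \<phi> \<longleftrightarrow>
     (\<forall>x \<in> carrier_vec n. \<forall>y \<in> carrier_vec n. \<phi> (x + y) = \<phi> x + \<phi> y) \<and>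
     (\<forall>x \<in> carrier_vec n. \<forall>c. \<phi> (c \<cdot>\<^sub>v x) = c * \<phi> x)"

lemma linear_functional_expand:
  assumes "linear_functional n \<phi>" and v: "v \<in> carrier_vec n"
  shows "\<phi> v = (\<Sum>i<n. v $ i * \<phi> (unit_vec n i))"
proof -
  have add: "\<phi> (x + y) = \<phi> x + \<phi> y" if "x \<in> carrier_vec n" "y \<in> carrier_vec n" for x y
    using that assms(1) by (simp add: linear_functional_def)
  have smult: "\<phi> (c \<cdot>\<^sub>v x) = c * \<phi> x" if "x \<in> carrier_vec n" for x c
    using that assms(1) by (simp add: linear_functional_def)
  define w where "w k = vec n (\<lambda>i. if i < k then v $ i else 0)" for k
  have "\<phi> (w k) = (\<Sum>i<k. v $ i * \<phi> (unit_vec n i))" if "k \<le> n" for k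
    using that
  proof (induction k)
    case 0
    have "w 0 = 0 \<cdot>\<^sub>v w 0"
      by (intro eq_vecI) (auto simp: w_def)
    moreover have "w 0 \<in> carrier_vec n"
      by (simp add: w_def)
    ultimately show ?case
      using smult[of "w 0" 0] by simp
  next
    case (Suc k)
    have "w (Suc k) = w k + v $ k \<cdot>\<^sub>v unit_vec n k"
      using Suc.prems by (intro eq_vecI) (auto simp: w_def less_Suc_eq)
    then have "\<phi> (w (Suc k)) = \<phi> (w k) + v $ k * \<phi> (unit_vec n k)"
      using add[of "w k" "v $ k \<cdot>\<^sub>v unit_vec n k"] smult by (simp add: w_def)
    then show ?case
      using Suc by simp
  qed
  moreover have "w n = v"
    using v by (intro eq_vecI) (auto simp: w_def)
  ultimately show ?thesis by force
qed

text \<open>The dual cone, abstracted to the set where a linear symmetric matrix function is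
  positive semidefinite. Injectivity of \<open>L\<close> is what makes the Hessian of the barrier
  definite, hence invertible.\<close>

locale lmi =
  fixes n N :: nat and L :: "real vec \<Rightarrow> real mat"
  assumes L_carrier: "x \<in> carrier_vec n \<Longrightarrow> L x \<in> carrier_mat N N"
    and L_sym: "x \<in> carrier_vec n \<Longrightarrow> (L x)\<^sup>T = L x"
    and L_add: "x \<in> carrier_vec n \<Longrightarrow> y \<in> carrier_vec n \<Longrightarrow> L (x + y) = L x + L y"
    and L_smult: "x \<in> carrier_vec n \<Longrightarrow> L (c \<cdot>\<^sub>v x) = c \<cdot>\<^sub>m L x"
    and L_inj: "x \<in> carrier_vec n \<Longrightarrow> L x = 0\<^sub>m N N \<Longrightarrow> x = 0\<^sub>v n"
begin

lemma linear_functional_frob: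
  assumes "A \<in> carrier_mat N N" "K \<in> carrier_mat N N"
  shows "linear_functional n (\<lambda>v. frob (congr_mat A (L v)) K)"
  unfolding linear_functional_def using assms(1) L_carrier
  by (simp add: L_add L_smult congr_mat_add[of _ N] congr_mat_smult[of _ N]
      frob_add_left[OF congr_mat_carrier[OF assms(1)] congr_mat_carrier[OF assms(1)]]
      frob_smult_left[OF congr_mat_carrier[OF assms(1)]])

text \<open>If \<open>A\<close> whitens \<open>L y\<close>, then \<open>A * A\<^sup>T\<close> is the
  inverse of \<open>L y\<close>, and this is the Hessian form of the barrier at \<open>y\<close>,
  usually written as the trace of the product of \<open>L u\<close> and \<open>L v\<close> with that
  inverse before each of them.\<close>

definition local_form :: "real mat \<Rightarrow> real vec \<Rightarrow> real vec \<Rightarrow> real" where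
  "local_form A u v = frob (congr_mat A (L u)) (congr_mat A (L v))"

lemma local_form_commute:
  assumes "A \<in> carrier_mat N N" "u \<in> carrier_vec n" "v \<in> carrier_vec n"
  shows "local_form A u v = local_form A v u"
  unfolding local_form_def using assms L_carrier by (intro frob_commute[of _ N N]) auto

lemma local_form_expand:
  assumes A: "A \<in> carrier_mat N N" and u: "u \<in> carrier_vec n" and v: "v \<in> carrier_vec n"
  shows "local_form A u v =
    (\<Sum>i<n. \<Sum>j<n. u $ i * local_form A (unit_vec n i) (unit_vec n j) * v $ j)"
proof -
  have 1: "local_form A u v = (\<Sum>i<n. u $ i * local_form A (unit_vec n i) v)"
    if "u \<in> carrier_vec n" "v \<in> carrier_vec n" for u v
    unfolding local_form_def using that A L_carrier
    by (intro linear_functional_expand linear_functional_frob) auto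
  have "local_form A (unit_vec n i) v =
      (\<Sum>j<n. v $ j * local_form A (unit_vec n i) (unit_vec n j))" for i
    using 1[of v "unit_vec n i"] A v by (simp add: local_form_commute)
  then show ?thesis
    using 1[OF u v] by (simp add: sum_distrib_left mult_ac)
qed

text \<open>The inverse of \<open>L x\<close> is \<open>B * B\<^sup>T\<close>; moving the leading
  \<open>B\<close> cyclically to the end of the trace produces the two whitened matrices.\<close>

lemma hessian_ln_det:
  assumes x: "x \<in> carrier_vec n" and B: "B \<in> carrier_mat N N" and one: "congr_mat B (L x) = 1\<^sub>m N"
    and ij: "i < n" "j < n"
  shows "hessian n (\<lambda>x. - ln (det (L x))) x $$ (i, j) =
    local_form B (unit_vec n i) (unit_vec n j)"
proof -
  define P where "P = L (unit_vec n i)"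
  define Q where "Q = L (unit_vec n j)"
  have c: "L x \<in> carrier_mat N N" "P \<in> carrier_mat N N" "Q \<in> carrier_mat N N"
    using x L_carrier by (auto simp: P_def Q_def)
  have f: "(\<lambda>s. - ln (det (L (x + r \<cdot>\<^sub>v unit_vec n i + s \<cdot>\<^sub>v unit_vec n j)))) =
      (\<lambda>s. - ln (det (L x + r \<cdot>\<^sub>m P + s \<cdot>\<^sub>m Q)))" for r
    using x by (simp add: L_add L_smult P_def Q_def del: assoc_add_vec assoc_add_mat)
  have "hessian n (\<lambda>x. - ln (det (L x))) x $$ (i, j) =
      tr (B * B\<^sup>T * P * (B * B\<^sup>T) * Q)"
    unfolding hessian_def index_mat(1)[OF ij] prod.case f
    using B c congruent_one_inverse[OF B c(1) one] by (intro deriv2_neg_ln_det) auto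
  also have "\<dots> = tr (B * (B\<^sup>T * P * B * B\<^sup>T * Q))"
    using B c by (simp add: assoc_mult_mat[of _ N N _ N _ N])
  also have "\<dots> = tr (B\<^sup>T * P * B * B\<^sup>T * Q * B)"
    using B c by (intro tr_mult_comm) auto
  also have "\<dots> = tr (congr_mat B P * congr_mat B Q)"
    using B c by (simp add: assoc_mult_mat[of _ N N _ N _ N])
  also have "\<dots> = local_form B (unit_vec n i) (unit_vec n j)"
    using transpose_congr_mat[OF B c(2)] L_sym[of "unit_vec n i"]
      frob_eq_tr[OF congr_mat_carrier[OF B] congr_mat_carrier[OF B], of P Q]
    by (simp add: local_form_def P_def Q_def)
  finally show ?thesis .
qed

end

lemma pos_semidef_smult:
  assumes "M \<in> carrier_mat n n" "pos_semidef M" "c \<ge> 0"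
  shows "pos_semidef (c \<cdot>\<^sub>m M)"
proof -
  have "(c \<cdot>\<^sub>m M) *\<^sub>v u = c \<cdot>\<^sub>v (M *\<^sub>v u)" if "u \<in> carrier_vec n" for u
    using assms(1) that by (intro eq_vecI) auto
  then show ?thesis
    using assms by (simp add: pos_semidef_def)
qed

context lmi
begin

text \<open>The Dikin ellipsoid: an open unit ball of the local norm stays inside the cone. It
  serves at the maximiser, at the rounded point, and for small moves along the slice.\<close>

lemma pos_def_L_if_local:
  assumes y: "y \<in> carrier_vec n" and A: "A \<in> carrier_mat N N"
    and one: "congr_mat A (L y) = 1\<^sub>m N" and v: "v \<in> carrier_vec n" and "local_form A v v < 1"
  shows "congr_mat A (L (y + v)) = 1\<^sub>m N + congr_mat A (L v)" "pos_def (L (y + v))"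
proof -
  have c: "L y \<in> carrier_mat N N" "L v \<in> carrier_mat N N"
    using y v L_carrier by auto
  show eq: "congr_mat A (L (y + v)) = 1\<^sub>m N + congr_mat A (L v)"
    using y v c A one by (simp add: L_add congr_mat_add[of _ N])
  have "pos_def (1\<^sub>m N + congr_mat A (L v))"
    using pos_def_one_add[OF congr_mat_carrier[OF A]] assms(5) by (simp add: local_form_def)
  then have "pos_def (congr_mat A (L (y + v)))"
    by (simp only: eq)
  then show "pos_def (L (y + v))"
    using pos_def_congruence_inv[OF L_carrier A _ congruent_one_inverse(1)[OF A c(1) one]]
      y v A c by auto
qed

lemma linear_functional_tr_congr:
  assumes A: "A \<in> carrier_mat N N"
  shows "linear_functional n (\<lambda>v. tr (congr_mat A (L v)))"
  using linear_functional_frob[OF A one_carrier_mat] frob_commute[OF congr_mat_carrier[OF A] one_carrier_mat]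
    frob_one_left[OF congr_mat_carrier[OF A]]
  by simp

text \<open>If the form vanishes, so does the whitened matrix; undoing the congruence leads to
  \<open>L v = 0\<close>, and \<open>L_inj\<close> applies.\<close>

lemma local_form_pos:
  assumes x: "x \<in> carrier_vec n" and B: "B \<in> carrier_mat N N" and one: "congr_mat B (L x) = 1\<^sub>m N"
    and v: "v \<in> carrier_vec n" "v \<noteq> 0\<^sub>v n"
  shows "local_form B v v > 0"
proof (rule ccontr)
  assume "\<not> local_form B v v > 0"
  then have "frob (congr_mat B (L v)) (congr_mat B (L v)) = 0"
    using frob_self_nonneg[of "congr_mat B (L v)"] by (simp add: local_form_def)
  then have 0: "congr_mat B (L v) = 0\<^sub>m N N"
    using frob_self_eq_0 congr_mat_carrier[OF B] by blast
  \<comment> \<open>The inverse of \<open>B\<close>.\<close>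
  define C where "C = B\<^sup>T * L x"
  have C: "C \<in> carrier_mat N N" and Lv: "L v \<in> carrier_mat N N"
    using B v L_carrier[OF x] L_carrier[OF v(1)] by (auto simp: C_def)
  have BC: "B * C = 1\<^sub>m N"
    unfolding C_def by (rule congruent_one_inverse(1)[OF B L_carrier[OF x] one])
  have "congr_mat C (congr_mat B (L v)) = congr_mat (B * C) (L v)"
    using B C Lv by (intro congruence_mult[symmetric]) auto
  also have "\<dots> = L v"
    using Lv by (simp add: BC)
  finally have "L v = 0\<^sub>m N N"
    using C by (simp add: 0)
  then show False
    using L_inj v by blast
qed

lemma hessian_quad_form:
  assumes x: "x \<in> carrier_vec n" and B: "B \<in> carrier_mat N N" and one: "congr_mat B (L x) = 1\<^sub>m N"
    and u: "u \<in> carrier_vec n" and v: "v \<in> carrier_vec n"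
  shows "u \<bullet> (hessian n (\<lambda>x. - ln (det (L x))) x *\<^sub>v v) = local_form B u v"
proof -
  have "hessian n (\<lambda>x. - ln (det (L x))) x \<in> carrier_mat n n"
    by (simp add: hessian_def)
  then show ?thesis
    using u v by (simp add: quad_form_sum[of _ n n] local_form_expand[OF B u v]
        hessian_ln_det[OF x B one])
qed

text \<open>Definiteness of the Hessian form guarantees that \<open>mat_inverse\<close> succeeds, so
  \<open>the\<close> yields the true inverse. The last conclusion describes \<open>w\<close> by its
  pairings in the local form, without reference to the inverse matrix.\<close>

lemma hessian_inverse:
  assumes x: "x \<in> carrier_vec n" and B: "B \<in> carrier_mat N N" and one: "congr_mat B (L x) = 1\<^sub>m N"
    and t: "t \<in> carrier_vec n"
  defines "w \<equiv> the (mat_inverse (hessian n (\<lambda>x. - ln (det (L x))) x)) *\<^sub>v t"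
  shows "w \<in> carrier_vec n" "u \<in> carrier_vec n \<Longrightarrow> local_form B u w = u \<bullet> t"
proof -
  define H where "H = hessian n (\<lambda>x. - ln (det (L x))) x"
  have H: "H \<in> carrier_mat n n"
    by (simp add: H_def hessian_def)
  have "det H \<noteq> 0"
  proof
    assume "det H = 0"
    then obtain v where v: "v \<in> carrier_vec n" "v \<noteq> 0\<^sub>v n" "H *\<^sub>v v = 0\<^sub>v n"
      using det_0_iff_vec_prod_zero[OF H] by blast
    have "local_form B v v = v \<bullet> (H *\<^sub>v v)"
      unfolding H_def using hessian_quad_form[OF x B one v(1) v(1)] by simp
    then show False
      using v local_form_pos[OF x B one v(1,2)] by simp
  qed
  then obtain K where K: "mat_inverse H = Some K"
    using mat_inverse(1)[OF H, of "()"] det_non_zero_imp_unit[OF H, of "()"]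
    by (cases "mat_inverse H") auto
  then have HK: "H * K = 1\<^sub>m n" and Kc: "K \<in> carrier_mat n n"
    using mat_inverse(2)[OF H] by auto
  have w: "w = K *\<^sub>v t"
    by (simp add: w_def K flip: H_def)
  then show wc: "w \<in> carrier_vec n"
    using Kc t by simp
  have "H *\<^sub>v w = t"
    using H Kc t HK by (simp add: w flip: assoc_mult_mat_vec[of _ n n _ n])
  then show "local_form B u w = u \<bullet> t" if "u \<in> carrier_vec n"
    using hessian_quad_form[OF x B one that wc] by (simp flip: H_def)
qed

text \<open>If \<open>t\<close> is the negative gradient of the barrier at \<open>y\<close> (up to the factor \<open>c\<close>), then every
  point of the open unit ball around \<open>y\<close> in the local norm certifies \<open>t\<close>: the distance in the local
  norm at \<open>x = y + v\<close> from \<open>x\<close> to \<open>w / c\<close> is at most the distance from \<open>y\<close> to \<open>x\<close> in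
  the local norm at \<open>y\<close>.\<close>

lemma hessian_inverse_in_cone:
  assumes y: "y \<in> carrier_vec n" and A: "A \<in> carrier_mat N N"
    and oneA: "congr_mat A (L y) = 1\<^sub>m N"
    and t: "t \<in> carrier_vec n" and "c > 0"
    and grad: "\<And>v. v \<in> carrier_vec n \<Longrightarrow> t \<bullet> v = c * tr (congr_mat A (L v))"
    and v: "v \<in> carrier_vec n" and near: "local_form A v v < 1"
  defines "w \<equiv> the (mat_inverse (hessian n (\<lambda>x. - ln (det (L x))) (y + v))) *\<^sub>v t"
  shows "w \<in> carrier_vec n" "pos_semidef (L w)"
proof -
  define x where "x = y + v"
  have x: "x \<in> carrier_vec n"
    using y v by (simp add: x_def)
  have Lx: "L x \<in> carrier_mat N N" "(L x)\<^sup>T = L x"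
    using x L_carrier L_sym by auto
  have Ax: "congr_mat A (L x) = 1\<^sub>m N + congr_mat A (L v)" and pdx: "pos_def (L x)"
    using pos_def_L_if_local[OF y A oneA v near] by (simp_all add: x_def)
  obtain B where B: "B \<in> carrier_mat N N" and oneB: "congr_mat B (L x) = 1\<^sub>m N"
    using pos_def_congruent_one[OF Lx pdx] by blast
  have w_eq: "w = the (mat_inverse (hessian n (\<lambda>x. - ln (det (L x))) x)) *\<^sub>v t"
    by (simp add: w_def x_def)
  show w: "w \<in> carrier_vec n"
    unfolding w_eq by (rule hessian_inverse(1)[OF x B oneB t])
  have Hw: "\<And>u. u \<in> carrier_vec n \<Longrightarrow> local_form B u w = u \<bullet> t"
    using hessian_inverse(2)[OF x B oneB t] by (simp add: w_eq)
  \<comment> \<open>By logarithmic homogeneity, \<open>h\<close> would be 0 if the negative gradient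
    of the barrier were \<open>(1 / c) \<cdot>\<^sub>v t\<close> at \<open>x\<close> instead of at
    \<open>y\<close>. It measures the effect of having moved from \<open>y\<close> to
    \<open>x\<close>.\<close>
  define h where "h = (1 / c) \<cdot>\<^sub>v w - x"
  have h: "h \<in> carrier_vec n"
    using w x by (simp add: h_def)
  define K where "K = congr_mat B (L h)"
  have K: "K \<in> carrier_mat N N" "K\<^sup>T = K"
    using B h L_carrier L_sym transpose_congr_mat[OF B L_carrier[OF h]] congr_mat_carrier[OF B]
    by (auto simp: K_def)
  \<comment> \<open>As \<open>B\<^sup>T * L x\<close> is the inverse of \<open>B\<close>, this is
    the transition matrix with \<open>A = B * G\<close>.\<close>
  define G where "G = B\<^sup>T * L x * A"
  have G: "G \<in> carrier_mat N N"
    using A B Lx by (simp add: G_def)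
  have BBX: "B * (B\<^sup>T * L x) = 1\<^sub>m N"
    by (rule congruent_one_inverse(1)[OF B Lx(1) oneB])
  have BG: "B * G = A"
  proof -
    have "B * G = B * (B\<^sup>T * L x) * A"
      using A B Lx by (simp add: G_def assoc_mult_mat[of _ N N _ N _ N])
    then show ?thesis
      using A by (simp add: BBX)
  qed
  have GG: "G\<^sup>T * G = 1\<^sub>m N + congr_mat A (L v)"
  proof -
    have "G\<^sup>T = A\<^sup>T * L x * B"
      using A B Lx by (simp add: G_def transpose_mult[of _ N N _ N] assoc_mult_mat[of _ N N _ N _ N])
    then have "G\<^sup>T * G = A\<^sup>T * L x * (B * G)"
      using A B Lx G by (simp add: assoc_mult_mat[of _ N N _ N _ N])
    then show ?thesis
      by (simp add: BG Ax)
  qed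
  define J where "J = (-1 :: real) \<cdot>\<^sub>m 1\<^sub>m N"
  have J: "J \<in> carrier_mat N N"
    by (simp add: J_def)
  define R where "R = G * G\<^sup>T + J"
  have R: "R \<in> carrier_mat N N"
    using G J by (simp add: R_def)
  have "G\<^sup>T * G + J = congr_mat A (L v)"
    unfolding GG J_def using congr_mat_carrier[OF A, of "L v"] by (intro eq_matI) auto
  then have RR: "frob R R < 1"
    using frob_gram_minus_one[OF G] near by (simp add: R_def J_def local_form_def)
  have trA: "tr (congr_mat A (L h)) = frob (G * G\<^sup>T) K"
  proof -
    have "congr_mat A (L h) = congr_mat G K"
      unfolding BG[symmetric] K_def by (rule congruence_mult[OF L_carrier[OF h] B G])
    moreover have "tr (congr_mat G K) = tr ((G * G\<^sup>T)\<^sup>T * K)"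
      using G by (simp add: tr_congr_mat[OF G K(1)] transpose_mult[of _ N N _ N])
    ultimately show ?thesis
      using G K by (simp add: frob_eq_tr[of _ N N])
  qed
  have lf: "linear_functional n (\<lambda>u. local_form B u h)"
    unfolding local_form_def using B congr_mat_carrier[OF B] by (intro linear_functional_frob) auto
  \<comment> \<open>Expanding one argument of \<open>local_form B h h\<close>: the term with
    \<open>w\<close> is evaluated by the gradient condition at \<open>y\<close>, the term with
    \<open>x\<close> by the whitening at \<open>x\<close>. Their difference is the pairing of
    \<open>K\<close> with \<open>R\<close>.\<close>
  have "h = (1 / c) \<cdot>\<^sub>v w + (-1) \<cdot>\<^sub>v x"
    unfolding h_def using w x by (intro eq_vecI) auto
  then have "local_form B h h = (1 / c) * local_form B w h + (-1) * local_form B x h"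
    using lf w x unfolding linear_functional_def by (simp only: smult_carrier_vec)
  also have "local_form B w h = c * tr (congr_mat A (L h))"
    using Hw[OF h] grad[OF h] local_form_commute[OF B w h] comm_scalar_prod[OF h t] by simp
  also have "local_form B x h = tr K"
    unfolding local_form_def oneB K_def[symmetric] by (rule frob_one_left[OF K(1)])
  finally have "frob K K = frob (G * G\<^sup>T) K - tr K"
    using \<open>c > 0\<close> by (simp add: local_form_def trA flip: K_def)
  also have "\<dots> = frob R K"
    using G K J by (simp add: R_def frob_add_left[of _ N N] frob_smult_left[of _ N N] J_def
        frob_one_left)
  \<comment> \<open>The squared norm of \<open>K\<close> equals its pairing with \<open>R\<close>,
    so \<open>K\<close> is no longer than \<open>R\<close>.\<close>
  finally have "(frob K K)\<^sup>2 \<le> frob R R * frob K K"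
    using frob_Cauchy_Schwarz[OF R K(1)] by simp
  then have "frob K K \<le> frob R R"
    using frob_self_nonneg[of K] frob_self_nonneg[of R]
    by (cases "frob K K = 0") (auto simp: power2_eq_square)
  then have "local_form B h h < 1"
    using RR by (simp add: local_form_def flip: K_def)
  then have "pos_def (L (x + h))"
    using pos_def_L_if_local[OF x B oneB h] by blast
  moreover have "w = c \<cdot>\<^sub>v (x + h)"
    using w x \<open>c > 0\<close> by (intro eq_vecI) (auto simp: h_def)
  moreover have "x + h \<in> carrier_vec n"
    using x h by simp
  ultimately show "pos_semidef (L w)"
    using pos_def_imp_pos_semidef[OF L_carrier, of "x + h"] L_carrier[of "x + h"] \<open>c > 0\<close>
    by (simp add: L_smult pos_semidef_smult)
qed

end

lemma linear_functional_entry: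
  assumes A: "A \<in> carrier_mat N N" and "lmi n N L" and ij: "i < N" "j < N"
  shows "linear_functional n (\<lambda>v. congr_mat A (L v) $$ (i, j))"
proof -
  interpret lmi n N L by fact
  have "congr_mat A (L x) \<in> carrier_mat N N" for x
    by (rule congr_mat_carrier[OF A])
  then show ?thesis
    unfolding linear_functional_def using A ij
    by (simp add: L_add L_smult congr_mat_add[OF A L_carrier L_carrier]
        congr_mat_smult[OF A L_carrier] del: index_mult_mat(1))
qed

context lmi
begin

text \<open>The form is a sum of squares of linear functionals, one for each matrix entry;
  Cauchy-Schwarz for each of them bounds the form by its trace.\<close>

lemma local_form_le:
  assumes A: "A \<in> carrier_mat N N" and v: "v \<in> carrier_vec n"
  shows "local_form A v v \<le> (v \<bullet> v) * (\<Sum>i<n. local_form A (unit_vec n i) (unit_vec n i))"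
proof -
  define E where "E x = congr_mat A (L x)" for x
  define e :: "nat \<Rightarrow> real vec" where "e = unit_vec n"
  have E: "E x \<in> carrier_mat N N" for x
    unfolding E_def by (rule congr_mat_carrier[OF A])
  have lf: "local_form A x x = (\<Sum>p\<in>{..<N} \<times> {..<N}. (E x $$ p)\<^sup>2)" for x
    unfolding local_form_def E_def[symmetric] by (simp add: frob_pairs[OF E] power2_eq_square)
  have "(E v $$ p)\<^sup>2 \<le> (v \<bullet> v) * (\<Sum>i<n. (E (e i) $$ p)\<^sup>2)" if p: "p \<in> {..<N} \<times> {..<N}" for p
  proof -
    obtain a b where ab: "p = (a, b)" "a < N" "b < N"
      using p by auto
    have "E v $$ p = (\<Sum>i<n. v $ i * E (e i) $$ p)"
      unfolding E_def e_def ab(1)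
      by (rule linear_functional_expand[OF linear_functional_entry[OF A lmi_axioms ab(2,3)] v])
    also have "(\<dots>)\<^sup>2 \<le> (\<Sum>i<n. (v $ i)\<^sup>2) * (\<Sum>i<n. (E (e i) $$ p)\<^sup>2)"
      by (rule Cauchy_Schwarz_ineq_sum)
    also have "(\<Sum>i<n. (v $ i)\<^sup>2) = v \<bullet> v"
      using v by (auto simp: scalar_prod_def power2_eq_square atLeast0LessThan)
    finally show ?thesis .
  qed
  then have "local_form A v v \<le> (\<Sum>p\<in>{..<N} \<times> {..<N}. (v \<bullet> v) * (\<Sum>i<n. (E (e i) $$ p)\<^sup>2))"
    unfolding lf by (rule sum_mono)
  also have "\<dots> = (v \<bullet> v) * (\<Sum>i<n. local_form A (e i) (e i))"
    unfolding lf by (subst sum.swap) (simp add: sum_distrib_left)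
  finally show ?thesis
    by (simp add: e_def)
qed

text \<open>Summing a bilinear form over vectors involves only their second moments. If the moment
  matrix is diagonal, only the diagonal of the form survives.\<close>

lemma local_form_orthogonal_sum:
  assumes A: "A \<in> carrier_mat N N" and q: "\<And>k. k < m \<Longrightarrow> q k \<in> carrier_vec n"
    and orth: "\<And>i j. i < n \<Longrightarrow> j < n \<Longrightarrow>
      (\<Sum>k<m. q k $ i * q k $ j) = (if i = j then D i else 0)"
  shows "(\<Sum>k<m. local_form A (q k) (q k)) =
    (\<Sum>i<n. D i * local_form A (unit_vec n i) (unit_vec n i))"
proof -
  define F where "F i j = local_form A (unit_vec n i) (unit_vec n j)" for i j
  have "(\<Sum>k<m. local_form A (q k) (q k)) =
      (\<Sum>k<m. \<Sum>i<n. \<Sum>j<n. (q k $ i * q k $ j) * F i j)"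
    by (intro sum.cong refl, subst local_form_expand[OF A q q]) (auto simp: F_def mult_ac)
  also have "\<dots> = (\<Sum>i<n. \<Sum>j<n. (\<Sum>k<m. q k $ i * q k $ j) * F i j)"
    by (subst sum.swap, subst sum.swap) (simp add: sum.swap[of _ "{..<m}"] sum_distrib_right)
  also have "\<dots> = (\<Sum>i<n. \<Sum>j<n. (if i = j then D i * F i j else 0))"
    by (intro sum.cong refl) (auto simp: orth)
  finally show ?thesis
    by (simp add: F_def)
qed

section \<open>Compactness of slices and the analytic center\<close>

lemma linear_functional_scalar_prod:
  "t \<in> carrier_vec n \<Longrightarrow> linear_functional n (\<lambda>v. t \<bullet> v)"
  by (simp add: linear_functional_def scalar_prod_add_distrib[of _ n])

lemma continuous_on_linear_functional:
  assumes "linear_functional n \<phi>"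
  shows "continuous_on UNIV (\<lambda>f :: nat \<Rightarrow> real. \<phi> (vec n f))"
proof -
  have "\<phi> (vec n f) = (\<Sum>i<n. f i * \<phi> (unit_vec n i))" for f
    using linear_functional_expand[OF assms, of "vec n f"] by simp
  then show ?thesis
    by (simp add: continuous_on_sum continuous_on_mult continuous_on_product_coordinates
        continuous_on_const)
qed

lemma linear_functional_quad:
  assumes "u \<in> carrier_vec N"
  shows "linear_functional n (\<lambda>v. u \<bullet> (L v *\<^sub>v u))"
proof -
  have "(c \<cdot>\<^sub>m L v) *\<^sub>v u = c \<cdot>\<^sub>v (L v *\<^sub>v u)" if "v \<in> carrier_vec n" for c v
    using that assms L_carrier[OF that] by (intro eq_vecI) auto
  moreover have "L v *\<^sub>v u \<in> carrier_vec N" if "v \<in> carrier_vec n" for v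
    using L_carrier[OF that] assms by simp
  ultimately show ?thesis
    using assms
    by (simp add: linear_functional_def L_add L_smult add_mult_distrib_mat_vec[OF L_carrier L_carrier]
        scalar_prod_add_distrib[of _ N] scalar_prod_smult_distrib[of _ N])
qed

lemma linear_functional_L_entry:
  "i < N \<Longrightarrow> j < N \<Longrightarrow> linear_functional n (\<lambda>v. L v $$ (i, j))"
  by (simp add: linear_functional_def L_add L_smult carrier_matD[OF L_carrier])

text \<open>The extreme value theorem on the slice. Vectors are represented by functions that vanish
  from index \<open>n\<close> on, so the coordinate bound places the slice in a product of compact
  sets, to which Tychonoff's theorem applies.\<close>

lemma det_maximiser_exists:
  assumes t: "t \<in> carrier_vec n" and e: "e \<in> carrier_vec n" "pos_semidef (L e)" "t \<bullet> e = m"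
    and bounded: "\<And>y i. y \<in> carrier_vec n \<Longrightarrow> pos_semidef (L y) \<Longrightarrow> t \<bullet> y = m \<Longrightarrow> i < n \<Longrightarrow>
      \<bar>y $ i\<bar> \<le> R"
  shows "\<exists>y \<in> carrier_vec n. pos_semidef (L y) \<and> t \<bullet> y = m \<and>
    (\<forall>z \<in> carrier_vec n. pos_semidef (L z) \<longrightarrow> t \<bullet> z = m \<longrightarrow> det (L z) \<le> det (L y))"
proof -
  define Q where "Q = (PiE UNIV (\<lambda>i. if i < n then {-R..R} else {0}) :: (nat \<Rightarrow> real) set)"
  \<comment> \<open>Semidefiniteness enters as an intersection of closed half-spaces, one for each
    \<open>u\<close>.\<close>
  define K where "K = Q \<inter> (\<Inter>u \<in> carrier_vec N. {f. 0 \<le> u \<bullet> (L (vec n f) *\<^sub>v u)}) \<inter>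
    {f. t \<bullet> vec n f = m}"
  have "compactin (product_topology (\<lambda>_. euclidean) UNIV) Q"
    unfolding Q_def compactin_PiE by auto
  then have "compact Q"
    by (simp add: euclidean_product_topology)
  moreover have "closed (\<Inter>u \<in> carrier_vec N. {f. 0 \<le> u \<bullet> (L (vec n f) *\<^sub>v u)})"
    by (intro closed_INT ballI closed_Collect_le continuous_on_const continuous_on_linear_functional
        linear_functional_quad)
  moreover have "closed {f. t \<bullet> vec n f = m}"
    by (intro closed_Collect_eq continuous_on_const continuous_on_linear_functional
        linear_functional_scalar_prod t)
  ultimately have "compact K"
    unfolding K_def by (intro compact_Int_closed)
  have rep: "\<exists>f \<in> K. vec n f = y"
    if "y \<in> carrier_vec n" "pos_semidef (L y)" "t \<bullet> y = m" for y
  proof (intro bexI)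
    define f where "f i = (if i < n then y $ i else 0)" for i
    show f: "vec n f = y"
      using that by (intro eq_vecI) (auto simp: f_def)
    show "f \<in> K"
      using that bounded[OF that] L_carrier[OF that(1)]
      by (auto simp: K_def f Q_def pos_semidef_def f_def abs_le_iff minus_le_iff)
  qed
  have "K \<noteq> {}"
    using rep e by blast
  have "continuous_on UNIV (\<lambda>f. det (L (vec n f)))"
    by (intro continuous_on_det[of _ _ N] continuous_on_linear_functional linear_functional_L_entry
        L_carrier) auto
  then have "continuous_on K (\<lambda>f. det (L (vec n f)))"
    using continuous_on_subset by blast
  from continuous_attains_sup[OF \<open>compact K\<close> \<open>K \<noteq> {}\<close> this]
  obtain f where f: "f \<in> K" "\<forall>g \<in> K. det (L (vec n g)) \<le> det (L (vec n f))"
    by blast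
  show ?thesis
  proof (intro bexI[of _ "vec n f"] conjI ballI impI)
    show "pos_semidef (L (vec n f))"
      using f(1) L_carrier[of "vec n f"] by (simp add: K_def pos_semidef_def)
    show "t \<bullet> vec n f = m"
      using f(1) by (simp add: K_def)
    show "det (L z) \<le> det (L (vec n f))"
      if "z \<in> carrier_vec n" "pos_semidef (L z)" "t \<bullet> z = m" for z
      using rep[OF that] f(2) by blast
  qed simp
qed

text \<open>The maximiser of the determinant on the slice \<open>t \<bullet> y = m\<close> is the point at which \<open>t\<close> is,
  up to a factor, the negative gradient of the barrier.\<close>

lemma analytic_center_exists:
  assumes t: "t \<in> carrier_vec n" and e: "e \<in> carrier_vec n" "pos_def (L e)" "t \<bullet> e > 0"
    and m: "m > 0" and N: "N > 0"
    and bounded: "\<And>y i. y \<in> carrier_vec n \<Longrightarrow> pos_semidef (L y) \<Longrightarrow> t \<bullet> y = m \<Longrightarrow> i < n \<Longrightarrow>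
      \<bar>y $ i\<bar> \<le> R"
  obtains y A where "y \<in> carrier_vec n" "t \<bullet> y = m" "pos_semidef (L y)" "A \<in> carrier_mat N N"
    "congr_mat A (L y) = 1\<^sub>m N"
    "\<And>v. v \<in> carrier_vec n \<Longrightarrow> t \<bullet> v = m / N * tr (congr_mat A (L v))"
proof -
  \<comment> \<open>The multiple of \<open>e\<close> on the slice. Its determinant is positive,
    hence so is the maximal one, which keeps the maximiser off the boundary.\<close>
  define e' where "e' = (m / (t \<bullet> e)) \<cdot>\<^sub>v e"
  have e': "e' \<in> carrier_vec n" "t \<bullet> e' = m"
    using t e by (simp_all add: e'_def)
  have psd_e': "pos_semidef (L e')"
    using e m L_carrier[OF e(1)] pos_semidef_smult[OF L_carrier pos_def_imp_pos_semidef[OF L_carrier]]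
    by (simp add: e'_def L_smult)
  have "det (L e') = (m / (t \<bullet> e)) ^ N * det (L e)"
    using e L_carrier[OF e(1)] by (simp add: e'_def L_smult)
  then have det_e': "det (L e') > 0"
    using m e pos_def_det_pos[OF L_carrier L_sym, of e] by simp
  obtain y where y: "y \<in> carrier_vec n" "pos_semidef (L y)" "t \<bullet> y = m"
    and max: "\<And>z. z \<in> carrier_vec n \<Longrightarrow> pos_semidef (L z) \<Longrightarrow> t \<bullet> z = m \<Longrightarrow> det (L z) \<le> det (L y)"
    using det_maximiser_exists[OF t e'(1) psd_e' e'(2) bounded] by blast
  have Ly: "L y \<in> carrier_mat N N" "(L y)\<^sup>T = L y"
    using y L_carrier L_sym by auto
  have det_y: "det (L y) > 0"
    using max[OF e'(1) psd_e' e'(2)] det_e' by simp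
  then have "pos_def (L y)"
    using pos_semidef_nonsingular_imp_pos_def[OF Ly y(2)] by simp
  then obtain A where A: "A \<in> carrier_mat N N" and one: "congr_mat A (L y) = 1\<^sub>m N"
    using pos_def_congruent_one[OF Ly] by blast
  \<comment> \<open>In a direction within the slice the determinant has a local maximum at
    \<open>y\<close>, so its derivative vanishes.\<close>
  have tangent: "tr (congr_mat A (L v)) = 0" if v: "v \<in> carrier_vec n" "t \<bullet> v = 0" for v
  proof -
    have Lv: "L v \<in> carrier_mat N N"
      using v L_carrier by blast
    define F where "F = local_form A v v"
    have F: "F \<ge> 0"
      by (simp add: F_def local_form_def frob_self_nonneg)
    have "((\<lambda>s. det (L y + s \<cdot>\<^sub>m L v)) has_real_derivative det (L y) * tr (A * A\<^sup>T * L v)) (at 0)"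
      using congruent_one_inverse(2)[OF A Ly(1) one] A by (intro DERIV_det[OF Ly(1) Lv]) auto
    \<comment> \<open>The radius makes both \<open>\<bar>s\<bar>\<close> and
      \<open>\<bar>s\<bar> * F\<close> less than 1, also when \<open>F = 0\<close>. Hence the
      squared local length of the move is less than 1, and maximality of \<open>y\<close> applies to
      the new point.\<close>
    moreover have "det (L y + s \<cdot>\<^sub>m L v) \<le> det (L y + 0 \<cdot>\<^sub>m L v)" if s: "\<bar>0 - s\<bar> < 1 / (1 + F)" for s
    proof -
      have "linear_functional n (\<lambda>u. local_form A u w)" for w
        unfolding local_form_def using A congr_mat_carrier[OF A] by (intro linear_functional_frob) auto
      then have "local_form A (s \<cdot>\<^sub>v v) (s \<cdot>\<^sub>v v) = s * (s * F)"
        using v A local_form_commute[OF A v(1), of "s \<cdot>\<^sub>v v"] by (simp add: linear_functional_def F_def)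
      also have "\<dots> = \<bar>s\<bar> * (\<bar>s\<bar> * F)"
        by simp
      also have "\<dots> < 1"
      proof -
        have "\<bar>s\<bar> * (1 + F) < 1"
          using s F by (simp add: field_simps)
        moreover have "0 \<le> \<bar>s\<bar> * F"
          using F by simp
        ultimately have "\<bar>s\<bar> < 1" "\<bar>s\<bar> * F < 1"
          by (simp_all add: distrib_left)
        then show ?thesis
          using mult_strict_mono[of "\<bar>s\<bar>" 1 "\<bar>s\<bar> * F" 1] \<open>0 \<le> \<bar>s\<bar> * F\<close> by simp
      qed
      finally have "pos_def (L (y + s \<cdot>\<^sub>v v))"
        using v by (intro pos_def_L_if_local(2)[OF y(1) A one]) auto
      then have "det (L (y + s \<cdot>\<^sub>v v)) \<le> det (L y)"
        using y v t by (intro max pos_def_imp_pos_semidef[OF L_carrier])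
          (auto simp: scalar_prod_add_distrib[of _ n])
      moreover have "L y + 0 \<cdot>\<^sub>m L v = L y"
        using Ly Lv by (intro eq_matI) auto
      ultimately show ?thesis
        using y v by (simp add: L_add L_smult)
    qed
    ultimately have "det (L y) * tr (A * A\<^sup>T * L v) = 0"
      using F by (intro DERIV_local_max[of "\<lambda>s. det (L y + s \<cdot>\<^sub>m L v)" _ 0 "1 / (1 + F)"]) auto
    then show ?thesis
      using det_y by (simp add: tr_congr_mat[OF A Lv])
  qed
  have "t \<bullet> v = m / N * tr (congr_mat A (L v))" if v: "v \<in> carrier_vec n" for v
  proof -
    \<comment> \<open>Subtracting \<open>k\<close> times \<open>y\<close> makes \<open>v\<close>
      tangent to the slice. On \<open>y\<close> itself the trace is \<open>N\<close>, which is the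
      origin of the factor \<open>m / N\<close>.\<close>
    define k where "k = t \<bullet> v / m"
    have lf: "linear_functional n (\<lambda>v. tr (congr_mat A (L v)))"
      by (rule linear_functional_tr_congr[OF A])
    have "t \<bullet> (v + (- k) \<cdot>\<^sub>v y) = 0"
      using t v y m by (simp add: scalar_prod_add_distrib[of _ n] k_def)
    then have "tr (congr_mat A (L (v + (- k) \<cdot>\<^sub>v y))) = 0"
      using v y by (intro tangent) auto
    then have "tr (congr_mat A (L v)) + (- k) * tr (congr_mat A (L y)) = 0"
      using lf v y unfolding linear_functional_def by (simp only: smult_carrier_vec)
    then have "tr (congr_mat A (L v)) = k * N"
      by (simp add: one tr_one)
    then show ?thesis
      using m N by (simp add: k_def)
  qed
  then show thesis
    using that y A one by blast
qed

end

section \<open>Chebyshev nodes and factorisations\<close>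

text \<open>For \<open>k \<le> D\<close> these are the zeros of \<open>cheb (D + 1)\<close>, the
  nodes of Gauss-Chebyshev quadrature.\<close>

definition cheb_node :: "nat \<Rightarrow> nat \<Rightarrow> real" where
  "cheb_node D k = cos ((2 * real k + 1) * (pi / (2 * (real D + 1))))"

text \<open>Multiplication by \<open>2 * sin b\<close> makes the sum telescope.\<close>

lemma sum_cos_odd_multiples:
  assumes "sin b \<noteq> 0" "sin (2 * real n * b) = 0"
  shows "(\<Sum>k<n. cos ((2 * real k + 1) * b)) = 0"
proof -
  have "2 * sin b * cos ((2 * real k + 1) * b) = sin (2 * real (Suc k) * b) - sin (2 * real k * b)" for k
  proof -
    have "2 * real (Suc k) * b = (2 * real k + 1) * b + b" "2 * real k * b = (2 * real k + 1) * b - b"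
      by (simp_all add: algebra_simps)
    then show ?thesis
      by (simp only: sin_add sin_diff) simp
  qed
  then have "2 * sin b * (\<Sum>k<n. cos ((2 * real k + 1) * b)) =
      (\<Sum>k<n. sin (2 * real (Suc k) * b) - sin (2 * real k * b))"
    by (simp add: sum_distrib_left)
  also have "\<dots> = 0"
    using assms(2) by (subst sum_lessThan_telescope) simp
  finally show ?thesis
    using assms(1) by simp
qed

text \<open>The bounds on \<open>m\<close> put \<open>b\<close> strictly between 0 and pi, while
  \<open>2 * (D + 1) * b\<close> is a multiple of pi. All frequencies \<open>i + j\<close> with
  \<open>i\<close> and \<open>j\<close> at most \<open>D\<close> are in this range.\<close>

lemma cheb_node_sum_cos:
  assumes "0 < m" "m < 2 * (D + 1)"
  shows "(\<Sum>k<D + 1. cos (real m * ((2 * real k + 1) * (pi / (2 * (real D + 1)))))) = 0"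
proof -
  define b where "b = real m * (pi / (2 * (real D + 1)))"
  have "0 < b"
    using assms by (simp add: b_def)
  moreover have "b < pi"
  proof -
    have "real m < 2 * (real D + 1)"
      using assms(2) of_nat_less_iff[of m "2 * (D + 1)", where ?'a = real] by simp
    then have "real m / (2 * (real D + 1)) * pi < 1 * pi"
      by (intro mult_strict_right_mono) auto
    then show ?thesis
      by (simp add: b_def)
  qed
  ultimately have "sin b \<noteq> 0"
    using sin_gt_zero[of b] by simp
  moreover have "2 * real (D + 1) * b = real m * pi"
    by (simp add: b_def field_simps)
  then have "sin (2 * real (D + 1) * b) = 0"
    by simp
  ultimately have "(\<Sum>k<D + 1. cos ((2 * real k + 1) * b)) = 0"
    by (rule sum_cos_odd_multiples)
  then show ?thesis
    by (simp add: b_def mult_ac)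
qed

text \<open>The product formula for cosines leaves sums with the frequencies
  \<open>\<bar>i - j\<bar>\<close> and \<open>i + j\<close>. At \<open>i = j = 0\<close> both
  frequencies vanish, which is why index 0 has twice the weight.\<close>

lemma cheb_node_orthogonal:
  assumes "i \<le> D" "j \<le> D"
  shows "(\<Sum>k<D + 1. poly (cheb i) (cheb_node D k) * poly (cheb j) (cheb_node D k)) =
    (if i = j then (if i = 0 then real D + 1 else (real D + 1) / 2) else 0)"
proof -
  define \<theta> where "\<theta> k = (2 * real k + 1) * (pi / (2 * (real D + 1)))" for k
  define S where "S m = (\<Sum>k<D + 1. cos (real m * \<theta> k))" for m
  have S: "S m = (if m = 0 then real D + 1 else 0)" if "m < 2 * (D + 1)" for m
    using cheb_node_sum_cos[of m D] that by (simp add: S_def \<theta>_def)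
  have *: "(\<Sum>k<D + 1. poly (cheb i) (cheb_node D k) * poly (cheb j) (cheb_node D k)) =
      (S (i - j) + S (i + j)) / 2" if "j \<le> i" for i j
  proof -
    have "poly (cheb i) (cheb_node D k) * poly (cheb j) (cheb_node D k) =
        (cos (real (i - j) * \<theta> k) + cos (real (i + j) * \<theta> k)) / 2" for k
      using that unfolding cheb_node_def \<theta>_def[symmetric]
      by (simp add: poly_cheb_cos cos_times_cos of_nat_diff algebra_simps)
    then show ?thesis
      by (simp only: S_def sum.distrib sum_divide_distrib[symmetric])
  qed
  show ?thesis
  proof (cases "j \<le> i")
    case True
    then show ?thesis
      using assms unfolding *[OF True] by (auto simp: S)
  next
    case False
    then have "(\<Sum>k<D + 1. poly (cheb i) (cheb_node D k) * poly (cheb j) (cheb_node D k)) =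
        (S (j - i) + S (j + i)) / 2"
      using *[of i j] by (simp add: mult.commute)
    then show ?thesis
      using assms False by (auto simp: S)
  qed
qed

lemma cheb_node_angle:
  assumes "k \<le> D"
  shows "0 < (2 * real k + 1) * (pi / (2 * (real D + 1)))" "(2 * real k + 1) * (pi / (2 * (real D + 1))) < pi"
proof -
  show "0 < (2 * real k + 1) * (pi / (2 * (real D + 1)))"
    by simp
  have "(2 * real k + 1) / (2 * (real D + 1)) < 1"
    using assms by simp
  then have "(2 * real k + 1) / (2 * (real D + 1)) * pi < 1 * pi"
    by (intro mult_strict_right_mono) auto
  then show "(2 * real k + 1) * (pi / (2 * (real D + 1))) < pi"
    by simp
qed

lemma cheb_node_bounds:
  assumes "k \<le> D"
  shows "-1 < cheb_node D k" "cheb_node D k < 1"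
  using cos_monotone_0_pi[OF less_imp_le[OF cheb_node_angle(1)[OF assms]]
      cheb_node_angle(2)[OF assms] order.refl]
    cos_monotone_0_pi[OF order.refl cheb_node_angle(1)[OF assms]
      less_imp_le[OF cheb_node_angle(2)[OF assms]]]
  by (simp_all add: cheb_node_def)

lemma inj_on_cheb_node: "inj_on (cheb_node D) {..<D + 1}"
proof (rule inj_onI)
  fix k l assume "k \<in> {..<D + 1}" "l \<in> {..<D + 1}" and eq: "cheb_node D k = cheb_node D l"
  then have kl: "k \<le> D" "l \<le> D"
    by auto
  have "(2 * real k + 1) * (pi / (2 * (real D + 1))) = (2 * real l + 1) * (pi / (2 * (real D + 1)))"
  proof (rule cos_inj_pi)
    show "cos ((2 * real k + 1) * (pi / (2 * (real D + 1)))) =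
        cos ((2 * real l + 1) * (pi / (2 * (real D + 1))))"
      using eq by (simp only: cheb_node_def)
  qed (intro less_imp_le cheb_node_angle kl)+
  moreover have "pi / (2 * (real D + 1)) \<noteq> 0"
    by simp
  ultimately have "2 * real k + 1 = 2 * real l + 1"
    using mult_right_cancel by blast
  then show "k = l"
    by linarith
qed

lemma unisolvent_cheb_nodes: "unisolvent D (cheb_node D ` {..<D + 1})"
  unfolding unisolvent_def
proof (intro ballI impI)
  fix p r :: "real poly"
  assume p: "p \<in> polys_upto D" "r \<in> polys_upto D"
    and eq: "\<forall>z \<in> cheb_node D ` {..<D + 1}. poly p z = poly r z"
  show "p = r"
  proof (rule ccontr)
    assume "p \<noteq> r"
    then have nz: "p - r \<noteq> 0" by simp
    have "cheb_node D ` {..<D + 1} \<subseteq> {z. poly (p - r) z = 0}"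
      using eq by auto
    then have "card (cheb_node D ` {..<D + 1}) \<le> card {z. poly (p - r) z = 0}"
      by (intro card_mono poly_roots_finite nz)
    also have "\<dots> \<le> degree (p - r)"
      by (intro card_poly_roots_bound nz)
    also have "\<dots> \<le> D"
      using p by (intro degree_diff_le) (auto simp: polys_upto_def)
    finally show False
      using card_image[OF inj_on_cheb_node[of D]] by simp
  qed
qed

lemma spectrum_diagonal:
  assumes "A = mat n n (\<lambda>(i, j). if i = j then d i else (0 :: real))"
  shows "spectrum A = d ` {..<n}"
proof -
  have A: "A \<in> carrier_mat n n" "upper_triangular A"
    using assms by auto
  have "diag_mat A = map d [0..<n]"
    using assms by (auto simp: diag_mat_def)
  then have "poly (char_poly A) k = (\<Prod>i\<leftarrow>[0..<n]. k - d i)" for k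
    unfolding char_poly_upper_triangular[OF A] by (simp add: poly_prod_list o_def)
  then show ?thesis
    unfolding spectrum_root_char_poly[OF A(1)] by (auto simp: prod_list_zero_iff)
qed

text \<open>With all weights equal to 1, discrete orthogonality makes the matrix diagonal. Its
  entries take two values in the ratio 2, so the condition number is in fact 2.\<close>

lemma cheb_nodes_well_conditioned:
  assumes "D \<ge> 1"
  shows "\<exists>(Z :: real set) (\<alpha> :: real \<Rightarrow> real).
     finite Z \<and> Z \<subseteq> {-1..1} \<and> unisolvent D Z \<and> (\<forall>z \<in> Z. \<alpha> z > 0) \<and>
     cond_number (mat (D + 1) (D + 1)
       (\<lambda>(i, j). \<Sum>z \<in> Z. \<alpha> z * (cheb_vec D z $ i * cheb_vec D z $ j))) \<le> 4"
proof (intro exI conjI)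
  let ?Z = "cheb_node D ` {..<D + 1}"
  let ?d = "\<lambda>i. if i = 0 then real D + 1 else (real D + 1) / 2"
  show "finite ?Z"
    by simp
  show "unisolvent D ?Z"
    by (rule unisolvent_cheb_nodes)
  show "?Z \<subseteq> {-1..1}"
    using cheb_node_bounds by (force simp: less_Suc_eq_le)
  show "\<forall>z \<in> ?Z. (\<lambda>_. 1 :: real) z > 0"
    by simp
  let ?M = "mat (D + 1) (D + 1) (\<lambda>(i, j). \<Sum>z \<in> ?Z. 1 * (cheb_vec D z $ i * cheb_vec D z $ j))"
  have M: "?M = mat (D + 1) (D + 1) (\<lambda>(i, j). if i = j then ?d i else 0)"
  proof (rule eq_matI)
    fix i j assume "i < dim_row (mat (D + 1) (D + 1) (\<lambda>(i, j). if i = j then ?d i else 0))"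
      "j < dim_col (mat (D + 1) (D + 1) (\<lambda>(i, j). if i = j then ?d i else 0))"
    then have ij: "i \<le> D" "j \<le> D"
      by auto
    then have "?M $$ (i, j) =
        (\<Sum>k<D + 1. poly (cheb i) (cheb_node D k) * poly (cheb j) (cheb_node D k))"
      by (simp add: cheb_vec_def sum.reindex[OF inj_on_cheb_node, simplified])
    then show "?M $$ (i, j) = mat (D + 1) (D + 1) (\<lambda>(i, j). if i = j then ?d i else 0) $$ (i, j)"
      using ij cheb_node_orthogonal[OF ij] by simp
  qed auto
  \<comment> \<open>The smaller value occurs because \<open>D \<ge> 1\<close>.\<close>
  have "?d ` {..<D + 1} = {real D + 1, (real D + 1) / 2}"
  proof
    show "{real D + 1, (real D + 1) / 2} \<subseteq> ?d ` {..<D + 1}"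
      using imageI[of 0 "{..<D + 1}" ?d] imageI[of 1 "{..<D + 1}" ?d] assms by simp
  qed auto
  then have "spectrum ?M = {real D + 1, (real D + 1) / 2}"
    using spectrum_diagonal[OF M] by simp
  then show "cond_number ?M \<le> 4"
    by (simp add: cond_number_def field_simps)
qed

section \<open>Factorisations of 1 plus or minus a Chebyshev polynomial, from identities between
  cosines\<close>

lemma poly_eqI_cos:
  fixes p q :: "real poly"
  assumes "\<And>t. poly p (cos t) = poly q (cos t)"
  shows "p = q"
proof (rule ccontr)
  assume "p \<noteq> q"
  then have "finite {z. poly (p - q) z = 0}"
    by (intro poly_roots_finite) simp
  moreover have "{-1..1} \<subseteq> {z. poly (p - q) z = 0}"
  proof
    fix z :: real assume "z \<in> {-1..1}"
    then have "cos (arccos z) = z" by simp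
    then show "z \<in> {z. poly (p - q) z = 0}"
      using assms[of "arccos z"] by simp
  qed
  ultimately have "finite {-1..1 :: real}"
    by (rule rev_finite_subset)
  then show False
    using infinite_Icc[of "-1 :: real" 1] by simp
qed

lemma one_plus_cheb_even: "1 + cheb (2 * m) = smult 2 ((cheb m)\<^sup>2)"
proof (rule poly_eqI_cos)
  fix t
  have "cos (real (2 * m) * t) = cos (2 * (real m * t))"
    by (simp add: mult_ac)
  then show "poly (1 + cheb (2 * m)) (cos t) = poly (smult 2 ((cheb m)\<^sup>2)) (cos t)"
    using cos_double_cos[of "real m * t"] by (simp add: poly_cheb_cos poly_power)
qed

lemma poly_root_factor:
  fixes p :: "real poly"
  assumes "poly p c = 0"
  obtains q where "p = [:- c, 1:] * q"
  using assms by (auto simp only: poly_eq_0_iff_dvd dvd_def)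

lemma degree_linear_cofactor:
  fixes p W :: "real poly"
  assumes "p = [:c, 1:] * W" "degree p \<le> Suc m"
  shows "degree W \<le> m"
proof (cases "W = 0")
  case False
  then have "degree p = Suc (degree W)"
    unfolding assms(1) by (subst degree_mult_eq) auto
  then show ?thesis
    using assms(2) by simp
qed simp

lemma degree_cheb_eq: "degree (cheb n) = n"
  using degree_cheb by blast

text \<open>The square \<open>(T\<^sub>m \<plusminus> T\<^sub>m\<^sub>+\<^sub>1)\<^sup>2 = (1 \<plusminus> z) (1 \<plusminus> T\<^sub>2\<^sub>m\<^sub>+\<^sub>1)\<close> yields the factorisation without the
  Chebyshev polynomials of the third and fourth kind.\<close>

lemma one_plus_cheb_odd: "\<exists>W. degree W \<le> m \<and> 1 + cheb (2 * m + 1) = [:1, 1:] * W\<^sup>2"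
proof -
  let ?p = "cheb m + cheb (Suc m)"
  have sq: "?p\<^sup>2 = [:1, 1:] * (1 + cheb (2 * m + 1))"
  proof (rule poly_eqI_cos)
    fix t
    define a where "a = real m * t"
    have e: "real (Suc m) * t = a + t" "real (2 * m + 1) * t = a + (a + t)"
      by (simp_all add: a_def algebra_simps)
    have "poly (?p\<^sup>2) (cos t) = (cos a + cos (a + t))\<^sup>2"
      by (simp only: poly_cheb_cos poly_power poly_add e flip: a_def)
    also have "\<dots> = (1 + cos t) * (1 + cos (a + (a + t)))"
    proof -
      define x y where "x = cos a" and "y = cos (a + t)"
      have "cos t = cos ((a + t) - a)" by simp
      then have ct: "cos t = y * x + sin (a + t) * sin a"
        by (simp only: cos_diff x_def y_def)
      have c2: "cos (a + (a + t)) = x * y - sin a * sin (a + t)"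
        by (simp only: cos_add[of a "a + t"] x_def y_def)
      have "(sin a * sin (a + t))\<^sup>2 = (1 - x\<^sup>2) * (1 - y\<^sup>2)"
        by (simp add: power_mult_distrib sin_squared_eq x_def y_def)
      then have s: "sin a * sin (a + t) * (sin a * sin (a + t)) = (1 - x * x) * (1 - y * y)"
        by (simp add: power2_eq_square)
      have "(1 + cos t) * (1 + cos (a + (a + t))) =
          (1 + x * y) * (1 + x * y) - sin a * sin (a + t) * (sin a * sin (a + t))"
        unfolding ct c2 by (simp add: algebra_simps)
      also have "\<dots> = (x + y)\<^sup>2"
        unfolding s by (simp add: algebra_simps power2_eq_square)
      finally show ?thesis
        by (simp add: x_def y_def)
    qed
    also have "\<dots> = poly ([:1, 1:] * (1 + cheb (2 * m + 1))) (cos t)"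
      by (simp only: poly_cheb_cos poly_mult poly_add poly_1 e) simp
    finally show "poly (?p\<^sup>2) (cos t) = poly ([:1, 1:] * (1 + cheb (2 * m + 1))) (cos t)" .
  qed
  \<comment> \<open>By \<open>sq\<close> the square vanishes at -1, hence so does its base, and a
    linear factor can be split off.\<close>
  have "poly ?p (-1) = 0"
    using arg_cong[OF sq, of "\<lambda>q. poly q (-1)"] by (simp add: poly_power)
  then obtain W where W: "?p = [:1, 1:] * W"
    using poly_root_factor[of ?p "-1"] by (auto simp only: minus_minus)
  have "degree ?p \<le> Suc m"
    by (intro degree_add_le) (auto simp: degree_cheb_eq simp del: cheb.simps)
  then have "degree W \<le> m"
    using degree_linear_cofactor[OF W] by blast
  moreover have "[:1, 1:] * ([:1, 1:] * W\<^sup>2) = [:1, 1:] * (1 + cheb (2 * m + 1))"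
    using sq unfolding W by (simp add: power2_eq_square mult_ac del: mult_pCons_left mult_pCons_right)
  then have "[:1, 1:] * W\<^sup>2 = 1 + cheb (2 * m + 1)"
    by (subst (asm) mult_left_cancel) auto
  ultimately show ?thesis
    by metis
qed

text \<open>Chebyshev polynomials of odd index are odd functions, so the previous factorisation is
  used at \<open>-z\<close>; for the angle this is a shift by pi.\<close>

lemma one_minus_cheb_odd: "\<exists>V. degree V \<le> m \<and> 1 - cheb (2 * m + 1) = [:1, -1:] * V\<^sup>2"
proof -
  obtain W where W: "degree W \<le> m" "1 + cheb (2 * m + 1) = [:1, 1:] * W\<^sup>2"
    using one_plus_cheb_odd by blast
  let ?V = "pcompose W [:0, -1:]"
  have "1 - cheb (2 * m + 1) = [:1, -1:] * ?V\<^sup>2"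
  proof (rule poly_eqI_cos)
    fix t
    have c: "cos (real (2 * m + 1) * (t + pi)) = - cos (real (2 * m + 1) * t)"
    proof -
      have "real (2 * m + 1) * (t + pi) = real (2 * m + 1) * t + real (2 * m + 1) * pi"
        by (simp add: distrib_left)
      then show ?thesis
        by (simp only: cos_add sin_npi cos_npi) simp
    qed
    have "poly (1 + cheb (2 * m + 1)) (cos (t + pi)) = poly ([:1, 1:] * W\<^sup>2) (cos (t + pi))"
      using W by simp
    then have "1 + cos (real (2 * m + 1) * (t + pi)) =
        (1 + cos (t + pi)) * (poly W (cos (t + pi)))\<^sup>2"
      by (simp only: poly_cheb_cos poly_add poly_1 poly_mult poly_power) simp
    then show "poly (1 - cheb (2 * m + 1)) (cos t) = poly ([:1, -1:] * ?V\<^sup>2) (cos t)"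
      unfolding c by (simp only: poly_cheb_cos poly_diff poly_1 poly_mult poly_power poly_pcompose) simp
  qed
  moreover have "degree ?V \<le> m"
    using W by simp
  ultimately show ?thesis
    by blast
qed

text \<open>The difference of the Chebyshev polynomials of indices \<open>m + 1\<close> and
  \<open>m - 1\<close> is \<open>z^2 - 1\<close> times \<open>U\<close>, where \<open>U\<close> is
  twice the Chebyshev polynomial of the second kind of degree \<open>m - 1\<close>.\<close>

lemma one_minus_cheb_even:
  assumes "m \<ge> 1"
  shows "\<exists>U. degree U \<le> m - 1 \<and> 1 - cheb (2 * m) = smult (1 / 2) ([:1, 0, -1:] * U\<^sup>2)"
proof -
  obtain l where m: "m = Suc l"
    using assms by (cases m) auto
  let ?p = "cheb (Suc m) - cheb l"
  have sq: "?p\<^sup>2 = smult 2 ([:1, 0, -1:] * (1 - cheb (2 * m)))"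
  proof (rule poly_eqI_cos)
    fix t
    define a where "a = real m * t"
    have e: "real (Suc m) * t = a + t" "real l * t = a - t" "real (2 * m) * t = 2 * a"
      by (simp_all add: a_def m algebra_simps)
    have "poly (?p\<^sup>2) (cos t) = (cos (a + t) - cos (a - t))\<^sup>2"
      by (simp only: poly_cheb_cos poly_power poly_diff e)
    also have "\<dots> = 4 * ((sin a)\<^sup>2 * (sin t)\<^sup>2)"
      by (simp add: cos_add cos_diff power2_eq_square)
    also have "\<dots> = 2 * ((1 - (cos t)\<^sup>2) * (1 - cos (2 * a)))"
      by (simp add: cos_double_sin sin_squared_eq[of t])
    also have "\<dots> = poly (smult 2 ([:1, 0, -1:] * (1 - cheb (2 * m)))) (cos t)"
      by (simp only: poly_cheb_cos poly_smult poly_mult poly_diff poly_1 e)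
        (simp add: power2_eq_square)
    finally show "poly (?p\<^sup>2) (cos t) = poly (smult 2 ([:1, 0, -1:] * (1 - cheb (2 * m)))) (cos t)" .
  qed
  have "poly ?p (-1) = 0" "poly ?p 1 = 0"
    using arg_cong[OF sq, of "\<lambda>q. poly q (-1)"] arg_cong[OF sq, of "\<lambda>q. poly q 1"]
    by (simp_all add: poly_power)
  then obtain W where W: "?p = [:1, 1:] * W"
    using poly_root_factor[of ?p "-1"] by (auto simp only: minus_minus)
  have "poly W 1 = 0"
    using \<open>poly ?p 1 = 0\<close> unfolding W by simp
  then obtain U where U: "W = [:-1, 1:] * U"
    using poly_root_factor by blast
  have "degree ?p \<le> Suc m"
    using m by (intro degree_diff_le) (auto simp: degree_cheb_eq simp del: cheb.simps)
  then have "degree W \<le> Suc l"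
    using degree_linear_cofactor[OF W] m by blast
  then have "degree U \<le> l"
    using degree_linear_cofactor[OF U] by blast
  moreover have "[:1, 0, -1:] * ([:1, 0, -1:] * U\<^sup>2) = [:1, 0, -1:] * smult 2 (1 - cheb (2 * m))"
  proof -
    have 1: "[:1, 1:] * [:-1, 1 :: real:] = - [:1, 0, -1:]"
      by simp
    have "?p = [:1, 1:] * [:-1, 1:] * U"
      by (simp only: W U mult.assoc)
    then have "?p = - ([:1, 0, -1:] * U)"
      by (simp only: 1 mult_minus_left)
    then have "?p\<^sup>2 = ([:1, 0, -1:] * U)\<^sup>2"
      by (simp only: power2_minus)
    moreover have "(A * U)\<^sup>2 = A * (A * U\<^sup>2)" for A
      by (simp add: power2_eq_square mult_ac)
    ultimately have "?p\<^sup>2 = [:1, 0, -1:] * ([:1, 0, -1:] * U\<^sup>2)"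
      by (simp only:)
    then show ?thesis
      using sq by (simp only: mult_smult_right)
  qed
  then have "[:1, 0, -1:] * U\<^sup>2 = smult 2 (1 - cheb (2 * m))"
    by (subst (asm) mult_left_cancel) auto
  ultimately show ?thesis
    using m by (intro exI[of _ U]) simp
qed

section \<open>The dual cone\<close>

lemma poly_poly_of_vec:
  assumes "s \<in> carrier_vec (D + 1)"
  shows "poly (poly_of_vec s) z = s \<bullet> cheb_vec D z"
  using assms by (auto simp: poly_of_vec_def cheb_vec_def scalar_prod_def poly_sum atLeast0LessThan)

lemma poly_of_vec_surj:
  assumes "degree p \<le> D"
  obtains s where "s \<in> carrier_vec (D + 1)" "poly_of_vec s = p"
proof -
  obtain c where c: "p = (\<Sum>i<Suc D. smult (c i) (cheb i))"
    using cheb_expansion[OF assms] by blast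
  have "poly_of_vec (vec (D + 1) c) = p"
    unfolding c poly_of_vec_def by (intro sum.cong) auto
  then show thesis
    using that[of "vec (D + 1) c"] by simp
qed

text \<open>The functional on polynomials belonging to a dual vector, in the form of a quadrature formula,
  which makes it linear on all polynomials without mentioning coordinates.\<close>

definition dual_apply :: "nat \<Rightarrow> real vec \<Rightarrow> real poly \<Rightarrow> real" where
  "dual_apply D x p = (\<Sum>k<D + 1. (\<Sum>i<D + 1. (if i = 0 then 1 else 2) / (real D + 1) * x $ i *
     poly (cheb i) (cheb_node D k)) * poly p (cheb_node D k))"

lemma dual_apply_0: "dual_apply D x 0 = 0"
  by (simp add: dual_apply_def)

lemma dual_apply_add: "dual_apply D x (p + q) = dual_apply D x p + dual_apply D x q"
  by (simp only: dual_apply_def poly_add distrib_left sum.distrib)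

lemma dual_apply_smult: "dual_apply D x (smult c p) = c * dual_apply D x p"
  unfolding dual_apply_def poly_smult sum_distrib_left by (intro sum.cong) (auto simp: mult_ac)

lemma dual_apply_sum: "dual_apply D x (sum f A) = (\<Sum>a\<in>A. dual_apply D x (f a))"
  by (induction A rule: infinite_finite_induct) (auto simp: dual_apply_0 dual_apply_add)

text \<open>The factors in \<open>dual_apply\<close> are the reciprocals of the sums of squares in
  \<open>cheb_node_orthogonal\<close>, so discrete orthogonality returns the coordinate.\<close>

lemma dual_apply_cheb:
  assumes "j \<le> D"
  shows "dual_apply D x (cheb j) = x $ j"
proof -
  let ?T = "\<lambda>i k. poly (cheb i) (cheb_node D k)"
  let ?g = "\<lambda>i. (if i = 0 then 1 else 2) / (real D + 1)"
  have "dual_apply D x (cheb j) = (\<Sum>k<D + 1. \<Sum>i<D + 1. ?g i * x $ i * (?T i k * ?T j k))"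
    by (simp only: dual_apply_def sum_distrib_right mult.assoc)
  also have "\<dots> = (\<Sum>i<D + 1. ?g i * x $ i * (\<Sum>k<D + 1. ?T i k * ?T j k))"
    by (subst sum.swap) (simp only: sum_distrib_left)
  also have "\<dots> = (\<Sum>i<D + 1. if i = j then x $ i else 0)"
    using assms by (intro sum.cong refl, subst cheb_node_orthogonal) auto
  also have "\<dots> = x $ j"
    using assms by (subst sum.delta) auto
  finally show ?thesis .
qed

lemma dual_apply_poly_of_vec:
  assumes s: "s \<in> carrier_vec (D + 1)" and x: "x \<in> carrier_vec (D + 1)"
  shows "dual_apply D x (poly_of_vec s) = s \<bullet> x"
proof -
  have "dual_apply D x (poly_of_vec s) = (\<Sum>i<D + 1. s $ i * x $ i)"
    unfolding poly_of_vec_def dual_apply_sum dual_apply_smult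
    using s by (intro sum.cong) (auto simp: dual_apply_cheb)
  then show ?thesis
    using x by (simp add: scalar_prod_def atLeast0LessThan)
qed

lemma dual_apply_cheb_vec:
  assumes "degree p \<le> D"
  shows "dual_apply D (cheb_vec D z) p = poly p z"
proof -
  obtain s where s: "s \<in> carrier_vec (D + 1)" "poly_of_vec s = p"
    using poly_of_vec_surj[OF assms] by blast
  have "cheb_vec D z \<in> carrier_vec (D + 1)"
    by (simp add: cheb_vec_def)
  then show ?thesis
    using dual_apply_poly_of_vec[OF s(1)] poly_poly_of_vec[OF s(1)] s(2) by metis
qed

text \<open>Read as a dual vector, the zeroth unit vector is the mean over the nodes. Being a
  quadrature with positive weights, it supplies a point of the dual cone at which
  \<open>Lambda_sum\<close> is positive definite.\<close>

lemma dual_apply_one: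
  "dual_apply D (one_coeffs D) p = (\<Sum>k<D + 1. poly p (cheb_node D k)) / (real D + 1)"
proof -
  have "(\<Sum>i<D + 1. (if i = 0 then 1 else 2) / (real D + 1) * one_coeffs D $ i *
      poly (cheb i) (cheb_node D k)) = 1 / (real D + 1)" for k
  proof -
    have "(\<Sum>i<D + 1. (if i = 0 then 1 else 2) / (real D + 1) * one_coeffs D $ i *
        poly (cheb i) (cheb_node D k)) = (\<Sum>i<D + 1. if i = 0 then 1 / (real D + 1) else 0)"
      by (intro sum.cong) (auto simp: one_coeffs_def)
    then show ?thesis
      by (subst (asm) sum.delta) auto
  qed
  then show ?thesis
    unfolding dual_apply_def by (simp only: sum_divide_distrib) simp
qed

lemma degree_weighted_square:
  fixes w p :: "real poly"
  assumes "degree p \<le> k" "degree w + 2 * k \<le> D"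
  shows "degree (w * p\<^sup>2) \<le> D"
  using assms degree_mult_le[of w "p\<^sup>2"] degree_power_le[of p 2] by linarith

text \<open>Single weighted squares generate the cone and the functional is additive, so it suffices
  to test on them. Their degrees stay within \<open>D\<close>, so that each of them has a
  coefficient vector.\<close>

lemma Sigma_dual_iff:
  assumes D: "D \<ge> 2"
  shows "y \<in> Sigma_dual D \<longleftrightarrow> y \<in> carrier_vec (D + 1) \<and>
    (\<forall>p. degree p \<le> deg1 D \<longrightarrow> 0 \<le> dual_apply D y (weight1 D * p\<^sup>2)) \<and>
    (\<forall>p. degree p \<le> deg2 D \<longrightarrow> 0 \<le> dual_apply D y (weight2 D * p\<^sup>2))"
proof (intro iffI conjI allI impI; (elim conjE)?)
  assume y: "y \<in> Sigma_dual D"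
  then show yc: "y \<in> carrier_vec (D + 1)"
    by (simp add: Sigma_dual_def)
  have *: "0 \<le> dual_apply D y q"
    if q: "degree q \<le> D" "q = weight1 D * s1 + weight2 D * s2" "s1 \<in> sos (deg1 D)" "s2 \<in> sos (deg2 D)"
    for q s1 s2
  proof -
    obtain s where s: "s \<in> carrier_vec (D + 1)" "poly_of_vec s = q"
      using poly_of_vec_surj[OF q(1)] by blast
    then have "s \<in> Sigma_cone D"
      unfolding Sigma_cone_def using q by blast
    then show ?thesis
      using y dual_apply_poly_of_vec[OF s(1) yc] s(2) by (simp add: Sigma_dual_def)
  qed
  have sq: "p\<^sup>2 \<in> sos k" if "degree p \<le> k" for p :: "real poly" and k
    using that by (auto simp: sos_def polys_upto_def intro!: exI[of _ "[p]"])
  have sos0: "0 \<in> sos k" for k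
    by (auto simp: sos_def intro!: exI[of _ "[]"])
  show "0 \<le> dual_apply D y (weight1 D * p\<^sup>2)" if "degree p \<le> deg1 D" for p
    using that *[OF degree_weighted_square[OF that degree_weights(1)[OF D]] _ sq[OF that] sos0] by simp
  show "0 \<le> dual_apply D y (weight2 D * p\<^sup>2)" if "degree p \<le> deg2 D" for p
    using that *[OF degree_weighted_square[OF that degree_weights(2)[OF D]] _ sos0 sq[OF that]] by simp
next
  assume yc: "y \<in> carrier_vec (D + 1)"
    and y1: "\<forall>p. degree p \<le> deg1 D \<longrightarrow> 0 \<le> dual_apply D y (weight1 D * p\<^sup>2)"
    and y2: "\<forall>p. degree p \<le> deg2 D \<longrightarrow> 0 \<le> dual_apply D y (weight2 D * p\<^sup>2)"
  have *: "0 \<le> dual_apply D y (w * (\<Sum>p\<leftarrow>ps. p\<^sup>2))"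
    if "\<And>p. p \<in> set ps \<Longrightarrow> 0 \<le> dual_apply D y (w * p\<^sup>2)" for w ps
    using that by (induction ps) (auto simp: dual_apply_0 dual_apply_add distrib_left)
  show "y \<in> Sigma_dual D"
    unfolding Sigma_dual_def
  proof (intro CollectI conjI ballI yc)
    fix s assume "s \<in> Sigma_cone D"
    then obtain s1 s2 where s: "s \<in> carrier_vec (D + 1)" "s1 \<in> sos (deg1 D)" "s2 \<in> sos (deg2 D)"
      "poly_of_vec s = weight1 D * s1 + weight2 D * s2"
      unfolding Sigma_cone_def by blast
    have "0 \<le> dual_apply D y (weight1 D * s1)" "0 \<le> dual_apply D y (weight2 D * s2)"
      using s(2,3) y1 y2 unfolding sos_def polys_upto_def by (auto intro!: *)
    then show "0 \<le> s \<bullet> y"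
      using dual_apply_poly_of_vec[OF s(1) yc] s(4) by (simp add: dual_apply_add)
  qed
qed

lemma Sigma_dual_carrier: "y \<in> Sigma_dual D \<Longrightarrow> y \<in> carrier_vec (D + 1)"
  by (simp add: Sigma_dual_def)

section \<open>Point evaluations and node averages in the dual cone\<close>

lemma weights_nonneg:
  assumes "z \<in> {-1..1}"
  shows "0 \<le> poly (weight1 D) z" "0 \<le> poly (weight2 D) z"
proof -
  have "0 \<le> (1 - z) * (1 + z)"
    using assms by (intro mult_nonneg_nonneg) auto
  then show "0 \<le> poly (weight1 D) z" "0 \<le> poly (weight2 D) z"
    using assms by (auto simp: weight1_def weight2_def algebra_simps)
qed

lemma weights_pos:
  assumes "-1 < z" "z < 1"
  shows "0 < poly (weight1 D) z" "0 < poly (weight2 D) z"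
proof -
  have "0 < (1 - z) * (1 + z)"
    using assms by (intro mult_pos_pos) auto
  then show "0 < poly (weight1 D) z" "0 < poly (weight2 D) z"
    using assms by (auto simp: weight1_def weight2_def algebra_simps)
qed

lemma cheb_vec_in_Sigma_dual:
  assumes D: "D \<ge> 2" and z: "z \<in> {-1..1}"
  shows "cheb_vec D z \<in> Sigma_dual D"
  unfolding Sigma_dual_iff[OF D]
proof (intro conjI allI impI)
  show "cheb_vec D z \<in> carrier_vec (D + 1)"
    by (simp add: cheb_vec_def)
  show "0 \<le> dual_apply D (cheb_vec D z) (weight1 D * p\<^sup>2)" if "degree p \<le> deg1 D" for p
    using dual_apply_cheb_vec[OF degree_weighted_square[OF that degree_weights(1)[OF D]]]
      weights_nonneg[OF z] by (simp add: poly_power)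
  show "0 \<le> dual_apply D (cheb_vec D z) (weight2 D * p\<^sup>2)" if "degree p \<le> deg2 D" for p
    using dual_apply_cheb_vec[OF degree_weighted_square[OF that degree_weights(2)[OF D]]]
      weights_nonneg[OF z] by (simp add: poly_power)
qed

lemma one_in_Sigma_dual:
  assumes D: "D \<ge> 2"
  shows "one_coeffs D \<in> Sigma_dual D"
proof -
  have "0 \<le> dual_apply D (one_coeffs D) (w * p\<^sup>2)"
    if "\<And>z. z \<in> {-1..1} \<Longrightarrow> 0 \<le> poly w z" for w p
    unfolding dual_apply_one using that cheb_node_bounds
    by (intro divide_nonneg_nonneg sum_nonneg)
      (auto simp: poly_power less_imp_le intro!: mult_nonneg_nonneg)
  then show ?thesis
    unfolding Sigma_dual_iff[OF D] using weights_nonneg by (simp add: one_coeffs_def)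
qed

text \<open>Both \<open>1 + cheb i\<close> and \<open>1 - cheb i\<close> are weighted sums of
  squares. If \<open>i\<close> and \<open>D\<close> have the same parity, the factorisations already
  carry the right weights. Otherwise the weights are converted: for even \<open>D\<close> by
  \<open>2 (1 + c z) = (1 + c z)^2 + (1 - z^2)\<close> with \<open>c\<close> equal to 1 or -1, for
  odd \<open>D\<close> by \<open>2 = (1 - z) + (1 + z)\<close> and
  \<open>2 (1 - z^2) = (1 - z) (1 + z)^2 + (1 + z) (1 - z)^2\<close>.\<close>

lemma Sigma_dual_dominated:
  assumes D: "D \<ge> 2" and y: "y \<in> Sigma_dual D" and i: "i \<le> D"
  shows "\<bar>y $ i\<bar> \<le> y $ 0"
proof -
  have y1: "0 \<le> dual_apply D y (weight1 D * p\<^sup>2)" if "degree p \<le> deg1 D" for p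
    using y that Sigma_dual_iff[OF D] by blast
  have y2: "0 \<le> dual_apply D y (weight2 D * p\<^sup>2)" if "degree p \<le> deg2 D" for p
    using y that Sigma_dual_iff[OF D] by blast
  have one: "dual_apply D y 1 = y $ 0"
    using dual_apply_cheb[of 0 D y] by simp
  have "0 \<le> dual_apply D y (1 + cheb i) \<and> 0 \<le> dual_apply D y (1 - cheb i)"
  proof (cases "even D")
    case D_even: True
    then obtain d where d: "D = 2 * d" by blast
    then have w: "weight1 D = 1" "weight2 D = [:1, 0, -1:]" "deg1 D = d" "deg2 D = d - 1" "d \<ge> 1"
      using D by (auto simp: weight1_def weight2_def deg1_def deg2_def)
    show ?thesis
    proof (cases "even i")
      case True
      then obtain m where m: "i = 2 * m" by blast
      then have "m \<le> d" using i d by simp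
      then have plus: "0 \<le> dual_apply D y (1 + cheb i)"
        using y1[of "cheb m"] unfolding m one_plus_cheb_even
        by (simp add: dual_apply_smult w degree_cheb_eq)
      have "0 \<le> dual_apply D y (1 - cheb i)"
      proof (cases "m = 0")
        case True
        then show ?thesis by (simp add: m dual_apply_0)
      next
        case False
        then obtain U where U: "degree U \<le> m - 1" "1 - cheb (2 * m) = smult (1 / 2) ([:1, 0, -1:] * U\<^sup>2)"
          using one_minus_cheb_even[of m] by force
        have "degree U \<le> deg2 D"
          using U(1) \<open>m \<le> d\<close> w by linarith
        from y2[OF this] show ?thesis
          unfolding m U(2) dual_apply_smult w by simp
      qed
      with plus show ?thesis ..
    next
      case False
      then obtain m where m: "i = 2 * m + 1" using oddE by blast
      then have md: "m + 1 \<le> d" using i d by simp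
      \<comment> \<open>The degrees just fit: \<open>[:1, c:] * W\<close> has degree at most
        \<open>m + 1 \<le> d\<close>, and \<open>W\<close>, which gets the weight
        \<open>1 - z^2\<close>, at most \<open>m \<le> d - 1\<close>.\<close>
      have half: "0 \<le> dual_apply D y ([:1, c:] * W\<^sup>2)" if W: "degree W \<le> m" and c: "c\<^sup>2 = 1" for W c
      proof -
        have cc: "c * c = 1"
          using c by (simp add: power2_eq_square)
        have "degree ([:1, c:] * W) \<le> deg1 D"
          using degree_mult_le[of "[:1, c:]" W] W md w by (simp split: if_splits)
        then have "0 \<le> dual_apply D y (([:1, c:] * W)\<^sup>2)"
          using y1 by (simp add: w)
        moreover have "0 \<le> dual_apply D y ([:1, 0, -1:] * W\<^sup>2)"
          using y2[of W] W md unfolding w by simp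
        moreover have "[:1, c:] * W\<^sup>2 =
            smult (1 / 2) (([:1, c:] * W)\<^sup>2) + smult (1 / 2) ([:1, 0, -1:] * W\<^sup>2)"
        proof -
          have "[:1, c:] = smult (1 / 2) ([:1, c:] * [:1, c:]) + smult (1 / 2) [:1, 0, -1:]"
            by (simp add: cc)
          then have "[:1, c:] * W\<^sup>2 =
              (smult (1 / 2) ([:1, c:] * [:1, c:]) + smult (1 / 2) [:1, 0, -1:]) * W\<^sup>2"
            by (simp only:)
          then show ?thesis
            by (simp only: power_mult_distrib power2_eq_square[of "[:1, c:]"] distrib_right
                mult_smult_left mult.assoc)
        qed
        ultimately show ?thesis
          by (simp only: dual_apply_add dual_apply_smult)
      qed
      obtain W where W: "degree W \<le> m" "1 + cheb i = [:1, 1:] * W\<^sup>2"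
        using one_plus_cheb_odd[of m] m by auto
      obtain V where V: "degree V \<le> m" "1 - cheb i = [:1, -1:] * V\<^sup>2"
        using one_minus_cheb_odd[of m] m by auto
      show ?thesis
        unfolding W(2) V(2) using half[OF W(1), of 1] half[OF V(1), of "-1"] by simp
    qed
  next
    case D_odd: False
    then obtain d where d: "D = 2 * d + 1" using oddE by blast
    then have w: "weight1 D = [:1, -1:]" "weight2 D = [:1, 1:]" "deg1 D = d" "deg2 D = d"
      by (auto simp: weight1_def weight2_def deg1_def deg2_def)
    show ?thesis
    proof (cases "even i")
      case True
      then obtain m where m: "i = 2 * m" by blast
      then have md: "m \<le> d" using i d by simp
      have "smult 2 ((cheb m)\<^sup>2) = [:1, -1:] * (cheb m)\<^sup>2 + [:1, 1:] * (cheb m)\<^sup>2"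
        unfolding distrib_right[symmetric] by simp
      then have plus: "0 \<le> dual_apply D y (1 + cheb i)"
        using y1[of "cheb m"] y2[of "cheb m"] md unfolding m one_plus_cheb_even w
        by (simp only: dual_apply_add degree_cheb_eq True_implies_equals add_nonneg_nonneg)
      have "0 \<le> dual_apply D y (1 - cheb i)"
      proof (cases "m = 0")
        case True
        then show ?thesis by (simp add: m dual_apply_0)
      next
        case False
        then obtain U where U: "degree U \<le> m - 1" "1 - cheb (2 * m) = smult (1 / 2) ([:1, 0, -1:] * U\<^sup>2)"
          using one_minus_cheb_even[of m] by force
        have "degree ([:1, c:] * U) \<le> d" for c
          using degree_mult_le[of "[:1, c:]" U] U(1) md False by (simp split: if_splits)
        then have "0 \<le> dual_apply D y ([:1, -1:] * ([:1, 1:] * U)\<^sup>2)"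
          "0 \<le> dual_apply D y ([:1, 1:] * ([:1, -1:] * U)\<^sup>2)"
          using y1 y2 unfolding w by blast+
        moreover have "smult (1 / 2) ([:1, 0, -1:] * U\<^sup>2) =
            smult (1 / 4) ([:1, -1:] * ([:1, 1:] * U)\<^sup>2) + smult (1 / 4) ([:1, 1:] * ([:1, -1:] * U)\<^sup>2)"
        proof -
          have "smult (1 / 2) [:1, 0, -1:] =
              smult (1 / 4) ([:1, -1:] * ([:1, 1:] * [:1, 1:])) +
              smult (1 / 4) ([:1, 1:] * ([:1, -1:] * [:1, -1 :: real:]))"
            by simp
          then have "smult (1 / 2) [:1, 0, -1:] * U\<^sup>2 =
              (smult (1 / 4) ([:1, -1:] * ([:1, 1:] * [:1, 1:])) +
              smult (1 / 4) ([:1, 1:] * ([:1, -1:] * [:1, -1:]))) * U\<^sup>2"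
            by (simp only:)
          then show ?thesis
            by (simp only: power_mult_distrib power2_eq_square[of "[:1, _:]"] distrib_right
                mult_smult_left mult.assoc)
        qed
        ultimately show ?thesis
          unfolding m U(2) by (simp only: dual_apply_add dual_apply_smult)
      qed
      with plus show ?thesis ..
    next
      case False
      then obtain m where m: "i = 2 * m + 1" using oddE by blast
      then have md: "m \<le> d" using i d by simp
      obtain W where W: "degree W \<le> m" "1 + cheb i = [:1, 1:] * W\<^sup>2"
        using one_plus_cheb_odd[of m] m by auto
      obtain V where V: "degree V \<le> m" "1 - cheb i = [:1, -1:] * V\<^sup>2"
        using one_minus_cheb_odd[of m] m by auto
      show ?thesis
        unfolding W(2) V(2) using y1[of V] y2[of W] W(1) V(1) md unfolding w by simp
    qed
  qed
  moreover have "dual_apply D y (1 + cheb i) = y $ 0 + y $ i"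
    using dual_apply_cheb[OF i] one by (simp add: dual_apply_add)
  moreover have "dual_apply D y (1 - cheb i) = y $ 0 - y $ i"
    using dual_apply_cheb[OF i, of y] one dual_apply_add[of D y 1 "smult (-1) (cheb i)"]
    by (simp only: dual_apply_smult) simp
  ultimately show ?thesis
    by (simp add: abs_le_iff)
qed

section \<open>The maximum norm on the dual cone\<close>

lemma linf_norm_le:
  assumes "dim_vec v > 0" "\<And>i. i < dim_vec v \<Longrightarrow> \<bar>v $ i\<bar> \<le> b"
  shows "linf_norm v \<le> b"
  unfolding linf_norm_def using assms by (subst Max_le_iff) auto

lemma le_linf_norm: "i < dim_vec v \<Longrightarrow> \<bar>v $ i\<bar> \<le> linf_norm v"
  unfolding linf_norm_def by (intro Max_ge) auto

lemma linf_norm_Sigma_dual: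
  assumes D: "D \<ge> 2" and y: "y \<in> Sigma_dual D"
  shows "linf_norm y = y $ 0"
proof (rule antisym)
  have dim: "dim_vec y = D + 1"
    using Sigma_dual_carrier[OF y] by simp
  show "linf_norm y \<le> y $ 0"
    using dim Sigma_dual_dominated[OF D y] by (intro linf_norm_le) auto
  show "y $ 0 \<le> linf_norm y"
    using le_linf_norm[of 0 y] dim by simp
qed

lemma one_coeffs_scalar_prod:
  "y \<in> carrier_vec (D + 1) \<Longrightarrow> one_coeffs D \<bullet> y = y $ 0"
  by (simp add: one_coeffs_def)

text \<open>On the dual cone, the maximum norm and the product with \<open>one_coeffs D\<close> are
  both the zeroth coordinate, so only the value 1 occurs; \<open>one_coeffs D\<close> itself attains
  it.\<close>

lemma min_one_Sigma_dual:
  assumes D: "D \<ge> 2"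
  shows "\<exists>k \<in> {one_coeffs D \<bullet> v | v. v \<in> Sigma_dual D \<and> linf_norm v = 1}.
    (\<forall>r \<in> {one_coeffs D \<bullet> v | v. v \<in> Sigma_dual D \<and> linf_norm v = 1}. k \<le> r) \<and> k \<ge> 1"
proof -
  have *: "one_coeffs D \<bullet> v = linf_norm v" if "v \<in> Sigma_dual D" for v
    using one_coeffs_scalar_prod[OF Sigma_dual_carrier[OF that]] linf_norm_Sigma_dual[OF D that] by simp
  have 1: "one_coeffs D \<in> Sigma_dual D" "linf_norm (one_coeffs D) = 1"
    using one_in_Sigma_dual[OF D] linf_norm_Sigma_dual[OF D] by (auto simp: one_coeffs_def)
  show ?thesis
    by (intro bexI[of _ 1]) (use 1 in \<open>force simp: *\<close>)+
qed

text \<open>\<open>Lambda_map\<close> prescribes \<open>L\<close> only along the curve of the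
  vectors \<open>cheb_vec D z\<close>. An entry of \<open>L x\<close> is linear in \<open>x\<close>,
  hence given by a coefficient vector \<open>s\<close>, and its values on the curve identify the
  polynomial of \<open>s\<close>.\<close>

lemma Lambda_map_entry:
  assumes L: "Lambda_map D w ps L" and x: "x \<in> carrier_vec (D + 1)"
    and ab: "a < length ps" "b < length ps"
  shows "L x $$ (a, b) = dual_apply D x (w * (ps ! a * ps ! b))"
proof -
  define \<phi> where "\<phi> x = L x $$ (a, b)" for x
  have carr: "L x \<in> carrier_mat (length ps) (length ps)" if "x \<in> carrier_vec (D + 1)" for x
    using L that by (simp add: Lambda_map_def)
  have "linear_functional (D + 1) \<phi>"
    using L ab by (simp add: linear_functional_def \<phi>_def Lambda_map_def)
      (simp add: carrier_matD[OF carr])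
  then have expand: "\<phi> x = (\<Sum>i<D + 1. x $ i * \<phi> (unit_vec (D + 1) i))"
    if "x \<in> carrier_vec (D + 1)" for x
    using linear_functional_expand that by blast
  define s where "s = vec (D + 1) (\<lambda>i. \<phi> (unit_vec (D + 1) i))"
  have s: "s \<in> carrier_vec (D + 1)"
    by (simp add: s_def)
  have sx: "s \<bullet> x = \<phi> x" if "x \<in> carrier_vec (D + 1)" for x
    unfolding expand[OF that] using that
    by (auto simp: s_def scalar_prod_def atLeast0LessThan intro!: sum.cong)
  have "poly (poly_of_vec s) z = poly (w * (ps ! a * ps ! b)) z" for z
  proof -
    have c: "cheb_vec D z \<in> carrier_vec (D + 1)"
      by (simp add: cheb_vec_def)
    show ?thesis
      unfolding poly_poly_of_vec[OF s] sx[OF c] \<phi>_def using L ab by (simp add: Lambda_map_def)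
  qed
  then have "poly_of_vec s = w * (ps ! a * ps ! b)"
    by (simp add: poly_eq_poly_eq_iff[symmetric] fun_eq_iff)
  then show ?thesis
    using dual_apply_poly_of_vec[OF s x] sx[OF x] by (simp add: \<phi>_def)
qed

definition basis_comb :: "real poly list \<Rightarrow> real vec \<Rightarrow> real poly" where
  "basis_comb ps u = (\<Sum>a<length ps. smult (u $ a) (ps ! a))"

text \<open>This translates semidefiniteness of a block into nonnegativity of the functional on
  weighted squares.\<close>

lemma Lambda_map_quad_form:
  assumes L: "Lambda_map D w ps L" and x: "x \<in> carrier_vec (D + 1)"
    and u: "u \<in> carrier_vec (length ps)"
  shows "u \<bullet> (L x *\<^sub>v u) = dual_apply D x (w * (basis_comb ps u)\<^sup>2)"
proof -
  let ?n = "length ps"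
  have Lx: "L x \<in> carrier_mat ?n ?n"
    using L x by (simp add: Lambda_map_def)
  have "(basis_comb ps u)\<^sup>2 =
      (\<Sum>a<?n. \<Sum>b<?n. smult (u $ a) (ps ! a) * smult (u $ b) (ps ! b))"
    unfolding basis_comb_def power2_eq_square by (rule sum_product)
  then have "w * (basis_comb ps u)\<^sup>2 =
      (\<Sum>a<?n. \<Sum>b<?n. w * (smult (u $ a) (ps ! a) * smult (u $ b) (ps ! b)))"
    by (simp only: sum_distrib_left)
  also have "\<dots> = (\<Sum>a<?n. \<Sum>b<?n. smult (u $ a * u $ b) (w * (ps ! a * ps ! b)))"
    by (intro sum.cong refl) (simp add: mult_ac)
  finally have "w * (basis_comb ps u)\<^sup>2 =
      (\<Sum>a<?n. \<Sum>b<?n. smult (u $ a * u $ b) (w * (ps ! a * ps ! b)))" .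
  then have "dual_apply D x (w * (basis_comb ps u)\<^sup>2) =
      (\<Sum>a<?n. \<Sum>b<?n. u $ a * u $ b * L x $$ (a, b))"
    by (simp add: dual_apply_sum dual_apply_smult Lambda_map_entry[OF L x])
  then show ?thesis
    by (simp add: quad_form_sum[OF Lx u u] mult_ac)
qed

section \<open>Coordinates with respect to an ordered basis\<close>

lemma ordered_basis_degree:
  assumes "ordered_basis k ps"
  shows "degree (basis_comb ps u) \<le> k"
  unfolding basis_comb_def
proof (intro degree_sum_le)
  fix a assume "a \<in> {..<length ps}"
  then have "ps ! a \<in> polys_upto k"
    using assms poly_vs.span_superset[of "set ps"] by (auto simp: ordered_basis_def)
  then show "degree (smult (u $ a) (ps ! a)) \<le> k"
    using degree_smult_le[of "u $ a" "ps ! a"] by (simp add: polys_upto_def)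
qed simp

lemma basis_comb_reindex:
  assumes "distinct ps"
  shows "(\<Sum>v\<in>set ps. smult (f v) v) = basis_comb ps (vec (length ps) (\<lambda>a. f (ps ! a)))"
proof -
  have "bij_betw ((!) ps) {..<length ps} (set ps)"
    using assms by (intro bij_betw_nth) auto
  then show ?thesis
    unfolding basis_comb_def by (subst sum.reindex_bij_betw[symmetric]) auto
qed

lemma ordered_basis_spans:
  assumes b: "ordered_basis k ps" and p: "degree p \<le> k"
  obtains u where "u \<in> carrier_vec (length ps)" "basis_comb ps u = p"
proof -
  have "p \<in> poly_vs.span (set ps)"
    using b p by (simp add: ordered_basis_def polys_upto_def)
  then obtain f where "p = (\<Sum>v\<in>set ps. smult (f v) v)"
    unfolding poly_vs.span_finite[OF finite_set] by blast
  then show thesis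
    using that[of "vec (length ps) (\<lambda>a. f (ps ! a))"] basis_comb_reindex b
    by (simp add: ordered_basis_def)
qed

lemma ordered_basis_independent:
  assumes b: "ordered_basis k ps" and u: "u \<in> carrier_vec (length ps)" and "basis_comb ps u = 0"
  shows "u = 0\<^sub>v (length ps)"
proof -
  have dist: "distinct ps"
    using b by (simp add: ordered_basis_def)
  \<comment> \<open>Moves the coefficients from positions to polynomials, the form in which
    independence is stated; distinctness makes the position unique.\<close>
  define f where "f v = u $ (THE a. a < length ps \<and> ps ! a = v)" for v
  have f: "f (ps ! a) = u $ a" if "a < length ps" for a
  proof -
    have "(THE a'. a' < length ps \<and> ps ! a' = ps ! a) = a"
      using that dist nth_eq_iff_index_eq by (intro the_equality) blast+
    then show ?thesis by (simp add: f_def)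
  qed
  have "vec (length ps) (\<lambda>a. f (ps ! a)) = u"
    using u f by (intro eq_vecI) auto
  then have "(\<Sum>v\<in>set ps. smult (f v) v) = 0"
    using basis_comb_reindex[OF dist, of f] assms(3) by simp
  then have "f v = 0" if "v \<in> set ps" for v
    using poly_vs.independentD[OF _ finite_set subset_refl _ that] b
    by (simp add: ordered_basis_def)
  then show ?thesis
    using u f by (intro eq_vecI) (metis carrier_vecD index_zero_vec nth_mem)+
qed

text \<open>The length bounds the size of the matrices, which enters the final norm bound as the
  trace of the identity.\<close>

lemma ordered_basis_length:
  assumes b: "ordered_basis k ps"
  shows "length ps \<le> k + 1" "length ps > 0"
proof -
  have "set ps \<subseteq> poly_vs.span (cheb ` {..<Suc k})"
  proof
    fix p assume "p \<in> set ps"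
    then have "p \<in> polys_upto k"
      using b poly_vs.span_superset[of "set ps"] by (auto simp: ordered_basis_def)
    then obtain c where p: "p = (\<Sum>i<Suc k. smult (c i) (cheb i))"
      using cheb_expansion by (auto simp: polys_upto_def)
    show "p \<in> poly_vs.span (cheb ` {..<Suc k})"
      unfolding p by (intro poly_vs.span_sum poly_vs.span_scale poly_vs.span_base imageI)
  qed
  then have "card (set ps) \<le> card (cheb ` {..<Suc k})"
    using poly_vs.independent_span_bound[of "cheb ` {..<Suc k}" "set ps"] b
    by (simp add: ordered_basis_def)
  also have "\<dots> \<le> Suc k"
    using card_image_le[of "{..<Suc k}" cheb] by simp
  finally show "length ps \<le> k + 1"
    using b by (simp add: ordered_basis_def distinct_card)
  show "length ps > 0"
  proof (rule ccontr)
    assume "\<not> length ps > 0"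
    then have "polys_upto k = {0}"
      using b by (simp add: ordered_basis_def)
    moreover have "1 \<in> polys_upto k"
      by (simp add: polys_upto_def)
    ultimately show False by auto
  qed
qed

lemma Lambda_map_pos_semidef:
  assumes L: "Lambda_map D w ps L" and b: "ordered_basis k ps" and x: "x \<in> carrier_vec (D + 1)"
  shows "pos_semidef (L x) \<longleftrightarrow> (\<forall>p. degree p \<le> k \<longrightarrow> 0 \<le> dual_apply D x (w * p\<^sup>2))"
proof -
  have "pos_semidef (L x) \<longleftrightarrow>
      (\<forall>u \<in> carrier_vec (length ps). 0 \<le> dual_apply D x (w * (basis_comb ps u)\<^sup>2))"
    unfolding pos_semidef_def using L x by (auto simp: Lambda_map_quad_form[OF L x] Lambda_map_def)
  also have "\<dots> \<longleftrightarrow> (\<forall>p. degree p \<le> k \<longrightarrow> 0 \<le> dual_apply D x (w * p\<^sup>2))"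
    using ordered_basis_degree[OF b] ordered_basis_spans[OF b] by metis
  finally show ?thesis .
qed

text \<open>The form is a mean over \<open>D + 1\<close> nodes at which the weight is positive, and
  a nonzero polynomial of degree at most \<open>D\<close> cannot vanish at all of them.\<close>

lemma Lambda_map_one_pos_def:
  assumes L: "Lambda_map D w ps L" and b: "ordered_basis k ps" and k: "k \<le> D"
    and w: "\<And>z. -1 < z \<Longrightarrow> z < 1 \<Longrightarrow> 0 < poly w z"
  shows "pos_def (L (one_coeffs D))"
proof -
  have x: "one_coeffs D \<in> carrier_vec (D + 1)"
    by (simp add: one_coeffs_def)
  have Lx: "L (one_coeffs D) \<in> carrier_mat (length ps) (length ps)"
    using L x by (simp add: Lambda_map_def)
  show ?thesis
    unfolding pos_def_def
  proof (intro ballI impI)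
    fix u :: "real vec"
    assume "u \<in> carrier_vec (dim_row (L (one_coeffs D)))" "u \<noteq> 0\<^sub>v (dim_row (L (one_coeffs D)))"
    then have u: "u \<in> carrier_vec (length ps)" "u \<noteq> 0\<^sub>v (length ps)"
      using Lx by auto
    let ?p = "basis_comb ps u"
    have "?p \<noteq> 0"
      using ordered_basis_independent[OF b u(1)] u(2) by blast
    moreover have "?p \<in> polys_upto D" "0 \<in> polys_upto D"
      using ordered_basis_degree[OF b, of u] k by (auto simp: polys_upto_def)
    ultimately have "\<not> (\<forall>z \<in> cheb_node D ` {..<D + 1}. poly ?p z = poly 0 z)"
      using unisolvent_cheb_nodes[of D] unfolding unisolvent_def by blast
    then obtain k where k: "k \<le> D" "poly ?p (cheb_node D k) \<noteq> 0"
      by (auto simp: less_Suc_eq_le)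
    have nn: "0 \<le> poly (w * ?p\<^sup>2) (cheb_node D l)" if "l \<le> D" for l
      using w[OF cheb_node_bounds[OF that]] by (simp add: poly_power)
    have "0 < poly (w * ?p\<^sup>2) (cheb_node D k)"
      using w[OF cheb_node_bounds[OF k(1)]] k(2) by (simp add: poly_power)
    then have "0 < (\<Sum>l<D + 1. poly (w * ?p\<^sup>2) (cheb_node D l))"
      using k(1) nn by (intro sum_pos2[of _ k]) auto
    then show "0 < u \<bullet> (L (one_coeffs D) *\<^sub>v u)"
      unfolding Lambda_map_quad_form[OF L x u(1)] dual_apply_one by simp
  qed
qed

section \<open>The direct sum of the two blocks\<close>

lemma Lambda_sum_four_block:
  assumes "L1 x \<in> carrier_mat n1 n1" "L2 x \<in> carrier_mat n2 n2"
  shows "Lambda_sum L1 L2 x = four_block_mat (L1 x) (0\<^sub>m n1 n2) (0\<^sub>m n2 n1) (L2 x)"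
  using assms
  unfolding Lambda_sum_def diag_block_mat.simps(2)[of "L1 x" "[L2 x]"] diag_block_mat_singleton Let_def
  by simp

lemma quad_form_diag_block_split:
  fixes M1 M2 :: "real mat"
  assumes M: "M1 \<in> carrier_mat n1 n1" "M2 \<in> carrier_mat n2 n2" and u: "u \<in> carrier_vec (n1 + n2)"
  obtains u1 u2 where "u1 \<in> carrier_vec n1" "u2 \<in> carrier_vec n2" "u = u1 @\<^sub>v u2"
    "u \<bullet> (four_block_mat M1 (0\<^sub>m n1 n2) (0\<^sub>m n2 n1) M2 *\<^sub>v u) =
      u1 \<bullet> (M1 *\<^sub>v u1) + u2 \<bullet> (M2 *\<^sub>v u2)"
proof -
  have "u = vec_first u n1 @\<^sub>v vec_last u n2"
    using u by simp
  moreover have "vec_first u n1 \<in> carrier_vec n1" "vec_last u n2 \<in> carrier_vec n2"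
    by auto
  ultimately show thesis
    using that quad_form_diag_block[OF M] by metis
qed

lemma pos_semidef_four_block:
  fixes M1 M2 :: "real mat"
  assumes M: "M1 \<in> carrier_mat n1 n1" "M2 \<in> carrier_mat n2 n2"
  shows "pos_semidef (four_block_mat M1 (0\<^sub>m n1 n2) (0\<^sub>m n2 n1) M2) \<longleftrightarrow>
    pos_semidef M1 \<and> pos_semidef M2"
    (is "pos_semidef ?B \<longleftrightarrow> _")
proof (intro iffI conjI)
  have dim: "dim_row ?B = n1 + n2"
    using M by simp
  assume B: "pos_semidef ?B"
  have *: "0 \<le> u1 \<bullet> (M1 *\<^sub>v u1) + u2 \<bullet> (M2 *\<^sub>v u2)"
    if "u1 \<in> carrier_vec n1" "u2 \<in> carrier_vec n2" for u1 u2
    using B that quad_form_diag_block[OF M that] dim unfolding pos_semidef_def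
    by (metis append_carrier_vec)
  have z: "M1 *\<^sub>v 0\<^sub>v n1 = 0\<^sub>v n1" "M2 *\<^sub>v 0\<^sub>v n2 = 0\<^sub>v n2"
    using M by (auto intro!: eq_vecI)
  show "pos_semidef M1" "pos_semidef M2"
    unfolding pos_semidef_def using M *[of _ "0\<^sub>v n2"] *[of "0\<^sub>v n1"] z by auto
next
  assume "pos_semidef M1 \<and> pos_semidef M2"
  then show "pos_semidef ?B"
    unfolding pos_semidef_def
    using M by (auto elim!: quad_form_diag_block_split[OF M])
qed

lemma pos_def_four_block:
  fixes M1 M2 :: "real mat"
  assumes M: "M1 \<in> carrier_mat n1 n1" "M2 \<in> carrier_mat n2 n2" and pd: "pos_def M1" "pos_def M2"
  shows "pos_def (four_block_mat M1 (0\<^sub>m n1 n2) (0\<^sub>m n2 n1) M2)"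
  unfolding pos_def_def
proof (intro ballI impI)
  let ?B = "four_block_mat M1 (0\<^sub>m n1 n2) (0\<^sub>m n2 n1) M2"
  fix u :: "real vec" assume "u \<in> carrier_vec (dim_row ?B)" "u \<noteq> 0\<^sub>v (dim_row ?B)"
  then have u: "u \<in> carrier_vec (n1 + n2)" "u \<noteq> 0\<^sub>v (n1 + n2)"
    using M by auto
  obtain u1 u2 where s: "u1 \<in> carrier_vec n1" "u2 \<in> carrier_vec n2" "u = u1 @\<^sub>v u2"
    and q: "u \<bullet> (?B *\<^sub>v u) = u1 \<bullet> (M1 *\<^sub>v u1) + u2 \<bullet> (M2 *\<^sub>v u2)"
    using quad_form_diag_block_split[OF M u(1)] by metis
  have psd: "0 \<le> u1 \<bullet> (M1 *\<^sub>v u1)" "0 \<le> u2 \<bullet> (M2 *\<^sub>v u2)"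
    using pos_def_imp_pos_semidef[OF M(1) pd(1)] pos_def_imp_pos_semidef[OF M(2) pd(2)] s M
    by (auto simp: pos_semidef_def)
  have "u1 \<noteq> 0\<^sub>v n1 \<or> u2 \<noteq> 0\<^sub>v n2"
    using u(2) s(3) by (auto intro!: eq_vecI)
  then have "0 < u1 \<bullet> (M1 *\<^sub>v u1) \<or> 0 < u2 \<bullet> (M2 *\<^sub>v u2)"
    using pd s M by (auto simp: pos_def_def)
  then show "0 < u \<bullet> (?B *\<^sub>v u)"
    using q psd by linarith
qed

locale cheb_cone =
  fixes D :: nat and ps1 ps2 :: "real poly list" and L1 L2 :: "real vec \<Rightarrow> real mat"
  assumes D: "D \<ge> 2"
    and basis1: "ordered_basis (deg1 D) ps1" and basis2: "ordered_basis (deg2 D) ps2"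
    and Lambda1: "Lambda_map D (weight1 D) ps1 L1" and Lambda2: "Lambda_map D (weight2 D) ps2 L2"
begin

abbreviation "N1 \<equiv> length ps1"
abbreviation "N2 \<equiv> length ps2"

lemma carrier12:
  "x \<in> carrier_vec (D + 1) \<Longrightarrow> L1 x \<in> carrier_mat N1 N1"
  "x \<in> carrier_vec (D + 1) \<Longrightarrow> L2 x \<in> carrier_mat N2 N2"
  using Lambda1 Lambda2 by (simp_all add: Lambda_map_def)

lemmas four_block = Lambda_sum_four_block[of L1 _ N1 L2 N2, OF carrier12]

lemma Sigma_dual_iff_Lambda:
  assumes "x \<in> carrier_vec (D + 1)"
  shows "x \<in> Sigma_dual D \<longleftrightarrow> pos_semidef (Lambda_sum L1 L2 x)"
  using assms unfolding four_block[OF assms assms] pos_semidef_four_block[OF carrier12[OF assms]]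
    Lambda_map_pos_semidef[OF Lambda1 basis1 assms] Lambda_map_pos_semidef[OF Lambda2 basis2 assms]
    Sigma_dual_iff[OF D]
  by simp

lemma size_le: "N1 + N2 \<le> deg1 D + deg2 D + 2" "N1 + N2 > 0"
  using ordered_basis_length[OF basis1] ordered_basis_length[OF basis2] by auto

lemma pos_def_Lambda_one: "pos_def (Lambda_sum L1 L2 (one_coeffs D))"
proof -
  have x: "one_coeffs D \<in> carrier_vec (D + 1)"
    by (simp add: one_coeffs_def)
  have "deg1 D \<le> D" "deg2 D \<le> D"
    by (auto simp: deg1_def deg2_def)
  then show ?thesis
    unfolding four_block[OF x x]
    using Lambda_map_one_pos_def[OF Lambda1 basis1 _ weights_pos(1)]
      Lambda_map_one_pos_def[OF Lambda2 basis2 _ weights_pos(2)]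
    by (intro pos_def_four_block carrier12[OF x]) auto
qed

sublocale lmi "D + 1" "N1 + N2" "Lambda_sum L1 L2"
proof
  fix x :: "real vec" assume x: "x \<in> carrier_vec (D + 1)"
  show c: "Lambda_sum L1 L2 x \<in> carrier_mat (N1 + N2) (N1 + N2)"
    using four_block[OF x x] carrier12[OF x] by simp
  show "(Lambda_sum L1 L2 x)\<^sup>T = Lambda_sum L1 L2 x"
    unfolding four_block[OF x x] using Lambda1 Lambda2 x carrier12[OF x]
    by (subst transpose_four_block_mat[of _ N1 N1 _ N2 _ N2]) (auto simp: Lambda_map_def)
  show "Lambda_sum L1 L2 (x + y) = Lambda_sum L1 L2 x + Lambda_sum L1 L2 y"
    if y: "y \<in> carrier_vec (D + 1)" for y
  proof -
    have xy: "x + y \<in> carrier_vec (D + 1)"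
      using x y by simp
    show ?thesis
      unfolding four_block[OF x x] four_block[OF y y] four_block[OF xy xy]
      using Lambda1 Lambda2 x y carrier12[OF x] carrier12[OF y]
      by (subst add_four_block_mat[of _ N1 N1 _ N2 _ N2]) (auto simp: Lambda_map_def)
  qed
  show smult: "Lambda_sum L1 L2 (c \<cdot>\<^sub>v x) = c \<cdot>\<^sub>m Lambda_sum L1 L2 x" for c
  proof -
    have cx: "c \<cdot>\<^sub>v x \<in> carrier_vec (D + 1)"
      using x by simp
    show ?thesis
      unfolding four_block[OF x x] four_block[OF cx cx]
      using Lambda1 Lambda2 x carrier12[OF x]
      by (subst smult_four_block_mat[of _ N1 N1 _ N2 _ N2]) (auto simp: Lambda_map_def)
  qed
  show "x = 0\<^sub>v (D + 1)" if 0: "Lambda_sum L1 L2 x = 0\<^sub>m (N1 + N2) (N1 + N2)"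
  proof -
    have psd0: "pos_semidef (0\<^sub>m m m)" for m
    proof -
      have "0\<^sub>m m m *\<^sub>v u = 0\<^sub>v m" if "u \<in> carrier_vec m" for u :: "real vec"
        using that by (intro eq_vecI) auto
      then show ?thesis
        by (simp add: pos_semidef_def)
    qed
    \<comment> \<open>The dual cone is pointed: it contains \<open>x\<close> and its negative, so
      every coordinate is bounded in absolute value by both \<open>x $ 0\<close> and
      \<open>- x $ 0\<close>.\<close>
    have "x \<in> Sigma_dual D"
      using Sigma_dual_iff_Lambda[OF x] 0 psd0 by simp
    moreover have "(-1) \<cdot>\<^sub>v x \<in> Sigma_dual D"
      using Sigma_dual_iff_Lambda[of "(-1) \<cdot>\<^sub>v x"] smult[of "-1"] x 0 psd0 by simp
    ultimately have "\<bar>x $ i\<bar> \<le> x $ 0" "\<bar>((-1) \<cdot>\<^sub>v x) $ i\<bar> \<le> ((-1) \<cdot>\<^sub>v x) $ 0" if "i \<le> D" for i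
      using Sigma_dual_dominated[OF D _ that] by blast+
    then show ?thesis
      using x by (intro eq_vecI) (auto simp: less_Suc_eq_le, fastforce)
  qed
qed

end

section \<open>Rounding the analytic center\<close>

lemma l2_norm_square: "(l2_norm t)\<^sup>2 = t \<bullet> t"
  by (simp add: l2_norm_def L2_set_def sum_nonneg scalar_prod_def power2_eq_square atLeast0LessThan)

lemma abs_entry_le_l2_norm:
  assumes "i < dim_vec t"
  shows "\<bar>t $ i\<bar> \<le> l2_norm t"
proof -
  have "(t $ i)\<^sup>2 \<le> (\<Sum>j<dim_vec t. (t $ j)\<^sup>2)"
    using assms by (intro member_le_sum) auto
  then show ?thesis
    by (simp add: l2_norm_def L2_set_def real_le_rsqrt)
qed

text \<open>A negative product would persist near \<open>f\<close>, in particular at members of the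
  cone.\<close>

lemma closure_Sigma_cone_scalar_prod:
  assumes f: "f \<in> euclid_top (D + 1) closure_of Sigma_cone D" and y: "y \<in> Sigma_dual D"
  shows "0 \<le> f \<bullet> y"
proof (rule ccontr)
  interpret M: Metric_space "carrier_vec (D + 1)" "euclid_dist (D + 1)"
    by (rule Metric_space_euclid)
  assume neg: "\<not> 0 \<le> f \<bullet> y"
  define Y where "Y = L2_set (\<lambda>i. y $ i) {..<D + 1}"
  \<comment> \<open>Moving by less than \<open>r\<close> keeps the product at most
    \<open>f \<bullet> y + r * Y\<close>, which is \<open>- r\<close>; the summand 1 keeps the
    denominator positive.\<close>
  define r where "r = - (f \<bullet> y) / (Y + 1)"
  have Y: "Y \<ge> 0"
    by (simp add: Y_def L2_set_nonneg)
  then have r: "r > 0" "r * (Y + 1) = - (f \<bullet> y)"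
    using neg by (simp_all add: r_def divide_neg_pos)
  obtain s where s: "s \<in> Sigma_cone D" "s \<in> M.mball f r" and fc: "f \<in> carrier_vec (D + 1)"
    using f r(1) unfolding euclid_top_def M.metric_closure_of by blast
  have sc: "s \<in> carrier_vec (D + 1)" and dist: "euclid_dist (D + 1) f s < r"
    using s(2) unfolding M.in_mball by blast+
  have yc: "y \<in> carrier_vec (D + 1)"
    by (rule Sigma_dual_carrier[OF y])
  have "s \<bullet> y - f \<bullet> y = (\<Sum>i<D + 1. (s $ i - f $ i) * y $ i)"
    using yc by (simp add: scalar_prod_def atLeast0LessThan left_diff_distrib sum_subtractf)
  also have "\<dots> \<le> (\<Sum>i<D + 1. \<bar>f $ i - s $ i\<bar> * \<bar>y $ i\<bar>)"
    by (intro sum_mono) (metis abs_ge_self abs_mult abs_minus_commute)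
  also have "\<dots> \<le> euclid_dist (D + 1) f s * Y"
    unfolding euclid_dist_def Y_def by (rule L2_set_mult_ineq)
  also have "\<dots> \<le> r * Y"
    using dist Y by (intro mult_right_mono) auto
  finally have "s \<bullet> y \<le> - r"
    using r(2) by (simp add: distrib_left)
  moreover have "0 \<le> s \<bullet> y"
    using y s(1) by (simp add: Sigma_dual_def)
  ultimately show False
    using r(1) by linarith
qed

text \<open>For \<open>d \<ge> 1\<close> the argument is at most \<open>25 * d * d * \<rho>\<close>,
  and \<open>ln 25 \<le> 4\<close> determines the constant. The other logarithms are nonnegative, so
  raising their coefficients to 4 is harmless.\<close>

lemma ln_certificate_bound:
  fixes d :: nat and \<rho> :: real
  assumes "d \<ge> 1" "\<rho> \<ge> 1"
  shows "ln (1 / 2 + 3 * sqrt (2 * real d + 2) * (2 * real d + 2) * \<rho>) \<le> 4 * (1 + ln (real d) + ln \<rho>)"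
proof -
  define a where "a = real d"
  have a: "a \<ge> 1"
    using assms(1) by (simp add: a_def)
  have "sqrt (2 * a + 2) \<le> 2 * a"
  proof (rule real_le_lsqrt)
    have "1 * a \<le> a * a"
      using a by (intro mult_right_mono) auto
    moreover have "(2 * a)\<^sup>2 = 4 * (a * a)"
      by (simp add: power2_eq_square)
    ultimately show "2 * a + 2 \<le> (2 * a)\<^sup>2"
      using a by linarith
  qed (use a in auto)
  then have "3 * sqrt (2 * a + 2) * (2 * a + 2) * \<rho> \<le> 3 * (2 * a) * (4 * a) * \<rho>"
    using a assms(2) by (intro mult_mono) auto
  moreover have "1 \<le> a * a * \<rho>"
    using mult_mono[of 1 a 1 a] mult_mono[of 1 "a * a" 1 \<rho>] a assms(2) by simp
  moreover have "3 * (2 * a) * (4 * a) * \<rho> = 24 * (a * a * \<rho>)"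
    by simp
  ultimately have "1 / 2 + 3 * sqrt (2 * a + 2) * (2 * a + 2) * \<rho> \<le> 25 * (a * a * \<rho>)"
    by linarith
  moreover have "0 < 1 / 2 + 3 * sqrt (2 * a + 2) * (2 * a + 2) * \<rho>"
    using a assms(2) by (intro add_pos_nonneg mult_nonneg_nonneg) auto
  ultimately have "ln (1 / 2 + 3 * sqrt (2 * a + 2) * (2 * a + 2) * \<rho>) \<le> ln (25 * (a * a * \<rho>))"
    by (intro ln_mono) auto
  also have "\<dots> = ln 25 + 2 * ln a + ln \<rho>"
    using a assms(2) by (simp add: ln_mult)
  also have "ln (25 :: real) \<le> 4"
  proof -
    \<comment> \<open>2.5 is the quadratic Taylor polynomial of the exponential at 1.\<close>
    have "(25 :: real) \<le> 2.5 ^ 4"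
      by (simp add: power_divide)
    also have "(2.5 :: real) ^ 4 \<le> exp 1 ^ 4"
    proof (intro power_mono)
      show "2.5 \<le> exp (1 :: real)"
        using exp_lower_Taylor_quadratic[of 1] by simp
    qed simp
    also have "exp 1 ^ 4 = exp (4 :: real)"
      by (simp flip: exp_of_nat_mult)
    finally show ?thesis
      using ln_mono[of "25 :: real" "exp 4"] by simp
  qed
  finally show ?thesis
    using ln_ge_zero[OF a] ln_ge_zero[OF assms(2)] by (simp add: a_def)
qed

text \<open>A discrete Parseval identity.\<close>

lemma sum_squares_orthogonal:
  fixes q :: "nat \<Rightarrow> nat \<Rightarrow> real"
  assumes "\<And>i j. i < n \<Longrightarrow> j < n \<Longrightarrow> (\<Sum>k<m. q k i * q k j) = (if i = j then e i else 0)"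
  shows "(\<Sum>k<m. (\<Sum>i<n. t i * q k i)\<^sup>2) = (\<Sum>i<n. e i * (t i)\<^sup>2)"
proof -
  have "(\<Sum>k<m. (\<Sum>i<n. t i * q k i)\<^sup>2) =
      (\<Sum>k<m. \<Sum>i<n. \<Sum>j<n. t i * t j * (q k i * q k j))"
    unfolding power2_eq_square sum_product by (intro sum.cong refl) (simp add: mult_ac)
  also have "\<dots> = (\<Sum>i<n. \<Sum>k<m. \<Sum>j<n. t i * t j * (q k i * q k j))"
    by (rule sum.swap)
  also have "\<dots> = (\<Sum>i<n. \<Sum>j<n. \<Sum>k<m. t i * t j * (q k i * q k j))"
    by (intro sum.cong refl sum.swap)
  also have "\<dots> = (\<Sum>i<n. \<Sum>j<n. if i = j then e i * (t i)\<^sup>2 else 0)"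
    by (intro sum.cong refl) (simp add: assms flip: sum_distrib_left, simp add: power2_eq_square)
  finally show ?thesis
    by simp
qed

context cheb_cone
begin

text \<open>The trace of the Hessian is controlled by its values at the Chebyshev nodes, where the
  quadratic form is at most the square of the gradient.\<close>

lemma local_form_trace_le:
  assumes A: "A \<in> carrier_mat (N1 + N2) (N1 + N2)" and t: "t \<in> carrier_vec (D + 1)" and c: "c > 0"
    and grad: "\<And>v. v \<in> carrier_vec (D + 1) \<Longrightarrow> t \<bullet> v = c * tr (congr_mat A (Lambda_sum L1 L2 v))"
  shows "(\<Sum>i<D + 1. local_form A (unit_vec (D + 1) i) (unit_vec (D + 1) i)) \<le> 2 * (t \<bullet> t) / c\<^sup>2"
proof -
  define q where "q k = cheb_vec D (cheb_node D k)" for k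
  define e where "e i = (if i = 0 then real D + 1 else (real D + 1) / 2)" for i :: nat
  define F where "F i = local_form A (unit_vec (D + 1) i) (unit_vec (D + 1) i)" for i
  have q: "q k \<in> carrier_vec (D + 1)" for k
    by (simp add: q_def cheb_vec_def)
  have orth: "(\<Sum>k<D + 1. q k $ i * q k $ j) = (if i = j then e i else 0)"
    if "i < D + 1" "j < D + 1" for i j
    using cheb_node_orthogonal[of i D j] that by (simp add: q_def cheb_vec_def e_def)
  have F: "F i \<ge> 0" for i
    by (simp add: F_def local_form_def frob_self_nonneg)
  \<comment> \<open>As \<open>q k\<close> is in the dual cone, its whitened matrix is positive
    semidefinite and its Frobenius norm at most its trace, which the gradient condition
    evaluates.\<close>
  have node: "local_form A (q k) (q k) \<le> (t \<bullet> q k)\<^sup>2 / c\<^sup>2" if k: "k < D + 1" for k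
  proof -
    have "cheb_node D k \<in> {-1..1}"
      using cheb_node_bounds[of k D] k by simp
    then have "pos_semidef (Lambda_sum L1 L2 (q k))"
      using cheb_vec_in_Sigma_dual[OF D] Sigma_dual_iff_Lambda[OF q, of k] unfolding q_def by blast
    then have "local_form A (q k) (q k) \<le> (tr (congr_mat A (Lambda_sum L1 L2 (q k))))\<^sup>2"
      unfolding local_form_def using A L_carrier[OF q] L_sym[OF q]
      by (intro pos_semidef_frob_le_tr[OF congr_mat_carrier[OF A]] transpose_congr_mat
          pos_semidef_congruence) auto
    also have "tr (congr_mat A (Lambda_sum L1 L2 (q k))) = (t \<bullet> q k) / c"
      using grad[OF q] c by simp
    finally show ?thesis
      by (simp add: power_divide)
  qed
  have tt: "t \<bullet> t = (\<Sum>i<D + 1. (t $ i)\<^sup>2)"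
    using t by (simp add: scalar_prod_def power2_eq_square atLeast0LessThan)
  have tq: "t \<bullet> q k = (\<Sum>i<D + 1. t $ i * q k $ i)" for k
    by (simp add: scalar_prod_def atLeast0LessThan carrier_vecD[OF q])
  have "(real D + 1) / 2 * (\<Sum>i<D + 1. F i) = (\<Sum>i<D + 1. (real D + 1) / 2 * F i)"
    by (rule sum_distrib_left)
  \<comment> \<open>The factor 2 in the claim arises from the two weights: the smaller one is used
    on this side, the larger one for \<open>t\<close>.\<close>
  also have "\<dots> \<le> (\<Sum>i<D + 1. e i * F i)"
    using F by (intro sum_mono mult_right_mono) (auto simp: e_def)
  also have "\<dots> = (\<Sum>k<D + 1. local_form A (q k) (q k))"
    unfolding F_def by (rule local_form_orthogonal_sum[OF A q orth, symmetric])
  also have "\<dots> \<le> (\<Sum>k<D + 1. (t \<bullet> q k)\<^sup>2 / c\<^sup>2)"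
    using node by (intro sum_mono) simp
  also have "\<dots> = (\<Sum>k<D + 1. (\<Sum>i<D + 1. t $ i * q k $ i)\<^sup>2) / c\<^sup>2"
    by (simp only: tq sum_divide_distrib)
  also have "\<dots> = (\<Sum>i<D + 1. e i * (t $ i)\<^sup>2) / c\<^sup>2"
    by (subst sum_squares_orthogonal[OF orth]) auto
  also have "\<dots> \<le> (\<Sum>i<D + 1. (real D + 1) * (t $ i)\<^sup>2) / c\<^sup>2"
    by (intro divide_right_mono sum_mono mult_right_mono) (auto simp: e_def)
  also have "\<dots> = (real D + 1) * (t \<bullet> t) / c\<^sup>2"
    by (simp only: tt sum_distrib_left)
  also have "\<dots> = (real D + 1) / 2 * (2 * (t \<bullet> t) / c\<^sup>2)"
    by simp
  finally show ?thesis
    unfolding F_def by (subst (asm) mult_le_cancel_left_pos) auto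
qed

lemma integer_dual_certificate:
  assumes d: "d \<ge> 1" "D \<in> {2 * d, 2 * d + 1}"
    and t: "t \<in> Sigma_cone D" and \<epsilon>: "\<epsilon> > 0"
    and bd: "t - \<epsilon> \<cdot>\<^sub>v one_coeffs D \<in> euclid_top (D + 1) closure_of Sigma_cone D"
  shows "\<exists>y. dual_certificate D L1 L2 t y \<and> (\<forall>i < D + 1. y $ i \<in> \<int>) \<and>
    linf_norm y \<le> 1 / 2 + 3 * sqrt (2 * real d + 2) * (2 * real d + 2) * (l2_norm t / \<epsilon>)"
    "l2_norm t / \<epsilon> \<ge> 1"
proof -
  let ?L = "Lambda_sum L1 L2"
  define N where "N = N1 + N2"
  define u where "u = 2 * real d + 2"
  have N: "real N \<le> u" "N > 0"
    using size_le d by (auto simp: N_def u_def deg1_def deg2_def)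
  have Du: "real (D + 1) \<le> u" "u > 0"
    using d by (auto simp: u_def)
  have tc: "t \<in> carrier_vec (D + 1)"
    using t by (simp add: Sigma_cone_def)
  have e: "one_coeffs D \<in> carrier_vec (D + 1)"
    by (simp add: one_coeffs_def)
  have lower: "\<epsilon> * y $ 0 \<le> t \<bullet> y" if y: "y \<in> Sigma_dual D" for y
  proof -
    have yc: "y \<in> carrier_vec (D + 1)"
      by (rule Sigma_dual_carrier[OF y])
    have "0 \<le> (t - \<epsilon> \<cdot>\<^sub>v one_coeffs D) \<bullet> y"
      by (rule closure_Sigma_cone_scalar_prod[OF bd y])
    also have "\<dots> = t \<bullet> y - \<epsilon> * y $ 0"
      using tc e yc
      by (simp add: minus_scalar_prod_distrib[of _ "D + 1"] one_coeffs_scalar_prod[OF yc])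
    finally show ?thesis by simp
  qed
  \<comment> \<open>The same inequality at \<open>one_coeffs D\<close>. It yields
    \<open>\<epsilon> \<le> l2_norm t\<close>, hence the second conclusion and positivity of
    \<open>c\<close>.\<close>
  have te: "\<epsilon> \<le> t \<bullet> one_coeffs D" "t \<bullet> one_coeffs D = t $ 0"
    using lower[OF one_in_Sigma_dual[OF D]] tc by (simp_all add: one_coeffs_def)
  then have "\<epsilon> \<le> l2_norm t"
    using abs_entry_le_l2_norm[of 0 t] tc by simp
  then show "l2_norm t / \<epsilon> \<ge> 1"
    using \<epsilon> by simp
  \<comment> \<open>\<open>sqrt u\<close> offsets the rounding error of up to 1/2 in at most
    \<open>u\<close> coordinates, and \<open>l2_norm t\<close> cancels \<open>t \<bullet> t\<close>
    in the trace bound; the 3 brings the squared local error down to 1/18.\<close>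
  define c where "c = 3 * sqrt u * l2_norm t"
  have c: "c > 0"
    using Du \<open>\<epsilon> \<le> l2_norm t\<close> \<epsilon> by (simp add: c_def)
  define R where "R = c * real N / \<epsilon>"
  have bounded: "\<bar>y $ i\<bar> \<le> R"
    if "y \<in> carrier_vec (D + 1)" "pos_semidef (?L y)" "t \<bullet> y = c * real N" "i < D + 1" for y i
  proof -
    have y: "y \<in> Sigma_dual D"
      using that Sigma_dual_iff_Lambda by blast
    have "\<bar>y $ i\<bar> \<le> y $ 0"
      using Sigma_dual_dominated[OF D y] that(4) by simp
    also have "\<dots> \<le> R"
      using lower[OF y] \<epsilon> that(3) by (simp add: R_def field_simps)
    finally show ?thesis .
  qed
  have "0 < t \<bullet> one_coeffs D" "0 < c * real N"
    using te \<epsilon> c N(2) by simp_all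
  \<comment> \<open>The level \<open>c * real N\<close> is chosen so that the gradient factor
    becomes \<open>c\<close>.\<close>
  note center = analytic_center_exists[OF tc e pos_def_Lambda_one this N(2)[unfolded N_def], of R]
  obtain y A where y: "y \<in> carrier_vec (D + 1)" "t \<bullet> y = c * real N" "pos_semidef (?L y)"
    and A: "A \<in> carrier_mat (N1 + N2) (N1 + N2)" "congr_mat A (?L y) = 1\<^sub>m (N1 + N2)"
    and grad0: "\<And>v. v \<in> carrier_vec (D + 1) \<Longrightarrow>
      t \<bullet> v = c * real N / real (N1 + N2) * tr (congr_mat A (?L v))"
    by (rule center; (rule bounded | rule that); assumption)
  have grad: "t \<bullet> v = c * tr (congr_mat A (?L v))" if "v \<in> carrier_vec (D + 1)" for v
    using grad0[OF that] N(2) by (simp flip: N_def)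
  define x where "x = vec (D + 1) (\<lambda>i. of_int (round (y $ i)) :: real)"
  define v where "v = x - y"
  have x: "x \<in> carrier_vec (D + 1)" and v: "v \<in> carrier_vec (D + 1)" and yv: "y + v = x"
    using y(1) by (auto simp: x_def v_def intro!: eq_vecI)
  have round: "\<bar>x $ i - y $ i\<bar> \<le> 1 / 2" if "i < D + 1" for i
    using that of_int_round_abs_le[of "y $ i"] by (simp add: x_def)
  define S where "S = (\<Sum>i<D + 1. local_form A (unit_vec (D + 1) i) (unit_vec (D + 1) i))"
  have S0: "S \<ge> 0"
    unfolding S_def local_form_def by (intro sum_nonneg frob_self_nonneg)
  have "S \<le> 2 * (t \<bullet> t) / c\<^sup>2"
    unfolding S_def by (rule local_form_trace_le[OF A(1) tc c grad])
  also have "c\<^sup>2 = 9 * u * (t \<bullet> t)"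
    using Du by (simp add: c_def power_mult_distrib l2_norm_square)
  also have "2 * (t \<bullet> t) / (9 * u * (t \<bullet> t)) = 2 / (9 * u)"
    using c l2_norm_square[of t] by (auto simp: c_def)
  finally have S: "S \<le> 2 / (9 * u)" .
  have vv: "v \<bullet> v \<le> u / 4"
  proof -
    have "v \<bullet> v = (\<Sum>i<D + 1. (x $ i - y $ i)\<^sup>2)"
      using x y(1) by (simp add: v_def scalar_prod_def power2_eq_square atLeast0LessThan)
    also have "\<dots> \<le> (\<Sum>i<D + 1. (1 / 2)\<^sup>2)"
      using round by (intro sum_mono) (metis abs_le_square_iff abs_of_nonneg lessThan_iff
          zero_le_divide_1_iff zero_le_numeral)
    also have "\<dots> = real (D + 1) / 4"
      by (simp add: power2_eq_square)
    finally show ?thesis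
      using Du by simp
  qed
  have vvS: "(v \<bullet> v) * S \<le> 1 / 18"
  proof -
    have "(v \<bullet> v) * S \<le> u / 4 * (2 / (9 * u))"
      using vv S S0 Du by (intro mult_mono) auto
    then show ?thesis
      using Du by simp
  qed
  have near: "local_form A v v < 1"
    using local_form_le[OF A(1) v] vvS by (simp add: S_def)
  have interior: "x \<in> euclid_top (D + 1) interior_of Sigma_dual D"
  proof -
    interpret M: Metric_space "carrier_vec (D + 1)" "euclid_dist (D + 1)"
      by (rule Metric_space_euclid)
    \<comment> \<open>Both \<open>r\<close> and \<open>r * S\<close> are at most 1/2. A point of the
      ball thus has squared local distance at most \<open>2 / 18 + 1 / 2\<close> from
      \<open>y\<close>, which is less than 1.\<close>
    define r where "r = 1 / (2 * (1 + S))"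
    have r: "r > 0"
      using S0 by (simp add: r_def)
    have "M.mball x r \<subseteq> Sigma_dual D"
    proof
      fix z assume "z \<in> M.mball x r"
      then have z: "z \<in> carrier_vec (D + 1)" and dist: "euclid_dist (D + 1) x z < r"
        unfolding M.in_mball by blast+
      define w where "w = z - y"
      have w: "w \<in> carrier_vec (D + 1)" and yw: "y + w = z"
        using y(1) z by (auto simp: w_def intro!: eq_vecI)
      have "w \<bullet> w = (\<Sum>i<D + 1. (w $ i)\<^sup>2)"
        using w by (simp add: scalar_prod_def power2_eq_square atLeast0LessThan)
      also have "\<dots> \<le> (\<Sum>i<D + 1. 2 * (v $ i)\<^sup>2 + 2 * (x $ i - z $ i)\<^sup>2)"
      proof (intro sum_mono)
        fix i assume "i \<in> {..<D + 1}"
        then have wi: "w $ i = v $ i - (x $ i - z $ i)"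
          using x y(1) z by (simp add: w_def v_def)
        have "2 * a\<^sup>2 + 2 * b\<^sup>2 = (a - b)\<^sup>2 + (a + b)\<^sup>2" for a b :: real
          by (simp add: power2_eq_square algebra_simps)
        then show "(w $ i)\<^sup>2 \<le> 2 * (v $ i)\<^sup>2 + 2 * (x $ i - z $ i)\<^sup>2"
          by (simp add: wi)
      qed
      also have "\<dots> = 2 * (v \<bullet> v) + 2 * (euclid_dist (D + 1) x z)\<^sup>2"
        using v by (simp add: scalar_prod_def power2_eq_square atLeast0LessThan sum.distrib
            sum_distrib_left euclid_dist_def L2_set_def sum_nonneg)
      also have "\<dots> \<le> 2 * (v \<bullet> v) + 2 * r\<^sup>2"
        using power_mono[OF less_imp_le[OF dist] M.nonneg, of 2] by simp
      finally have "(w \<bullet> w) * S \<le> (2 * (v \<bullet> v) + 2 * r\<^sup>2) * S"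
        by (rule mult_right_mono[OF _ S0])
      also have "\<dots> = 2 * ((v \<bullet> v) * S) + 2 * (r * (r * S))"
        by (simp add: algebra_simps power2_eq_square)
      also have "r * (r * S) \<le> (1 / 2) * (1 / 2)"
        using S0 by (intro mult_mono) (auto simp: r_def field_simps)
      finally have "local_form A w w < 1"
        using local_form_le[OF A(1) w] vvS by (simp add: S_def)
      then have "pos_def (?L z)"
        using pos_def_L_if_local(2)[OF y(1) A w] yw by simp
      then show "z \<in> Sigma_dual D"
        using Sigma_dual_iff_Lambda[OF z] pos_def_imp_pos_semidef[OF L_carrier[OF z]] by blast
    qed
    then show ?thesis
      unfolding euclid_top_def M.in_interior_of_mball using x r by blast
  qed
  have barrier: "barrier L1 L2 = (\<lambda>x. - ln (det (?L x)))"
    by (simp add: barrier_def fun_eq_iff)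
  have "dual_certificate D L1 L2 t x"
    unfolding dual_certificate_def barrier yv[symmetric]
    using hessian_inverse_in_cone[OF y(1) A tc c grad v near] t interior
    by (simp add: Sigma_dual_iff_Lambda yv)
  moreover have "\<forall>i < D + 1. x $ i \<in> \<int>"
    by (simp add: x_def)
  moreover have "linf_norm x \<le> 1 / 2 + 3 * sqrt u * u * (l2_norm t / \<epsilon>)"
  proof (rule linf_norm_le)
    show "dim_vec x > 0"
      by (simp add: x_def)
    fix i assume "i < dim_vec x"
    then have i: "i < D + 1"
      by (simp add: x_def)
    have "R \<le> 3 * sqrt u * u * (l2_norm t / \<epsilon>)"
    proof -
      have "c * real N / \<epsilon> \<le> c * u / \<epsilon>"
        using c N \<epsilon> by (intro divide_right_mono mult_left_mono) auto
      then show ?thesis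
        by (simp add: R_def c_def mult_ac)
    qed
    then show "\<bar>x $ i\<bar> \<le> 1 / 2 + 3 * sqrt u * u * (l2_norm t / \<epsilon>)"
      using round[OF i] bounded[OF y(1,3,2) i] by linarith
  qed
  ultimately show "\<exists>y. dual_certificate D L1 L2 t y \<and> (\<forall>i < D + 1. y $ i \<in> \<int>) \<and>
    linf_norm y \<le> 1 / 2 + 3 * sqrt (2 * real d + 2) * (2 * real d + 2) * (l2_norm t / \<epsilon>)"
    unfolding u_def by blast
qed

end

theorem theorem3p3:
  "(\<forall>d D :: nat. d \<ge> 1 \<and> D \<in> {2 * d, 2 * d + 1} \<longrightarrow>
      (\<exists>k \<in> {one_coeffs D \<bullet> v | v. v \<in> Sigma_dual D \<and> linf_norm v = 1}.
         (\<forall>r \<in> {one_coeffs D \<bullet> v | v. v \<in> Sigma_dual D \<and> linf_norm v = 1}. k \<le> r) \<and> k \<ge> 1)) \<and>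
   (\<forall>d D :: nat. d \<ge> 1 \<and> D \<in> {2 * d, 2 * d + 1} \<longrightarrow>
      (\<exists>(Z :: real set) (\<alpha> :: real \<Rightarrow> real).
         finite Z \<and> Z \<subseteq> {-1..1} \<and> unisolvent D Z \<and> (\<forall>z \<in> Z. \<alpha> z > 0) \<and>
         cond_number (mat (D + 1) (D + 1)
           (\<lambda>(i, j). \<Sum>z \<in> Z. \<alpha> z * (cheb_vec D z $ i * cheb_vec D z $ j))) \<le> 4)) \<and>
   (\<exists>C :: real. \<forall>(d :: nat) (D :: nat) ps1 ps2 L1 L2 (t :: real vec) (\<epsilon> :: real).
      d \<ge> 1 \<and> D \<in> {2 * d, 2 * d + 1} \<and>
      ordered_basis (deg1 D) ps1 \<and> ordered_basis (deg2 D) ps2 \<and>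
      Lambda_map D (weight1 D) ps1 L1 \<and> Lambda_map D (weight2 D) ps2 L2 \<and>
      t \<in> euclid_top (D + 1) interior_of Sigma_cone D \<and> \<epsilon> > 0 \<and>
      t - \<epsilon> \<cdot>\<^sub>v one_coeffs D \<in> euclid_top (D + 1) frontier_of Sigma_cone D \<longrightarrow>
      (\<exists>y. dual_certificate D L1 L2 t y \<and> (\<forall>i < D + 1. y $ i \<in> \<int>) \<and>
         linf_norm y \<le> 1 / 2 + (2 * real d + 2) / \<epsilon> *
           real_of_int \<lceil>3 * sqrt (2 * real d + 2) * l2_norm t\<rceil> \<and>
         ln (linf_norm y) \<le> C * (1 + ln (real d) + ln (l2_norm t) + ln (1 / \<epsilon>))))"
proof (intro conjI)
  show "\<forall>d D :: nat. d \<ge> 1 \<and> D \<in> {2 * d, 2 * d + 1} \<longrightarrow>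
      (\<exists>k \<in> {one_coeffs D \<bullet> v | v. v \<in> Sigma_dual D \<and> linf_norm v = 1}.
         (\<forall>r \<in> {one_coeffs D \<bullet> v | v. v \<in> Sigma_dual D \<and> linf_norm v = 1}. k \<le> r) \<and> k \<ge> 1)"
    by (intro allI impI min_one_Sigma_dual) auto
  show "\<forall>d D :: nat. d \<ge> 1 \<and> D \<in> {2 * d, 2 * d + 1} \<longrightarrow>
      (\<exists>(Z :: real set) (\<alpha> :: real \<Rightarrow> real).
         finite Z \<and> Z \<subseteq> {-1..1} \<and> unisolvent D Z \<and> (\<forall>z \<in> Z. \<alpha> z > 0) \<and>
         cond_number (mat (D + 1) (D + 1)
           (\<lambda>(i, j). \<Sum>z \<in> Z. \<alpha> z * (cheb_vec D z $ i * cheb_vec D z $ j))) \<le> 4)"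
    by (intro allI impI cheb_nodes_well_conditioned) auto
  show "\<exists>C :: real. \<forall>(d :: nat) (D :: nat) ps1 ps2 L1 L2 (t :: real vec) (\<epsilon> :: real).
      d \<ge> 1 \<and> D \<in> {2 * d, 2 * d + 1} \<and>
      ordered_basis (deg1 D) ps1 \<and> ordered_basis (deg2 D) ps2 \<and>
      Lambda_map D (weight1 D) ps1 L1 \<and> Lambda_map D (weight2 D) ps2 L2 \<and>
      t \<in> euclid_top (D + 1) interior_of Sigma_cone D \<and> \<epsilon> > 0 \<and>
      t - \<epsilon> \<cdot>\<^sub>v one_coeffs D \<in> euclid_top (D + 1) frontier_of Sigma_cone D \<longrightarrow>
      (\<exists>y. dual_certificate D L1 L2 t y \<and> (\<forall>i < D + 1. y $ i \<in> \<int>) \<and>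
         linf_norm y \<le> 1 / 2 + (2 * real d + 2) / \<epsilon> *
           real_of_int \<lceil>3 * sqrt (2 * real d + 2) * l2_norm t\<rceil> \<and>
         ln (linf_norm y) \<le> C * (1 + ln (real d) + ln (l2_norm t) + ln (1 / \<epsilon>)))"
  proof (intro exI[of _ 4] allI impI; elim conjE)
    fix d D :: nat and ps1 ps2 :: "real poly list" and L1 L2 :: "real vec \<Rightarrow> real mat"
      and t :: "real vec" and \<epsilon> :: real
    assume d: "d \<ge> 1" "D \<in> {2 * d, 2 * d + 1}"
      and basis: "ordered_basis (deg1 D) ps1" "ordered_basis (deg2 D) ps2"
      and Lambda: "Lambda_map D (weight1 D) ps1 L1" "Lambda_map D (weight2 D) ps2 L2"
      and t: "t \<in> euclid_top (D + 1) interior_of Sigma_cone D" and \<epsilon>: "\<epsilon> > 0"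
      and bd: "t - \<epsilon> \<cdot>\<^sub>v one_coeffs D \<in> euclid_top (D + 1) frontier_of Sigma_cone D"
    have "D \<ge> 2"
      using d by auto
    then interpret cheb_cone D ps1 ps2 L1 L2
      using basis Lambda by (intro cheb_cone.intro)
    have t': "t \<in> Sigma_cone D"
      using interior_of_subset t by (rule subsetD)
    have bd': "t - \<epsilon> \<cdot>\<^sub>v one_coeffs D \<in> euclid_top (D + 1) closure_of Sigma_cone D"
      using bd by (simp add: frontier_of_def)
    define \<rho> where "\<rho> = l2_norm t / \<epsilon>"
    define b where "b = 1 / 2 + 3 * sqrt (2 * real d + 2) * (2 * real d + 2) * \<rho>"
    have \<rho>: "\<rho> \<ge> 1"
      unfolding \<rho>_def by (rule integer_dual_certificate(2)[OF d t' \<epsilon> bd'])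
    obtain y where y: "dual_certificate D L1 L2 t y" "\<forall>i < D + 1. y $ i \<in> \<int>" "linf_norm y \<le> b"
      using integer_dual_certificate(1)[OF d t' \<epsilon> bd'] unfolding b_def \<rho>_def by blast
    have "0 < l2_norm t"
      using \<rho> \<epsilon> by (simp add: \<rho>_def field_simps)
    \<comment> \<open>Either of the two logarithms may be negative; their sum is not, because
      \<open>\<rho> \<ge> 1\<close>.\<close>
    then have ln_\<rho>: "ln (l2_norm t) + ln (1 / \<epsilon>) = ln \<rho>"
      using \<epsilon> by (simp add: \<rho>_def ln_div)
    \<comment> \<open>The ceiling enters as an upper bound of its argument.\<close>
    have "(2 * real d + 2) / \<epsilon> * (3 * sqrt (2 * real d + 2) * l2_norm t) \<le>
        (2 * real d + 2) / \<epsilon> * real_of_int \<lceil>3 * sqrt (2 * real d + 2) * l2_norm t\<rceil>"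
      using \<epsilon> by (intro mult_left_mono le_of_int_ceiling) auto
    then have "b \<le> 1 / 2 + (2 * real d + 2) / \<epsilon> *
        real_of_int \<lceil>3 * sqrt (2 * real d + 2) * l2_norm t\<rceil>"
      by (simp add: b_def \<rho>_def mult_ac)
    moreover have "ln (linf_norm y) \<le> 4 * (1 + ln (real d) + ln (l2_norm t) + ln (1 / \<epsilon>))"
    proof -
      have bound: "ln b \<le> 4 * (1 + ln (real d) + ln \<rho>)"
        unfolding b_def by (rule ln_certificate_bound[OF d(1) \<rho>])
      have "ln (linf_norm y) \<le> 4 * (1 + ln (real d) + ln \<rho>)"
      proof (cases "linf_norm y > 0")
        case True
        then have "ln (linf_norm y) \<le> ln b"
          using y(3) by (intro ln_mono) auto
        then show ?thesis
          using bound by linarith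
      next
        case False
        \<comment> \<open>If the norm is 0, then \<open>ln 0 = 0\<close> by convention, and the
          right-hand side is nonnegative.\<close>
        have "y \<in> Sigma_dual D"
          using y(1) interior_of_subset[of "euclid_top (D + 1)" "Sigma_dual D"]
          by (auto simp: dual_certificate_def)
        then have "0 \<le> linf_norm y"
          using le_linf_norm[of 0 y] Sigma_dual_carrier[of y D] by force
        then have "ln (linf_norm y) = 0"
          using False by simp
        then show ?thesis
          using ln_ge_zero[OF \<rho>] ln_ge_zero[of "real d"] d(1) by simp
      qed
      then show ?thesis
        by (simp add: add.assoc ln_\<rho>)
    qed
    ultimately show "\<exists>y. dual_certificate D L1 L2 t y \<and> (\<forall>i < D + 1. y $ i \<in> \<int>) \<and>
         linf_norm y \<le> 1 / 2 + (2 * real d + 2) / \<epsilon> *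
           real_of_int \<lceil>3 * sqrt (2 * real d + 2) * l2_norm t\<rceil> \<and>
         ln (linf_norm y) \<le> 4 * (1 + ln (real d) + ln (l2_norm t) + ln (1 / \<epsilon>))"
      using y by (intro exI[of _ y]) auto
  qed
qed

end
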